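(* For $n=2q$ even and sufficiently large, among all (not necessarily connected) outerplanar graphs on $n$ vertices, the maximum $\lambda_2$ is uniquely achieved (up to isomorphism) by $2(K_1\vee P_{q-1})$.
   Context: For a graph $G$, $\lambda_1(G)\ge\lambda_2(G)\ge\cdots$ denote the eigenvalues of its adjacency matrix in non-increasing order. A graph is outerplanar if it can be drawn in the plane without crossing edges such that each vertex lies on the outer face. $P_m$ is the path on $m$ vertices, $K_1\vee P_{m}$ is the fan graph, obtained from $P_m$ by adding a new vertex adjacent to every vertex of $P_m$, and $2H$ denotes the disjoint union of two copies of $H$. *)

theory Defs
  imports
    "HOL-Analysis.Analysis"
    "HOL-Computational_Algebra.Polynomial"
    "Jordan_Normal_Form.Char_Poly"
    "Graph_Theory.Graph_Theory"
begin

text \<open>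
  A finite simple graph is a \<^locale>\<open>pair_graph\<close> of the entry Graph Theory: each edge
  between \<open>u\<close> and \<open>v\<close> is represented by the two arcs \<open>(u, v)\<close> and \<open>(v, u)\<close>. For such graphs
  \<^const>\<open>digraph_iso\<close> is graph isomorphism.
\<close>

subsection \<open>Outerplanar graphs\<close>

text \<open>
  A vertex \<open>v\<close> is drawn as the point \<open>p v\<close>, an arc \<open>e\<close> as the injective curve \<open>c e\<close>.
  The two arcs representing one edge run along the same curve in opposite directions.
  The last two conjuncts say that an edge passes through no vertices but its own ends, and that
  distinct edges meet only in vertices, hence only in common ends.
\<close>

definition plane_drawing ::
  "'a pair_pre_digraph \<Rightarrow> ('a \<Rightarrow> complex) \<Rightarrow> ('a \<times> 'a \<Rightarrow> real \<Rightarrow> complex) \<Rightarrow> bool" where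
  "plane_drawing G p c \<longleftrightarrow>
     inj_on p (pverts G) \<and>
     (\<forall>(u, v) \<in> parcs G.
        arc (c (u, v)) \<and> pathstart (c (u, v)) = p u \<and> pathfinish (c (u, v)) = p v \<and>
        c (v, u) = reversepath (c (u, v))) \<and>
     (\<forall>(u, v) \<in> parcs G. path_image (c (u, v)) \<inter> p ` pverts G = {p u, p v}) \<and>
     (\<forall>(u, v) \<in> parcs G. \<forall>(x, y) \<in> parcs G. {u, v} \<noteq> {x, y} \<longrightarrow>
        path_image (c (u, v)) \<inter> path_image (c (x, y)) \<subseteq> p ` pverts G)"

definition drawing_points ::
  "'a pair_pre_digraph \<Rightarrow> ('a \<Rightarrow> complex) \<Rightarrow> ('a \<times> 'a \<Rightarrow> real \<Rightarrow> complex) \<Rightarrow> complex set" where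
  "drawing_points G p c = p ` pverts G \<union> (\<Union>e \<in> parcs G. path_image (c e))"

text \<open>
  The drawing is a compact set, so \<^const>\<open>outside\<close> of it is the unique unbounded component of its
  complement, i.e. the outer face. A vertex lies on a face if it lies on its boundary.
\<close>

definition outerplanar :: "'a pair_pre_digraph \<Rightarrow> bool" where
  "outerplanar G \<longleftrightarrow> pair_graph G \<and>
     (\<exists>p c. plane_drawing G p c \<and>
        (\<forall>v \<in> pverts G. p v \<in> frontier (outside (drawing_points G p c))))"

subsection \<open>Adjacency eigenvalues\<close>

definition adj_matrix :: "'a pair_pre_digraph \<Rightarrow> 'a list \<Rightarrow> real mat" where
  "adj_matrix G vs = mat (length vs) (length vs)
     (\<lambda>(i, j). if (vs ! i, vs ! j) \<in> parcs G then 1 else 0)"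

text \<open>
  The eigenvalues with multiplicity, in non-increasing order. Different enumerations of the vertices
  give permutation-similar matrices, so the choice does not matter. The adjacency matrix is real
  symmetric, so that its characteristic polynomial has only real roots.
\<close>

definition adj_eigenvalues :: "'a pair_pre_digraph \<Rightarrow> real list" where
  "adj_eigenvalues G =
     (let vs = (SOME vs. distinct vs \<and> set vs = pverts G)
      in rev (sorted_list_of_multiset (proots (char_poly (adj_matrix G vs)))))"

text \<open>Eigenvalues are counted from 1. This is meaningful for \<open>1 \<le> k \<le> card (pverts G)\<close>.\<close>

definition graph_lambda :: "nat \<Rightarrow> 'a pair_pre_digraph \<Rightarrow> real" where
  "graph_lambda k G = adj_eigenvalues G ! (k - 1)"

subsection \<open>Graph constructions\<close>

definition disjoint_union ::
  "'a pair_pre_digraph \<Rightarrow> 'b pair_pre_digraph \<Rightarrow> ('a + 'b) pair_pre_digraph" where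
  "disjoint_union G H =
     \<lparr> pverts = pverts G <+> pverts H,
       parcs = map_prod Inl Inl ` parcs G \<union> map_prod Inr Inr ` parcs H \<rparr>"

definition graph_join ::
  "'a pair_pre_digraph \<Rightarrow> 'b pair_pre_digraph \<Rightarrow> ('a + 'b) pair_pre_digraph" where
  "graph_join G H =
     \<lparr> pverts = pverts G <+> pverts H,
       parcs = parcs (disjoint_union G H)
         \<union> (Inl ` pverts G \<times> Inr ` pverts H) \<union> (Inr ` pverts H \<times> Inl ` pverts G) \<rparr>"

definition K1 :: "unit pair_pre_digraph" where
  "K1 = \<lparr> pverts = {()}, parcs = {} \<rparr>"

definition path_graph :: "nat \<Rightarrow> nat pair_pre_digraph" where
  "path_graph m =
     \<lparr> pverts = {..<m}, parcs = {(i, j). i < m \<and> j < m \<and> (j = Suc i \<or> i = Suc j)} \<rparr>"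

end

theory Submission
  imports Defs
begin

text \<open>
  Let \<open>F\<close> be the fan on \<open>q\<close> vertices. The second eigenvalue of \<open>2F\<close> is the spectral radius
  \<open>\<mu>\<close> of \<open>F\<close>, because an eigenvector of \<open>F\<close> can be placed on either copy. For the upper
  bound, let \<open>G\<close> be outerplanar on \<open>2q\<close> vertices and take orthogonal eigenvectors for its two
  largest eigenvalues. From them one obtains two nonzero nonnegative vectors \<open>u\<close>, \<open>v\<close> with
  disjoint supports, each of Rayleigh quotient at least \<open>\<lambda>\<^sub>2(G)\<close>: the positive and
  negative parts of an eigenvector that changes sign, or else the two eigenvectors themselves
  (\<open>exists_nodal_pair\<close>). One of the supports has at most \<open>q\<close> vertices, so the bound
  \<open>\<lambda>\<^sub>2(G) \<le> \<mu>\<close> follows once \<open>F\<close> is known to be the unique outerplanar graph on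
  \<open>q\<close> vertices with the largest spectral radius (\<open>form_le_fan_value\<close>). In the case of
  equality both supports induce fans on exactly \<open>q\<close> vertices, and the mixed term
  \<open>u\<^sup>T A v\<close> that was lost in the estimate must vanish, so no edge joins them.

  To compare an outerplanar graph on a vertex set \<open>S\<close> of size \<open>q\<close> with the fan, suppose that its
  spectral radius \<open>\<lambda>\<close> is at least \<open>\<mu> \<ge> \<surd>(q - 1)\<close> and let \<open>x\<close> be a nonnegative
  eigenvector with maximum \<open>x w = 1\<close>. Two vertices have at most two common neighbours, so walks
  of length two are scarce, and this forces all but \<open>O(\<surd>q)\<close> vertices to be neighbours of
  \<open>w\<close>, all other entries of \<open>x\<close> to be \<open>O(1/\<surd>q)\<close>, and finally \<open>\<lambda> x v < 1\<close> for
  every \<open>v\<close> in the set \<open>R\<close> of vertices neither equal nor adjacent to \<open>w\<close>. The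
  neighbourhood of \<open>w\<close> induces a linear
  forest, which can be completed to a path through \<open>S - {w}\<close>. Passing from the graph to the fan
  with apex \<open>w\<close> over this path loses at most the edges that meet \<open>R\<close> and gains the edges from
  \<open>w\<close> to \<open>R\<close>. The quadratic form at \<open>x\<close> changes by at least
  \<open>2 \<Sum>\<^sub>v x v (1 - \<lambda> x v)\<close>, summed over \<open>R\<close>, so it does not decrease; since
  \<open>\<lambda> \<ge> \<mu>\<close> it cannot increase either, which leaves only the fan
  (\<open>fan_form_ge\<close>, \<open>is_fan\<close>).

  Everything that this argument needs from outerplanarity is the absence of \<open>K\<^sub>4\<close> and of
  subdivisions of \<open>K\<^sub>2\<^sub>,\<^sub>3\<close>. Both follow from the fact that, of three arcs with common ends in the
  plane, one lies inside the closed curve formed by the other two (\<open>theta_middle_arc\<close>),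
  whereas a vertex on the outer face lies inside no closed curve of the drawing.
\<close>

section \<open>Theta curves in the plane\<close>

lemma two_arcs_Jordan:
  fixes c d :: "real \<Rightarrow> complex"
  assumes "arc c" "pathstart c = a" "pathfinish c = b"
    and "arc d" "pathstart d = a" "pathfinish d = b"
    and "path_image c \<inter> path_image d = {a, b}"
  defines "J \<equiv> path_image c \<union> path_image d"
  shows "inside J \<noteq> {}" "open (inside J)" "Topological_Spaces.connected (inside J)" "Topological_Spaces.connected (outside J)"
    "inside J \<union> outside J = - J" "frontier (inside J) = J"
proof -
  define g where "g = c +++ reversepath d"
  have "simple_path g" unfolding g_def
    using assms by (auto simp: simple_path_join_loop_eq arc_simple_path simple_path_reversepath)
  moreover have "pathfinish g = pathstart g" using assms by (simp add: g_def)
  moreover have "path_image g = J" using assms by (simp add: g_def path_image_join J_def)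
  ultimately show "inside J \<noteq> {}" "open (inside J)" "Topological_Spaces.connected (inside J)" "Topological_Spaces.connected (outside J)"
    "inside J \<union> outside J = - J" "frontier (inside J) = J"
    using Jordan_inside_outside[of g] by auto
qed

lemma arc_not_subset_ends:
  fixes c :: "real \<Rightarrow> complex"
  assumes "arc c"
  shows "\<not> path_image c \<subseteq> {pathstart c, pathfinish c}"
proof
  assume "path_image c \<subseteq> {pathstart c, pathfinish c}"
  moreover have "c (1/2) \<in> path_image c" by (auto simp: path_image_def)
  ultimately have "c (1/2) = c 0 \<or> c (1/2) = c 1" by (auto simp: pathstart_def pathfinish_def)
  then show False using assms unfolding arc_def inj_on_def by force
qed

lemma inside_imp_notin: "x \<in> inside J \<Longrightarrow> x \<notin> J"
  using inside_no_overlap[of J] by blast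

text \<open>If \<open>c1\<close> and \<open>c3\<close> avoid the two regions, then each region is connected and misses the frontier of the
other one. Overlapping regions would therefore coincide, and so would their frontiers
\<open>c1 \<union> c2\<close> and \<open>c2 \<union> c3\<close>.\<close>

lemma inside_disjoint_of_theta:
  fixes c1 c2 c3 :: "real \<Rightarrow> complex"
  assumes 1: "arc c1" "pathstart c1 = a" "pathfinish c1 = b"
    and 2: "arc c2" "pathstart c2 = a" "pathfinish c2 = b"
    and 3: "arc c3" "pathstart c3 = a" "pathfinish c3 = b"
    and 12: "path_image c1 \<inter> path_image c2 = {a, b}"
    and 13: "path_image c1 \<inter> path_image c3 = {a, b}"
    and 23: "path_image c2 \<inter> path_image c3 = {a, b}"
    and n1: "path_image c1 \<inter> inside (path_image c2 \<union> path_image c3) = {}"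
    and n3: "path_image c3 \<inter> inside (path_image c1 \<union> path_image c2) = {}"
  shows "inside (path_image c1 \<union> path_image c2) \<inter> inside (path_image c2 \<union> path_image c3) = {}"
proof (rule ccontr)
  let ?I = "inside (path_image c1 \<union> path_image c2)"
  let ?K = "inside (path_image c2 \<union> path_image c3)"
  assume ne: "?I \<inter> ?K \<noteq> {}"
  note J1 = two_arcs_Jordan[OF 1 2 12] and J2 = two_arcs_Jordan[OF 2 3 23]
  have "?I \<inter> (path_image c1 \<union> path_image c2) = {}" "?K \<inter> (path_image c2 \<union> path_image c3) = {}"
    using inside_imp_notin by blast+
  then have f: "?I \<inter> frontier ?K = {}" "?K \<inter> frontier ?I = {}"
    unfolding J1(6) J2(6) using n1 n3 by (auto dest: inside_imp_notin)
  have "?I \<subseteq> ?K" using connected_Int_frontier[OF J1(3), of ?K] f ne by auto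
  moreover have "?K \<subseteq> ?I" using connected_Int_frontier[OF J2(3), of ?I] f ne by auto
  ultimately have "frontier ?I = frontier ?K" by simp
  then have "path_image c1 \<union> path_image c2 = path_image c2 \<union> path_image c3"
    unfolding J1(6) J2(6) .
  then have "path_image c1 \<subseteq> {a, b}" using 12 13 by blast
  then show False using arc_not_subset_ends[OF 1(1)] 1 by simp
qed

text \<open>Suppose that no arc enters the closed curve formed by the other two, and take \<open>z\<close> inside
\<open>c2 \<union> c3\<close>. Then \<open>z\<close> is outside \<open>c1 \<union> c2\<close> and outside \<open>c1 \<union> c3\<close>. These two curves meet in the
connected set \<open>c1\<close>, so by Janiszewski's theorem \<open>z\<close> can be joined to infinity without
meeting any of the three arcs, a contradiction.\<close>

lemma theta_middle_arc:
  fixes c1 c2 c3 :: "real \<Rightarrow> complex"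
  assumes 1: "arc c1" "pathstart c1 = a" "pathfinish c1 = b"
    and 2: "arc c2" "pathstart c2 = a" "pathfinish c2 = b"
    and 3: "arc c3" "pathstart c3 = a" "pathfinish c3 = b"
    and 12: "path_image c1 \<inter> path_image c2 = {a, b}"
    and 13: "path_image c1 \<inter> path_image c3 = {a, b}"
    and 23: "path_image c2 \<inter> path_image c3 = {a, b}"
  shows "path_image c1 \<inter> inside (path_image c2 \<union> path_image c3) \<noteq> {} \<or>
    path_image c2 \<inter> inside (path_image c1 \<union> path_image c3) \<noteq> {} \<or>
    path_image c3 \<inter> inside (path_image c1 \<union> path_image c2) \<noteq> {}"
proof (rule ccontr)
  let ?P = "path_image c1" and ?Q = "path_image c2" and ?R = "path_image c3"
  assume "\<not> ?thesis"
  then have n: "?P \<inter> inside (?Q \<union> ?R) = {}" "?Q \<inter> inside (?P \<union> ?R) = {}"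
    "?R \<inter> inside (?P \<union> ?Q) = {}" by auto
  have comm: "?R \<inter> ?Q = {a, b}" "?Q \<inter> ?P = {a, b}" "?R \<inter> ?P = {a, b}" using 12 13 23 by auto
  obtain z where z: "z \<in> inside (?Q \<union> ?R)" using two_arcs_Jordan(1)[OF 2 3 23] by blast
  have zT: "z \<notin> ?P" "z \<notin> ?Q" "z \<notin> ?R"
    using z n(1) inside_imp_notin[OF z] by auto
  have "z \<notin> inside (?P \<union> ?Q)"
    using inside_disjoint_of_theta[OF 1 2 3 12 13 23] n z by auto
  then have z12: "z \<in> outside (?P \<union> ?Q)"
    using two_arcs_Jordan(5)[OF 1 2 12] zT by blast
  have "z \<notin> inside (?P \<union> ?R)"
    using inside_disjoint_of_theta[OF 1 3 2 13 12 comm(1)] n z by (auto simp: Un_commute)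
  then have z13: "z \<in> outside (?P \<union> ?R)"
    using two_arcs_Jordan(5)[OF 1 3 13] zT by blast
  have cp: "compact ?P" "compact ?Q" "compact ?R" using 1 2 3 by (simp_all add: compact_arc_image)
  have "outside (?P \<union> ?Q \<union> ?R) \<noteq> {}"
    using cp by (intro outside_bounded_nonempty) (simp add: compact_imp_bounded)
  then obtain y where y: "y \<in> outside (?P \<union> ?Q \<union> ?R)" by blast
  have y': "y \<in> outside (?P \<union> ?Q)" "y \<in> outside (?P \<union> ?R)" "y \<in> outside (?Q \<union> ?R)"
    using y outside_mono[of "?P \<union> ?Q" "?P \<union> ?Q \<union> ?R"] outside_mono[of "?P \<union> ?R" "?P \<union> ?Q \<union> ?R"]
      outside_mono[of "?Q \<union> ?R" "?P \<union> ?Q \<union> ?R"] by auto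
  have A: "connected_component (- (?P \<union> ?Q)) z y"
    unfolding connected_component_def
    using two_arcs_Jordan(4,5)[OF 1 2 12] z12 y'(1) by blast
  have B: "connected_component (- (?P \<union> ?R)) z y"
    unfolding connected_component_def
    using two_arcs_Jordan(4,5)[OF 1 3 13] z13 y'(2) by blast
  have "(?P \<union> ?Q) \<inter> (?P \<union> ?R) = ?P" using 12 13 23 by auto
  then have C: "Topological_Spaces.connected ((?P \<union> ?Q) \<inter> (?P \<union> ?R))"
    using 1 by (simp add: connected_arc_image)
  have "connected_component (- ((?P \<union> ?Q) \<union> (?P \<union> ?R))) z y"
    by (rule Janiszewski[OF _ _ C A B]) (use cp in \<open>simp_all add: compact_imp_closed compact_Un closed_Un\<close>)
  then have "connected_component (- (?Q \<union> ?R)) z y"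
    by (rule connected_component_of_subset) auto
  then have "y \<in> inside (?Q \<union> ?R)" using z by (rule inside_same_component)
  then show False using y'(3) inside_Int_outside by blast
qed

lemma open_arc_subset_inside:
  fixes c :: "real \<Rightarrow> complex"
  assumes "arc c" "pathstart c = a" "pathfinish c = b"
    and sub: "path_image c \<inter> J \<subseteq> {a, b}" and ab: "a \<in> J" "b \<in> J" and J: "closed J"
    and meets: "path_image c \<inter> inside J \<noteq> {}"
  shows "path_image c - {a, b} \<subseteq> inside J"
proof -
  let ?C = "path_image c - {a, b}"
  have con: "Topological_Spaces.connected ?C"
    using connected_simple_path_endless[of c] assms by (simp add: arc_imp_simple_path)
  have "?C \<inter> inside J \<noteq> {}" using meets ab inside_no_overlap[of J] by blast
  then obtain x where x: "x \<in> ?C" "x \<in> inside J" by auto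
  have "y \<in> inside J" if "y \<in> ?C" for y
  proof -
    have "connected_component (- J) x y"
      unfolding connected_component_def using con x that sub by blast
    then show ?thesis using x(2) by (rule inside_same_component)
  qed
  then show ?thesis by blast
qed

section \<open>Paths in a graph and their drawings\<close>

fun list_arcs :: "'a list \<Rightarrow> ('a \<times> 'a) set" where
  "list_arcs (x # y # zs) = insert (x, y) (list_arcs (y # zs))"
| "list_arcs _ = {}"

lemma list_arcs_append:
  "xs \<noteq> [] \<Longrightarrow> ys \<noteq> [] \<Longrightarrow>
    list_arcs (xs @ ys) = insert (last xs, hd ys) (list_arcs xs \<union> list_arcs ys)"
proof (induction xs rule: list_arcs.induct)
  case (1 x y zs)
  then show ?case by auto
next
  case ("2_2" v)
  then show ?case by (cases ys) auto
qed auto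

lemma list_arcs_subset: "list_arcs xs \<subseteq> set xs \<times> set xs"
  by (induction xs rule: list_arcs.induct) auto

lemma list_arcs_distinct_ends: "distinct xs \<Longrightarrow> (u, v) \<in> list_arcs xs \<Longrightarrow> u \<noteq> v"
  by (induction xs rule: list_arcs.induct) auto

text \<open>Two paths that share only their ends have no common edge as soon as one of them has an inner
vertex.\<close>

lemma list_arcs_no_shortcut:
  assumes "distinct (a # xs @ [b])" "xs \<noteq> []" "(u, v) \<in> list_arcs (a # xs @ [b])"
  shows "\<not> {u, v} \<subseteq> {a, b}"
proof -
  obtain x xs' where xs: "xs = x # xs'" using assms(2) by (cases xs) auto
  have "list_arcs (a # xs @ [b]) = insert (a, x) (insert (last xs, b) (list_arcs xs))"
    using list_arcs_append[of xs "[b]"] assms(2) by (simp add: xs)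
  moreover have "last xs \<in> set xs" using assms(2) by simp
  ultimately show ?thesis using assms list_arcs_subset[of xs] xs by auto
qed

lemma pair_graph_arcD:
  assumes "pair_graph G" "(u, v) \<in> parcs G"
  shows "u \<in> pverts G" "v \<in> pverts G" "u \<noteq> v" "(v, u) \<in> parcs G"
proof -
  interpret pair_graph G by (rule assms(1))
  show "u \<in> pverts G" "v \<in> pverts G" using wellformed' assms(2) by blast+
  show "u \<noteq> v" using pair_no_loops[OF assms(2)] by simp
  show "(v, u) \<in> parcs G" using pair_sym_arcs assms(2) by (auto simp: symmetric_def elim: symE)
qed

locale outerplane_graph =
  fixes G :: "'a pair_pre_digraph" and p :: "'a \<Rightarrow> complex"
    and c :: "'a \<times> 'a \<Rightarrow> real \<Rightarrow> complex"
  assumes graph: "pair_graph G" and drawing: "plane_drawing G p c"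
    and outer: "\<And>v. v \<in> pverts G \<Longrightarrow> p v \<in> frontier (outside (drawing_points G p c))"
begin

lemma arc_ends: "(u, v) \<in> parcs G \<Longrightarrow> u \<in> pverts G \<and> v \<in> pverts G"
  using pair_graph_arcD[OF graph] by blast

lemma edge_curve:
  assumes "(u, v) \<in> parcs G"
  shows "arc (c (u, v))" "pathstart (c (u, v)) = p u" "pathfinish (c (u, v)) = p v"
    "path_image (c (u, v)) \<inter> p ` pverts G = {p u, p v}"
  using drawing assms unfolding plane_drawing_def by fast+

lemma inj_p: "inj_on p (pverts G)" using drawing unfolding plane_drawing_def by blast

lemma edges_meet:
  assumes "(u, v) \<in> parcs G" "(x, y) \<in> parcs G" "{u, v} \<noteq> {x, y}"
  shows "path_image (c (u, v)) \<inter> path_image (c (x, y)) \<subseteq> p ` ({u, v} \<inter> {x, y})"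
proof
  fix z assume z: "z \<in> path_image (c (u, v)) \<inter> path_image (c (x, y))"
  then have zp: "z \<in> p ` pverts G" using drawing assms unfolding plane_drawing_def by fast
  have "z \<in> {p u, p v}" "z \<in> {p x, p y}" using edge_curve(4) assms z zp by blast+
  moreover have "u \<in> pverts G" "v \<in> pverts G" "x \<in> pverts G" "y \<in> pverts G"
    using arc_ends assms by auto
  ultimately show "z \<in> p ` ({u, v} \<inter> {x, y})" using inj_p by (auto simp: inj_on_def)
qed

definition curve_of :: "'a list \<Rightarrow> complex set" where
  "curve_of vs = (\<Union>e \<in> list_arcs vs. path_image (c e))"

text \<open>The third hypothesis excludes a common edge. Distinct edges meet only in common ends.\<close>

lemma curves_meet:
  assumes "list_arcs vs \<subseteq> parcs G" "list_arcs ws \<subseteq> parcs G"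
    and "\<And>u v. (u, v) \<in> list_arcs vs \<Longrightarrow> \<not> {u, v} \<subseteq> set ws"
  shows "curve_of vs \<inter> curve_of ws \<subseteq> p ` (set vs \<inter> set ws)"
proof
  fix z assume "z \<in> curve_of vs \<inter> curve_of ws"
  then obtain u v x y where e: "(u, v) \<in> list_arcs vs" "(x, y) \<in> list_arcs ws"
    "z \<in> path_image (c (u, v))" "z \<in> path_image (c (x, y))"
    unfolding curve_of_def by auto
  have s: "u \<in> set vs" "v \<in> set vs" "x \<in> set ws" "y \<in> set ws"
    using e list_arcs_subset by fast+
  have "{u, v} \<noteq> {x, y}" using assms(3)[OF e(1)] s by auto
  then have "z \<in> p ` ({u, v} \<inter> {x, y})" using edges_meet[of u v x y] e assms(1,2) by blast
  then show "z \<in> p ` (set vs \<inter> set ws)" using s by auto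
qed

lemma path_verts: "list_arcs vs \<subseteq> parcs G \<Longrightarrow> 2 \<le> length vs \<Longrightarrow> set vs \<subseteq> pverts G"
proof (induction vs rule: list_arcs.induct)
  case (1 x y zs)
  then show ?case using arc_ends[of x y] by (cases zs) auto
qed auto

lemma path_curve:
  assumes "distinct vs" "2 \<le> length vs" "list_arcs vs \<subseteq> parcs G"
  shows "\<exists>g. arc g \<and> pathstart g = p (hd vs) \<and> pathfinish g = p (last vs) \<and>
    path_image g = curve_of vs"
  using assms
proof (induction vs rule: list_arcs.induct)
  case (1 x y zs)
  show ?case
  proof (cases "zs = []")
    case True
    then show ?thesis using 1(4) edge_curve[of x y] by (auto simp: curve_of_def)
  next
    case False
    then obtain g where g: "arc g" "pathstart g = p y" "pathfinish g = p (last zs)"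
      "path_image g = curve_of (y # zs)" using 1 by (cases zs) auto
    have xy: "(x, y) \<in> parcs G" using 1 by simp
    have "curve_of [x, y] \<inter> curve_of (y # zs) \<subseteq> p ` (set [x, y] \<inter> set (y # zs))"
      using 1 by (intro curves_meet) auto
    then have "path_image (c (x, y)) \<inter> path_image g \<subseteq> {p y}"
      using 1(2) by (auto simp: g(4) curve_of_def)
    then have "arc (c (x, y) +++ g)" using edge_curve[OF xy] g by (intro arc_join) auto
    moreover have "path_image (c (x, y) +++ g) = curve_of (x # y # zs)"
      using edge_curve[OF xy] g by (subst path_image_join) (auto simp: curve_of_def)
    ultimately show ?thesis
      using edge_curve[OF xy] g False by (intro exI[of _ "c (x, y) +++ g"]) simp
  qed
qed auto

text \<open>A point inside a part of the drawing has a neighbourhood that misses the outer face of the whole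
drawing, so it cannot be a vertex on that face.\<close>

lemma vertex_not_inside:
  assumes "v \<in> pverts G" "J \<subseteq> drawing_points G p c" "open (inside J)"
  shows "p v \<notin> inside J"
proof
  assume "p v \<in> inside J"
  moreover have "p v \<in> closure (outside (drawing_points G p c))"
    using outer[OF assms(1)] by (simp add: frontier_def)
  ultimately obtain y where "y \<in> inside J" "y \<in> outside (drawing_points G p c)"
    using assms(3) by (meson disjoint_iff open_Int_closure_eq_empty)
  then show False using outside_mono[OF assms(2)] inside_Int_outside[of J] by blast
qed

lemma curve_of_subset: "list_arcs vs \<subseteq> parcs G \<Longrightarrow> curve_of vs \<subseteq> drawing_points G p c"
  unfolding curve_of_def drawing_points_def by auto

lemma vertex_in_curve:
  assumes "list_arcs vs \<subseteq> parcs G" "2 \<le> length vs" "v \<in> set vs"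
  shows "p v \<in> curve_of vs"
  using assms
proof (induction vs rule: list_arcs.induct)
  case (1 x y zs)
  have "p x \<in> path_image (c (x, y))" "p y \<in> path_image (c (x, y))"
    using edge_curve(4)[of x y] 1(2) by auto
  then show ?case using 1 by (cases zs) (auto simp: curve_of_def)
qed auto

lemma theta_paths:
  assumes d: "distinct (a # xs @ ys @ [b])" and ne: "xs \<noteq> []"
    and ar: "list_arcs (a # xs @ [b]) \<subseteq> parcs G" "list_arcs (a # ys @ [b]) \<subseteq> parcs G"
  shows "curve_of (a # xs @ [b]) \<inter> curve_of (a # ys @ [b]) = {p a, p b}"
proof
  have "curve_of (a # xs @ [b]) \<inter> curve_of (a # ys @ [b])
      \<subseteq> p ` (set (a # xs @ [b]) \<inter> set (a # ys @ [b]))"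
  proof (rule curves_meet[OF ar])
    fix u v assume uv: "(u, v) \<in> list_arcs (a # xs @ [b])"
    then have "\<not> {u, v} \<subseteq> {a, b}" using list_arcs_no_shortcut[of a xs b u v] d ne by auto
    moreover have "u \<in> set (a # xs @ [b])" "v \<in> set (a # xs @ [b])"
      using uv list_arcs_subset by fast+
    ultimately show "\<not> {u, v} \<subseteq> set (a # ys @ [b])" using d by auto
  qed
  also have "\<dots> \<subseteq> {p a, p b}" using d by auto
  finally show "curve_of (a # xs @ [b]) \<inter> curve_of (a # ys @ [b]) \<subseteq> {p a, p b}" .
  show "{p a, p b} \<subseteq> curve_of (a # xs @ [b]) \<inter> curve_of (a # ys @ [b])"
    using vertex_in_curve[OF ar(1)] vertex_in_curve[OF ar(2)] by auto
qed

text \<open>If such a path entered the inside of \<open>J\<close>, all its points except the ends would be there, among them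
the inner vertices, which are on the outer face.\<close>

lemma path_with_inner_vertex_not_inside:
  assumes d: "distinct (a # xs @ [b])" and ne: "xs \<noteq> []"
    and ar: "list_arcs (a # xs @ [b]) \<subseteq> parcs G"
    and J: "J \<subseteq> drawing_points G p c" "closed J" "open (inside J)" "p a \<in> J" "p b \<in> J"
    and meet: "curve_of (a # xs @ [b]) \<inter> J \<subseteq> {p a, p b}"
  shows "curve_of (a # xs @ [b]) \<inter> inside J = {}"
proof (rule ccontr)
  assume m: "curve_of (a # xs @ [b]) \<inter> inside J \<noteq> {}"
  obtain g where g: "arc g" "pathstart g = p a" "pathfinish g = p b"
    "path_image g = curve_of (a # xs @ [b])"
    using path_curve[OF d _ ar] by auto
  have sub: "path_image g - {p a, p b} \<subseteq> inside J"
    using g J meet m by (intro open_arc_subset_inside) auto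
  obtain x where x: "x \<in> set xs" using ne by (cases xs) auto
  have vs: "set (a # xs @ [b]) \<subseteq> pverts G" using path_verts[OF ar] by simp
  have "p x \<in> path_image g" using vertex_in_curve[OF ar] x g by simp
  moreover have "p x \<noteq> p a" "p x \<noteq> p b" using inj_p vs x d by (auto simp: inj_on_def)
  ultimately have "p x \<in> inside J" using sub by auto
  then show False using vertex_not_inside[of x J] J vs x by auto
qed

text \<open>One of the three paths would lie inside the closed curve formed by the other two, but each has an
inner vertex. In other words, the graph contains no subdivision of \<open>K\<^sub>2\<^sub>,\<^sub>3\<close>.\<close>

lemma no_theta:
  assumes d: "distinct (a # xs @ ys @ zs @ [b])" and ne: "xs \<noteq> []" "ys \<noteq> []" "zs \<noteq> []"
    and ar: "list_arcs (a # xs @ [b]) \<subseteq> parcs G" "list_arcs (a # ys @ [b]) \<subseteq> parcs G"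
      "list_arcs (a # zs @ [b]) \<subseteq> parcs G"
  shows False
proof -
  obtain f where f: "arc f" "pathstart f = p a" "pathfinish f = p b"
    "path_image f = curve_of (a # xs @ [b])" using path_curve[OF _ _ ar(1)] d by auto
  obtain g where g: "arc g" "pathstart g = p a" "pathfinish g = p b"
    "path_image g = curve_of (a # ys @ [b])" using path_curve[OF _ _ ar(2)] d by auto
  obtain h where h: "arc h" "pathstart h = p a" "pathfinish h = p b"
    "path_image h = curve_of (a # zs @ [b])" using path_curve[OF _ _ ar(3)] d by auto
  have fg: "path_image f \<inter> path_image g = {p a, p b}"
    unfolding f g using d ne ar by (intro theta_paths) auto
  have fh: "path_image f \<inter> path_image h = {p a, p b}"
    unfolding f h using d ne ar by (intro theta_paths) auto
  have gh: "path_image g \<inter> path_image h = {p a, p b}"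
    unfolding g h using d ne ar by (intro theta_paths) auto
  have D: "path_image f \<subseteq> drawing_points G p c" "path_image g \<subseteq> drawing_points G p c"
    "path_image h \<subseteq> drawing_points G p c" unfolding f g h using ar curve_of_subset by blast+
  have cl: "closed (path_image f)" "closed (path_image g)" "closed (path_image h)"
    using f(1) g(1) h(1) by (auto intro: closed_arc_image)
  have "curve_of (a # zs @ [b]) \<inter> inside (path_image f \<union> path_image g) = {}"
    using d ne ar D cl fg fh gh f g h two_arcs_Jordan(2)[OF f(1-3) g(1-3) fg]
    by (intro path_with_inner_vertex_not_inside) auto
  moreover have "curve_of (a # ys @ [b]) \<inter> inside (path_image f \<union> path_image h) = {}"
    using d ne ar D cl fg fh gh f g h two_arcs_Jordan(2)[OF f(1-3) h(1-3) fh]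
    by (intro path_with_inner_vertex_not_inside) auto
  moreover have "curve_of (a # xs @ [b]) \<inter> inside (path_image g \<union> path_image h) = {}"
    using d ne ar D cl fg fh gh f g h two_arcs_Jordan(2)[OF g(1-3) h(1-3) gh]
    by (intro path_with_inner_vertex_not_inside) auto
  ultimately show False
    using theta_middle_arc[OF f(1-3) g(1-3) h(1-3) fg fh gh] f g h by auto
qed


lemma sym_arcs: "(u, v) \<in> parcs G \<Longrightarrow> (v, u) \<in> parcs G"
  using pair_graph_arcD[OF graph] by blast

lemma edge_image_sym: "(u, v) \<in> parcs G \<Longrightarrow> path_image (c (v, u)) = path_image (c (u, v))"
  using drawing unfolding plane_drawing_def by fastforce

text \<open>Of the three paths from \<open>x\<close> to \<open>z\<close>, only the edge has no inner vertex, so it has to be the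
one inside.\<close>

lemma chord_inside_cycle:
  assumes d: "distinct [x, y, z, t]"
    and ar: "(x, y) \<in> parcs G" "(y, z) \<in> parcs G" "(x, t) \<in> parcs G" "(t, z) \<in> parcs G"
      "(x, z) \<in> parcs G"
  shows "path_image (c (x, z)) - {p x, p z} \<subseteq> inside (curve_of [x, y, z] \<union> curve_of [x, t, z])"
    and "path_image (c (x, z)) \<inter> inside (curve_of [x, y, z] \<union> curve_of [x, t, z]) \<noteq> {}"
proof -
  have ar1: "list_arcs (x # [y] @ [z]) \<subseteq> parcs G" and ar2: "list_arcs (x # [t] @ [z]) \<subseteq> parcs G"
    and ar3: "list_arcs (x # [] @ [z]) \<subseteq> parcs G" using ar by auto
  obtain f where f: "arc f" "pathstart f = p x" "pathfinish f = p z"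
    "path_image f = curve_of (x # [y] @ [z])" using path_curve[OF _ _ ar1] d by auto
  obtain g where g: "arc g" "pathstart g = p x" "pathfinish g = p z"
    "path_image g = curve_of (x # [t] @ [z])" using path_curve[OF _ _ ar2] d by auto
  let ?h = "c (x, z)"
  have h: "arc ?h" "pathstart ?h = p x" "pathfinish ?h = p z"
    "path_image ?h = curve_of (x # [] @ [z])" using edge_curve[OF ar(5)] by (simp_all add: curve_of_def)
  have fg: "path_image f \<inter> path_image g = {p x, p z}"
    unfolding f g using d ar1 ar2 by (intro theta_paths) auto
  have fh: "path_image f \<inter> path_image ?h = {p x, p z}"
    unfolding f h(4) using d ar1 ar3 by (intro theta_paths) auto
  have gh: "path_image g \<inter> path_image ?h = {p x, p z}"
    unfolding g h(4) using d ar2 ar3 by (intro theta_paths) auto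
  have D: "path_image f \<subseteq> drawing_points G p c" "path_image g \<subseteq> drawing_points G p c"
    "path_image ?h \<subseteq> drawing_points G p c" unfolding f g h(4) using ar1 ar2 ar3 curve_of_subset by blast+
  have cl: "closed (path_image f)" "closed (path_image g)" "closed (path_image ?h)"
    using f(1) g(1) h(1) by (auto intro: closed_arc_image)
  have "curve_of (x # [t] @ [z]) \<inter> inside (path_image f \<union> path_image ?h) = {}"
    using d ar2 D cl fg fh gh f g h two_arcs_Jordan(2)[OF f(1-3) h(1-3) fh]
    by (intro path_with_inner_vertex_not_inside) auto
  moreover have "curve_of (x # [y] @ [z]) \<inter> inside (path_image g \<union> path_image ?h) = {}"
    using d ar1 D cl fg fh gh f g h two_arcs_Jordan(2)[OF g(1-3) h(1-3) gh]
    by (intro path_with_inner_vertex_not_inside) auto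
  ultimately have m: "path_image ?h \<inter> inside (path_image f \<union> path_image g) \<noteq> {}"
    using theta_middle_arc[OF f(1-3) g(1-3) h(1-3) fg fh gh] f g by auto
  have "path_image ?h - {p x, p z} \<subseteq> inside (path_image f \<union> path_image g)"
    by (rule open_arc_subset_inside[OF h(1-3) _ _ _ _ m]) (use cl fg fh gh in auto)
  with m show "path_image (c (x, z)) - {p x, p z} \<subseteq> inside (curve_of [x, y, z] \<union> curve_of [x, t, z])"
    "path_image (c (x, z)) \<inter> inside (curve_of [x, y, z] \<union> curve_of [x, t, z]) \<noteq> {}"
    using f g by auto
qed

text \<open>Both diagonals of the 4-cycle \<open>x y z t\<close> run inside it. The diagonal \<open>x z\<close> divides the inside into
two regions, and the diagonal \<open>y t\<close> stays in one of them because it does not meet \<open>x z\<close>. But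
\<open>y\<close> and \<open>t\<close> are not in the closure of the same region.\<close>

lemma no_K4:
  assumes d: "distinct [x, y, z, t]"
    and ar: "(x, y) \<in> parcs G" "(y, z) \<in> parcs G" "(x, t) \<in> parcs G" "(t, z) \<in> parcs G"
      "(x, z) \<in> parcs G" "(y, t) \<in> parcs G"
  shows False
proof -
  have ar1: "list_arcs (x # [y] @ [z]) \<subseteq> parcs G" and ar2: "list_arcs (x # [t] @ [z]) \<subseteq> parcs G"
    and ar3: "list_arcs (x # [] @ [z]) \<subseteq> parcs G" using ar by auto
  obtain f where f: "arc f" "pathstart f = p x" "pathfinish f = p z"
    "path_image f = curve_of (x # [y] @ [z])" using path_curve[OF _ _ ar1] d by auto
  obtain g where g: "arc g" "pathstart g = p x" "pathfinish g = p z"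
    "path_image g = curve_of (x # [t] @ [z])" using path_curve[OF _ _ ar2] d by auto
  let ?h = "c (x, z)" and ?k = "c (y, t)"
  have h: "arc ?h" "pathstart ?h = p x" "pathfinish ?h = p z"
    "path_image ?h = curve_of (x # [] @ [z])" using edge_curve[OF ar(5)] by (simp_all add: curve_of_def)
  have fg: "path_image f \<inter> path_image g = {p x, p z}"
    unfolding f g using d ar1 ar2 by (intro theta_paths) auto
  have fh: "path_image f \<inter> path_image ?h = {p x, p z}"
    unfolding f h(4) using d ar1 ar3 by (intro theta_paths) auto
  have gh: "path_image g \<inter> path_image ?h = {p x, p z}"
    unfolding g h(4) using d ar2 ar3 by (intro theta_paths) auto
  let ?J = "path_image f \<union> path_image g"
  let ?I1 = "inside (path_image f \<union> path_image ?h)" and ?I2 = "inside (path_image g \<union> path_image ?h)"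
  have verts: "x \<in> pverts G" "y \<in> pverts G" "z \<in> pverts G" "t \<in> pverts G"
    using arc_ends ar by blast+
  have m: "path_image ?h \<inter> inside ?J \<noteq> {}" using chord_inside_cycle(2)[OF d ar(1-5)] f g by simp
  have split: "?I1 \<inter> ?I2 = {}" "?I1 \<union> ?I2 \<union> (path_image ?h - {p x, p z}) = inside ?J"
    using split_inside_simple_closed_curve[OF arc_imp_simple_path[OF f(1)] f(2,3)
        arc_imp_simple_path[OF g(1)] g(2,3) arc_imp_simple_path[OF h(1)] h(2,3) _ fg fh gh m]
      inj_p verts d by (auto simp: inj_on_def)
  \<comment> \<open>Seen from either diagonal, the cycle is the same point set.\<close>
  have "curve_of [y, x, t] \<union> curve_of [y, z, t] = ?J"
    using f g edge_image_sym[OF ar(1)] edge_image_sym[OF ar(4)] by (auto simp: curve_of_def)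
  then have "path_image ?k - {p y, p t} \<subseteq> inside ?J"
    using chord_inside_cycle(1)[of y x t z] d ar sym_arcs by auto
  moreover have "path_image ?k \<inter> path_image ?h = {}"
    using edges_meet[OF ar(6,5)] d by auto
  moreover have "?k ` {0<..<1} \<subseteq> path_image ?k - {p y, p t}"
  proof -
    have k: "inj_on ?k {0..1}" "?k 0 = p y" "?k 1 = p t"
      using edge_curve[OF ar(6)] by (auto simp: arc_def pathstart_def pathfinish_def)
    have "?k s \<noteq> ?k 0" "?k s \<noteq> ?k 1" if "s \<in> {0<..<1}" for s
      using inj_onD[OF k(1), of s 0] inj_onD[OF k(1), of s 1] that by auto
    then show ?thesis using k by (auto simp: path_image_def)
  qed
  ultimately have K: "?k ` {0<..<1} \<subseteq> ?I1 \<union> ?I2" using split(2) by blast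
  have ck: "continuous_on {0..1} ?k" using edge_curve(1)[OF ar(6)] by (simp add: arc_def path_def)
  have con: "Topological_Spaces.connected (?k ` {0<..<1})"
    by (rule connected_continuous_image[OF continuous_on_subset[OF ck]]) auto
  have op: "open ?I1" "open ?I2"
    using two_arcs_Jordan(2)[OF f(1-3) h(1-3) fh] two_arcs_Jordan(2)[OF g(1-3) h(1-3) gh] by auto
  have fr: "frontier ?I1 = path_image f \<union> path_image ?h" "frontier ?I2 = path_image g \<union> path_image ?h"
    using two_arcs_Jordan(6)[OF f(1-3) h(1-3) fh] two_arcs_Jordan(6)[OF g(1-3) h(1-3) gh] by auto
  have ends: "{p y, p t} \<subseteq> closure I" if "?k ` {0<..<1} \<subseteq> I" for I
  proof -
    have "?k ` closure {0<..<1} \<subseteq> closure I"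
      by (rule image_closure_subset) (use ck that closure_subset in auto)
    then have "?k 0 \<in> closure I" "?k 1 \<in> closure I" by (simp_all add: image_subset_iff)
    then show ?thesis using edge_curve(2,3)[OF ar(6)] by (simp add: pathstart_def pathfinish_def)
  qed
  have J: "p y \<notin> inside ?J" "p t \<notin> inside ?J"
    using vertex_in_curve[OF ar1, of y] vertex_in_curve[OF ar2, of t] f g
    by (auto dest!: inside_imp_notin)
  have pt: "p v \<in> {p x, p z}" if "p v \<in> path_image ?h" "v \<in> pverts G" for v
    using edge_curve(4)[OF ar(5)] that by auto
  have ne: "p y \<notin> {p x, p z}" "p t \<notin> {p x, p z}"
    using inj_p verts d by (auto simp: inj_on_def)
  have "p y \<in> path_image f" "p t \<in> path_image g"
    using vertex_in_curve[OF ar1, of y] vertex_in_curve[OF ar2, of t] f g by auto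
  then have "p y \<notin> path_image g" "p t \<notin> path_image f" using fg ne by blast+
  moreover have "p y \<notin> path_image ?h" "p t \<notin> path_image ?h"
    using pt[of y] pt[of t] ne verts by blast+
  moreover have "?k ` {0<..<1} \<subseteq> ?I1 \<or> ?k ` {0<..<1} \<subseteq> ?I2"
    using connectedD[OF con op] split(1) K by blast
  ultimately show False
    using ends[of ?I1] ends[of ?I2] J split(2) fr op by (auto simp: frontier_def interior_open)
qed

end

section \<open>Excluded configurations and linear forests\<close>

lemma card_le_2I:
  assumes "\<And>x y z. x \<in> A \<Longrightarrow> y \<in> A \<Longrightarrow> z \<in> A \<Longrightarrow> distinct [x, y, z] \<Longrightarrow> False"
  shows "card A \<le> 2"
proof (rule ccontr)
  assume "\<not> card A \<le> 2"
  then have "3 \<le> card A" by simp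
  then obtain T where "T \<subseteq> A" "card T = 3" by (rule obtain_subset_with_card_n)
  then obtain x y z where "T = {x, y, z}" "distinct [x, y, z]" by (auto simp: card_3_iff)
  then show False using assms[of x y z] \<open>T \<subseteq> A\<close> by auto
qed

text \<open>The excluded configurations are all that is used of outerplanarity from here on. They refer to
the arcs only, so they hold in every induced subgraph.\<close>

locale theta_K4_free =
  fixes E :: "('a \<times> 'a) set"
  assumes sym: "(u, v) \<in> E \<Longrightarrow> (v, u) \<in> E"
    and loopfree: "(v, v) \<notin> E"
    and no_theta: "\<lbrakk>distinct (a # xs @ ys @ zs @ [b]); xs \<noteq> []; ys \<noteq> []; zs \<noteq> [];
      list_arcs (a # xs @ [b]) \<subseteq> E; list_arcs (a # ys @ [b]) \<subseteq> E; list_arcs (a # zs @ [b]) \<subseteq> E\<rbrakk>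
      \<Longrightarrow> False"
    and no_K4: "\<lbrakk>distinct [x, y, z, t]; (x, y) \<in> E; (y, z) \<in> E; (x, t) \<in> E; (t, z) \<in> E;
      (x, z) \<in> E; (y, t) \<in> E\<rbrakk> \<Longrightarrow> False"

lemma outerplanar_theta_K4_free:
  assumes "outerplanar G"
  shows "theta_K4_free (parcs G)"
proof -
  obtain p c where "pair_graph G" "plane_drawing G p c"
    "\<forall>v \<in> pverts G. p v \<in> frontier (outside (drawing_points G p c))"
    using assms unfolding outerplanar_def by blast
  then interpret D: outerplane_graph G p c by (intro outerplane_graph.intro) auto
  show ?thesis
  proof
    show "(u, v) \<in> parcs G \<Longrightarrow> (v, u) \<in> parcs G" for u v by (rule D.sym_arcs)
    show "(v, v) \<notin> parcs G" for v using pair_graph_arcD(3)[OF D.graph] by blast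
  qed (fact D.no_theta D.no_K4)+
qed

context theta_K4_free
begin

text \<open>A path of length two leads from each of \<open>a\<close>, \<open>b\<close>, \<open>c\<close> through a neighbour \<open>a'\<close>, \<open>b'\<close>,
\<open>c'\<close> to \<open>w\<close>. If these neighbours are distinct, there are three disjoint paths from \<open>v\<close> to \<open>w\<close>.
Otherwise two of the paths meet already in a neighbour \<open>m\<close> of \<open>w\<close>, and the third path can be
continued through \<open>w\<close> to \<open>m\<close>.\<close>

lemma no_three_at_distance_2:
  assumes vw: "v \<noteq> w" "(v, w) \<notin> E"
    and d: "distinct [a, b, c]"
    and v: "(v, a) \<in> E" "(v, b) \<in> E" "(v, c) \<in> E"
    and far: "a \<noteq> w" "b \<noteq> w" "c \<noteq> w" "(w, a) \<notin> E" "(w, b) \<notin> E" "(w, c) \<notin> E"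
    and a': "(a, a') \<in> E" "(w, a') \<in> E" and b': "(b, b') \<in> E" "(w, b') \<in> E"
    and c': "(c, c') \<in> E" "(w, c') \<in> E"
  shows False
proof -
  have two: False
    if "distinct [a, b, c]" "(v, a) \<in> E" "(v, b) \<in> E" "(v, c) \<in> E" "a \<noteq> w" "b \<noteq> w" "c \<noteq> w"
      "(w, a) \<notin> E" "(w, b) \<notin> E" "(w, c) \<notin> E" "(a, m) \<in> E" "(b, m) \<in> E" "(w, m) \<in> E"
      "(c, c') \<in> E" "(w, c') \<in> E" for a b c m c'
  proof (cases "c' = m")
    case True
    show False by (rule no_theta[of v "[a]" "[b]" "[c]" m]) (use that True vw sym loopfree in auto)
  next
    case False
    show False
      by (rule no_theta[of v "[a]" "[b]" "[c, c', w]" m]) (use that False vw sym loopfree in auto)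
  qed
  consider "a' = b'" | "a' = c'" | "b' = c'" | "distinct [a', b', c']" by auto
  then show False
  proof cases
    case 1
    show False by (rule two[of a b c a' c']) (use assms 1 in auto)
  next
    case 2
    show False by (rule two[of a c b a' b']) (use assms 2 in auto)
  next
    case 3
    show False by (rule two[of b c a b' a']) (use assms 3 in auto)
  next
    case 4
    show False by (rule no_theta[of v "[a, a']" "[b, b']" "[c, c']" w]) (use assms 4 sym loopfree in auto)
  qed
qed

text \<open>A triangle together with \<open>w\<close> is a \<open>K\<^sub>4\<close>. On a longer cycle, two vertices at distance two
are joined by three disjoint paths: both parts of the cycle, and the path through \<open>w\<close>.\<close>

lemma no_cycle_in_neighbourhood:
  assumes d: "distinct vs" "3 \<le> length vs" and ar: "list_arcs vs \<subseteq> E" "(last vs, hd vs) \<in> E"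
    and nb: "set vs \<subseteq> E `` {w}"
  shows False
proof -
  obtain x y z rest where vs: "vs = x # y # z # rest"
    using d(2) by (auto simp: numeral_3_eq_3 Suc_le_length_iff)
  have w: "w \<notin> set vs" using nb loopfree by auto
  show False
  proof (cases "rest = []")
    case True
    show False by (rule no_K4[of x y z w]) (use vs True d ar nb w sym in auto)
  next
    case False
    have "list_arcs (z # rest @ [x]) \<subseteq> E"
      using ar False list_arcs_append[of "z # rest" "[x]"] by (auto simp: vs)
    then show False
      by (intro no_theta[of z "[w]" "[y]" rest x]) (use vs False d ar nb w sym in auto)
  qed
qed

end

lemma list_arcs_rev: "(u, v) \<in> list_arcs (rev xs) \<longleftrightarrow> (v, u) \<in> list_arcs xs"
proof (induction xs)
  case (Cons x xs)
  then show ?case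
  proof (cases "xs = []")
    case False
    then have "list_arcs (rev (x # xs)) = insert (hd xs, x) (list_arcs (rev xs))"
      by (simp add: list_arcs_append last_rev)
    moreover have "list_arcs (x # xs) = insert (x, hd xs) (list_arcs xs)" using False by (cases xs) auto
    ultimately show ?thesis using Cons by auto
  qed simp
qed simp

lemma list_arcs_split:
  "list_arcs (xs @ u # ys) = list_arcs xs \<union> list_arcs ys \<union>
     (if xs = [] then {} else {(last xs, u)}) \<union> (if ys = [] then {} else {(u, hd ys)})"
proof -
  have "list_arcs (u # ys) = list_arcs ys \<union> (if ys = [] then {} else {(u, hd ys)})"
    by (cases ys) auto
  then show ?thesis by (cases "xs = []") (auto simp: list_arcs_append)
qed

text \<open>The end \<open>u\<close> of a longest path has no neighbour off the path. A neighbour further along the path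
would close a cycle if it were the other end, and would have degree three if it were inner.\<close>

lemma longest_path_end:
  assumes sym: "\<And>u v. (u, v) \<in> E \<Longrightarrow> (v, u) \<in> E" and irr: "\<And>v. (v, v) \<notin> E"
    and deg: "\<And>v x y z. \<lbrakk>v \<in> S; x \<in> S; y \<in> S; z \<in> S; (v, x) \<in> E; (v, y) \<in> E; (v, z) \<in> E;
      distinct [x, y, z]\<rbrakk> \<Longrightarrow> False"
    and acyclic: "\<And>vs. \<lbrakk>distinct vs; 3 \<le> length vs; set vs \<subseteq> S; list_arcs vs \<subseteq> E;
      (last vs, hd vs) \<in> E\<rbrakk> \<Longrightarrow> False"
    and P: "distinct (u # ys)" "set (u # ys) \<subseteq> S" "list_arcs (u # ys) \<subseteq> E"
    and longest: "\<And>Q. \<lbrakk>distinct Q; set Q \<subseteq> S; list_arcs Q \<subseteq> E\<rbrakk> \<Longrightarrow> length Q \<le> length (u # ys)"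
    and uv: "(u, v) \<in> E" "v \<in> S"
  shows "ys \<noteq> [] \<and> v = hd ys"
proof -
  have "v \<in> set (u # ys)"
  proof (rule ccontr)
    assume "v \<notin> set (u # ys)"
    then show False using longest[of "v # u # ys"] P uv sym by auto
  qed
  then have "v \<in> set ys" using uv irr by auto
  then obtain y zs where ys: "ys = y # zs" by (cases ys) auto
  have "v = y"
  proof (rule ccontr)
    assume "v \<noteq> y"
    then obtain as bs where zs: "zs = as @ v # bs"
      using \<open>v \<in> set ys\<close> ys by (auto dest: split_list)
    show False
    proof (cases "bs = []")
      case True
      then show False using acyclic[of "u # ys"] P uv ys zs sym by auto
    next
      case False
      define l h where "l = last (y # as)" and "h = hd bs"
      have "list_arcs ((u # y # as) @ v # bs) \<subseteq> E" using P ys zs by simp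
      then have "(l, v) \<in> E" "(v, h) \<in> E"
        unfolding list_arcs_split using False by (auto simp: l_def h_def)
      moreover have lh: "l \<in> set (y # as)" "h \<in> set bs"
        using False last_in_set[of "y # as"] by (auto simp: l_def h_def)
      have "set (y # as) \<subseteq> S - {u}" "set bs \<subseteq> S - {u}" "set (y # as) \<inter> set bs = {}" "u \<in> S"
        using P ys zs by auto
      then have "l \<in> S" "h \<in> S" "distinct [u, l, h]" "u \<in> S" using lh by auto
      ultimately show False using deg[of v u l h] uv(2) sym[of u v] sym[of l v] uv(1) by simp
    qed
  qed
  then show ?thesis using ys by simp
qed

text \<open>By degree and by \<open>longest_path_end\<close>, the longest path is a component of the induced
subgraph, so it can be split off and the rest treated by induction. The consecutive pairs of the
resulting list contain all edges, but they need not all be edges.\<close>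

lemma linear_forest_covering_path:
  fixes E :: "('a \<times> 'a) set"
  assumes sym: "\<And>u v. (u, v) \<in> E \<Longrightarrow> (v, u) \<in> E" and irr: "\<And>v. (v, v) \<notin> E"
    and "finite S"
    and deg: "\<And>v x y z. \<lbrakk>v \<in> S; x \<in> S; y \<in> S; z \<in> S; (v, x) \<in> E; (v, y) \<in> E; (v, z) \<in> E;
      distinct [x, y, z]\<rbrakk> \<Longrightarrow> False"
    and acyclic: "\<And>vs. \<lbrakk>distinct vs; 3 \<le> length vs; set vs \<subseteq> S; list_arcs vs \<subseteq> E;
      (last vs, hd vs) \<in> E\<rbrakk> \<Longrightarrow> False"
  shows "\<exists>vs. distinct vs \<and> set vs = S \<and>
    (\<forall>u \<in> S. \<forall>v \<in> S. (u, v) \<in> E \<longrightarrow> (u, v) \<in> list_arcs vs \<or> (v, u) \<in> list_arcs vs)"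
  using \<open>finite S\<close> deg acyclic
proof (induction S rule: finite_psubset_induct)
  case (psubset S)
  note deg = psubset.prems(1) and acyclic = psubset.prems(2)
  define good where "good P \<longleftrightarrow> distinct P \<and> set P \<subseteq> S \<and> list_arcs P \<subseteq> E" for P
  have "good []" by (simp add: good_def)
  moreover have "length P < Suc (card S)" if "good P" for P
    using that psubset.hyps(1) by (metis card_mono distinct_card good_def le_imp_less_Suc)
  ultimately obtain P where P: "good P" and longest: "\<And>Q. good Q \<Longrightarrow> length Q \<le> length P"
    using ex_has_greatest_nat[of good "[]" length "Suc (card S)"] by blast
  show ?case
  proof (cases "S = {}")
    case True
    then show ?thesis by (intro exI[of _ "[]"]) auto
  next
    case False
    then obtain s where "s \<in> S" by auto
    then have "good [s]" by (simp add: good_def)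
    then have "P \<noteq> []" using longest[of "[s]"] by auto
    have ends: "ys \<noteq> [] \<and> v = hd ys"
      if "good (u # ys)" "length (u # ys) = length P" "(u, v) \<in> E" "v \<in> S" for u v ys
      by (rule longest_path_end[OF sym irr deg acyclic])
        (use that longest in \<open>auto simp: good_def\<close>)
    have arcs: "(u, v) \<in> list_arcs P \<or> (v, u) \<in> list_arcs P"
      if u: "u \<in> set P" and v: "v \<in> S" "(u, v) \<in> E" for u v
    proof -
      obtain xs ys where split: "P = xs @ u # ys" using u by (auto dest: split_list)
      consider "xs = []" | "ys = []" | "xs \<noteq> []" "ys \<noteq> []" by auto
      then show ?thesis
      proof cases
        case 1
        then show ?thesis using ends[of u ys v] split P v list_arcs_split[of "[]" u ys] by auto
      next
        case 2
        have "rev P = u # rev xs" using split 2 by simp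
        moreover have "good (rev P)" using P sym by (auto simp: good_def list_arcs_rev)
        ultimately have "xs \<noteq> [] \<and> v = last xs"
          using ends[of u "rev xs" v] v by (auto simp: hd_rev simp flip: length_rev[of P])
        then show ?thesis using split by (auto simp: list_arcs_split)
      next
        case 3
        have "(last xs, u) \<in> E" "(u, hd ys) \<in> E"
          using P 3 split by (auto simp: good_def list_arcs_split)
        moreover have lh: "last xs \<in> set xs" "hd ys \<in> set ys" using 3 by auto
        moreover have "set xs \<subseteq> S" "set ys \<subseteq> S" "set xs \<inter> set ys = {}"
          using P split by (auto simp: good_def)
        then have "last xs \<in> S" "hd ys \<in> S" "last xs \<noteq> hd ys" using lh by auto
        ultimately have "v = last xs \<or> v = hd ys"
          using deg[of u v "last xs" "hd ys"] P split v sym by (auto simp: good_def)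
        then show ?thesis using 3 split by (auto simp: list_arcs_split)
      qed
    qed
    have inP: "v \<in> set P" if "u \<in> set P" "v \<in> S" "(u, v) \<in> E" for u v
      using arcs[OF that] list_arcs_subset by fast
    have "S - set P \<subset> S" using P \<open>P \<noteq> []\<close> by (cases P) (auto simp: good_def)
    then have "\<exists>vs. distinct vs \<and> set vs = S - set P \<and> (\<forall>u\<in>S - set P. \<forall>v\<in>S - set P.
        (u, v) \<in> E \<longrightarrow> (u, v) \<in> list_arcs vs \<or> (v, u) \<in> list_arcs vs)"
    proof (rule psubset.IH)
      fix v x y z
      assume "v \<in> S - set P" "x \<in> S - set P" "y \<in> S - set P" "z \<in> S - set P"
        "(v, x) \<in> E" "(v, y) \<in> E" "(v, z) \<in> E" "distinct [x, y, z]"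
      then show False by (intro deg[of v x y z]) simp_all
    next
      fix vs
      assume "distinct vs" "3 \<le> length vs" "set vs \<subseteq> S - set P" "list_arcs vs \<subseteq> E" "(last vs, hd vs) \<in> E"
      then show False by (intro acyclic[of vs]) auto
    qed
    then obtain vs where vs: "distinct vs" "set vs = S - set P"
      "\<forall>u\<in>S - set P. \<forall>v\<in>S - set P.
        (u, v) \<in> E \<longrightarrow> (u, v) \<in> list_arcs vs \<or> (v, u) \<in> list_arcs vs" by blast
    have sub: "list_arcs P \<subseteq> list_arcs (P @ vs)" "list_arcs vs \<subseteq> list_arcs (P @ vs)"
      using list_arcs_append[of P vs] \<open>P \<noteq> []\<close> by (cases "vs = []"; auto)+
    show ?thesis
    proof (intro exI[of _ "P @ vs"] conjI ballI impI)
      show "distinct (P @ vs)" "set (P @ vs) = S" using vs P by (auto simp: good_def)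
      fix u v assume uv: "u \<in> S" "v \<in> S" "(u, v) \<in> E"
      show "(u, v) \<in> list_arcs (P @ vs) \<or> (v, u) \<in> list_arcs (P @ vs)"
      proof (cases "u \<in> set P")
        case True
        then show ?thesis using arcs uv sub by blast
      next
        case False
        then have "v \<notin> set P" using inP uv sym by blast
        then show ?thesis using vs(3) False uv sub by blast
      qed
    qed
  qed
qed

section \<open>Quadratic forms on a finite set\<close>

definition sqnorm :: "'a set \<Rightarrow> ('a \<Rightarrow> real) \<Rightarrow> real" where
  "sqnorm S x = (\<Sum>i\<in>S. (x i)\<^sup>2)"

definition bform :: "('a \<Rightarrow> 'a \<Rightarrow> real) \<Rightarrow> 'a set \<Rightarrow> ('a \<Rightarrow> real) \<Rightarrow> ('a \<Rightarrow> real) \<Rightarrow> real" where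
  "bform a S x y = (\<Sum>i\<in>S. \<Sum>j\<in>S. a i j * x i * y j)"

lemma sqnorm_nonneg: "0 \<le> sqnorm S x"
  unfolding sqnorm_def by (simp add: sum_nonneg)

lemma sqnorm_eq_0_iff: "finite S \<Longrightarrow> sqnorm S x = 0 \<longleftrightarrow> (\<forall>i\<in>S. x i = 0)"
  unfolding sqnorm_def by (simp add: sum_nonneg_eq_0_iff)

lemma bform_cong: "(\<And>i. i \<in> S \<Longrightarrow> x i = x' i) \<Longrightarrow> (\<And>i. i \<in> S \<Longrightarrow> y i = y' i) \<Longrightarrow>
    bform a S x y = bform a S x' y'"
  unfolding bform_def by (intro sum.cong) auto

lemma bform_eq_sum_apply: "bform a S x y = (\<Sum>i\<in>S. x i * (\<Sum>j\<in>S. a i j * y j))"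
  unfolding bform_def by (simp add: sum_distrib_left algebra_simps)

lemma bform_sym:
  assumes "\<And>i j. a i j = a j i"
  shows "bform a S x y = bform a S y x"
  unfolding bform_def by (subst sum.swap) (simp add: assms[of _ _] mult.commute mult.left_commute)

lemma bform_scale: "bform a S (\<lambda>i. r * x i) (\<lambda>i. r * x i) = r\<^sup>2 * bform a S x x"
  unfolding bform_def by (simp add: sum_distrib_left power2_eq_square algebra_simps)

lemma sqnorm_scale: "sqnorm S (\<lambda>i. r * x i) = r\<^sup>2 * sqnorm S x"
  unfolding sqnorm_def by (simp add: sum_distrib_left power_mult_distrib)

lemma bform_perturb:
  assumes "\<And>i j. a i j = a j i"
  shows "bform a S (\<lambda>i. x i + t * z i) (\<lambda>i. x i + t * z i) =
    bform a S x x + 2 * t * bform a S z x + t\<^sup>2 * bform a S z z"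
proof -
  have "bform a S (\<lambda>i. x i + t * z i) (\<lambda>i. x i + t * z i) =
      bform a S x x + t * bform a S x z + t * bform a S z x + t\<^sup>2 * bform a S z z"
    unfolding bform_def
    by (simp add: sum.distrib sum_distrib_left power2_eq_square algebra_simps)
  then show ?thesis using bform_sym[of a S x z] assms by simp
qed

lemma sqnorm_perturb:
  "sqnorm S (\<lambda>i. x i + t * z i) = sqnorm S x + 2 * t * (\<Sum>i\<in>S. z i * x i) + t\<^sup>2 * sqnorm S z"
  unfolding sqnorm_def
  by (simp add: sum.distrib sum_distrib_left power2_eq_square algebra_simps)

text \<open>The unit sphere of the functions that vanish off \<open>S\<close> is a closed subset of a product of compact
intervals, so Tychonoff's theorem makes it compact.\<close>

lemma exists_maximal_quotient:
  fixes a :: "'a \<Rightarrow> 'a \<Rightarrow> real"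
  assumes S: "finite S" "S \<noteq> {}"
  shows "\<exists>x. sqnorm S x = 1 \<and> (\<forall>y. bform a S y y \<le> bform a S x x * sqnorm S y)"
proof -
  define K where "K = {x :: 'a \<Rightarrow> real. (\<forall>i. x i \<in> {-1..1})} \<inter> (\<Inter>i\<in>-S. {x. x i = 0}) \<inter> {x. sqnorm S x = 1}"
  have "compactin (product_topology (\<lambda>_. euclidean) UNIV) (PiE UNIV (\<lambda>_. {-1..1::real}))"
    by (subst compactin_PiE) auto
  then have "compact (PiE (UNIV :: 'a set) (\<lambda>_. {-1..1::real}))"
    by (simp add: euclidean_product_topology)
  moreover have "PiE (UNIV :: 'a set) (\<lambda>_. {-1..1::real}) = {x. (\<forall>i. x i \<in> {-1..1})}"
    by (auto simp: PiE_def)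
  moreover have "closed (\<Inter>i\<in>-S. {x :: 'a \<Rightarrow> real. x i = 0})"
    by (intro closed_INT ballI closed_Collect_eq continuous_intros continuous_on_product_coordinates)
  moreover have "closed {x :: 'a \<Rightarrow> real. sqnorm S x = 1}" unfolding sqnorm_def
    by (intro closed_Collect_eq continuous_intros continuous_on_product_coordinates)
  ultimately have cK: "compact K" unfolding K_def by (intro compact_Int_closed) auto
  have K_I: "(\<lambda>i. if i \<in> S then x i else 0) \<in> K" if "sqnorm S x = 1" for x
  proof -
    have "\<bar>x i\<bar> \<le> 1" if "i \<in> S" for i
    proof -
      have "(x i)\<^sup>2 \<le> sqnorm S x" unfolding sqnorm_def
        by (rule member_le_sum) (use that S in auto)
      then show ?thesis using \<open>sqnorm S x = 1\<close> by (simp add: abs_square_le_1)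
    qed
    moreover have "sqnorm S (\<lambda>i. if i \<in> S then x i else 0) = sqnorm S x"
      unfolding sqnorm_def by (intro sum.cong) auto
    ultimately show ?thesis using that by (auto simp: K_def abs_le_iff minus_le_iff)
  qed
  obtain s where "s \<in> S" using S by auto
  then have "sqnorm S (\<lambda>i. if i = s then 1 else 0) = 1"
    using S by (simp add: sqnorm_def if_distrib[of "\<lambda>t. t\<^sup>2"] sum.delta cong: if_cong)
  then have "K \<noteq> {}" using K_I by blast
  moreover have "continuous_on K (\<lambda>x. bform a S x x)" unfolding bform_def
    by (intro continuous_intros continuous_on_product_coordinates continuous_on_subset[OF continuous_on_product_coordinates]) auto
  ultimately obtain x where x: "x \<in> K" "\<And>y. y \<in> K \<Longrightarrow> bform a S y y \<le> bform a S x x"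
    using continuous_attains_sup[OF cK] by blast
  have "bform a S y y \<le> bform a S x x * sqnorm S y" for y
  proof (cases "sqnorm S y = 0")
    case True
    then have "bform a S y y = 0" using S by (simp add: sqnorm_eq_0_iff bform_def)
    then show ?thesis using True by simp
  next
    case False
    then have pos: "0 < sqnorm S y" using sqnorm_nonneg[of S y] by simp
    define r where "r = 1 / sqrt (sqnorm S y)"
    have r: "r\<^sup>2 = 1 / sqnorm S y" using pos by (simp add: r_def power_divide)
    then have "sqnorm S (\<lambda>i. r * y i) = 1" using pos by (simp add: sqnorm_scale)
    then have "bform a S (\<lambda>i. if i \<in> S then r * y i else 0) (\<lambda>i. if i \<in> S then r * y i else 0) \<le> bform a S x x"
      by (intro x(2) K_I)
    also have "bform a S (\<lambda>i. if i \<in> S then r * y i else 0) (\<lambda>i. if i \<in> S then r * y i else 0) = r\<^sup>2 * bform a S y y"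
      unfolding bform_scale[symmetric] by (intro bform_cong) auto
    finally show ?thesis using pos by (simp add: r field_simps)
  qed
  moreover have "sqnorm S x = 1" using x(1) by (simp add: K_def)
  ultimately show ?thesis by blast
qed

lemma quadratic_dominates_linear:
  fixes b k :: real
  assumes "\<And>t. 2 * t * b \<le> t\<^sup>2 * k"
  shows "b = 0"
proof (rule ccontr)
  assume "b \<noteq> 0"
  define m where "m = \<bar>k\<bar> + 1"
  have m: "0 < m" "k \<le> m" by (auto simp: m_def)
  have "2 * (b / m) * b \<le> (b / m)\<^sup>2 * m"
    using assms[of "b / m"] mult_left_mono[OF m(2), of "(b / m)\<^sup>2"] by simp
  then have "2 * b\<^sup>2 / m \<le> b\<^sup>2 / m" using m by (simp add: power2_eq_square)
  then show False using m \<open>b \<noteq> 0\<close> by (simp add: divide_le_cancel)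
qed

text \<open>The first variation of the form at a maximizer vanishes in every direction; the direction used
is the residual \<open>z\<close> of the eigenvalue equation.\<close>

lemma maximizer_is_eigenvector:
  assumes S: "finite S" and sym: "\<And>i j. a i j = a j i"
    and bound: "\<And>y. bform a S y y \<le> M * sqnorm S y"
    and x: "bform a S x x = M * sqnorm S x"
  shows "\<forall>i\<in>S. (\<Sum>j\<in>S. a i j * x j) = M * x i"
proof -
  define z where "z i = (\<Sum>j\<in>S. a i j * x j) - M * x i" for i
  let ?b = "bform a S z x - M * (\<Sum>i\<in>S. z i * x i)"
  have "2 * t * ?b \<le> t\<^sup>2 * (M * sqnorm S z - bform a S z z)" for t
    using bound[of "\<lambda>i. x i + t * z i"] x
    by (simp add: bform_perturb[OF sym] sqnorm_perturb algebra_simps)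
  then have "?b = 0" by (rule quadratic_dominates_linear)
  moreover have "?b = sqnorm S z"
    unfolding bform_eq_sum_apply sqnorm_def
    by (simp add: sum_distrib_left z_def power2_eq_square algebra_simps flip: sum_subtractf)
  ultimately show ?thesis using S by (simp add: sqnorm_eq_0_iff z_def)
qed

definition top_value :: "('a \<Rightarrow> 'a \<Rightarrow> real) \<Rightarrow> 'a set \<Rightarrow> real" where
  "top_value a S = Sup ((\<lambda>x. bform a S x x) ` {x. sqnorm S x = 1})"

lemma top_value_props:
  assumes S: "finite S" "S \<noteq> {}"
  shows "bform a S y y \<le> top_value a S * sqnorm S y"
    and "\<exists>x. sqnorm S x = 1 \<and> bform a S x x = top_value a S"
proof -
  obtain x where x: "sqnorm S x = 1" "\<And>y. bform a S y y \<le> bform a S x x * sqnorm S y"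
    using exists_maximal_quotient[OF S, of a] by blast
  have "top_value a S = bform a S x x"
    unfolding top_value_def
  proof (rule cSup_eq_maximum)
    show "bform a S x x \<in> (\<lambda>x. bform a S x x) ` {x. sqnorm S x = 1}" using x(1) by blast
    fix z assume "z \<in> (\<lambda>x. bform a S x x) ` {x. sqnorm S x = 1}"
    then obtain y where "z = bform a S y y" "sqnorm S y = 1" by auto
    then show "z \<le> bform a S x x" using x(2)[of y] by simp
  qed
  then show "bform a S y y \<le> top_value a S * sqnorm S y"
    "\<exists>x. sqnorm S x = 1 \<and> bform a S x x = top_value a S" using x by auto
qed

lemma top_value_eigenvector:
  assumes "finite S" "S \<noteq> {}" "\<And>i j. a i j = a j i"
  shows "\<exists>x. sqnorm S x = 1 \<and> (\<forall>i\<in>S. (\<Sum>j\<in>S. a i j * x j) = top_value a S * x i)"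
proof -
  obtain x where "sqnorm S x = 1" "bform a S x x = top_value a S"
    using top_value_props(2)[OF assms(1,2)] by blast
  then show ?thesis
    using maximizer_is_eigenvector[where a = a, OF assms(1,3) top_value_props(1)[OF assms(1,2)], where x = x] by auto
qed

lemma sqnorm_abs: "sqnorm S (\<lambda>i. \<bar>x i\<bar>) = sqnorm S x"
  by (simp add: sqnorm_def)

lemma bform_abs_ge:
  assumes "\<And>i j. 0 \<le> a i j"
  shows "bform a S x x \<le> bform a S (\<lambda>i. \<bar>x i\<bar>) (\<lambda>i. \<bar>x i\<bar>)"
  unfolding bform_def
proof (intro sum_mono)
  fix i j
  have "a i j * (x i * x j) \<le> a i j * (\<bar>x i\<bar> * \<bar>x j\<bar>)"
    using assms by (intro mult_left_mono) (simp_all flip: abs_mult)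
  then show "a i j * x i * x j \<le> a i j * \<bar>x i\<bar> * \<bar>x j\<bar>" by (simp add: mult.assoc)
qed

text \<open>For a nonnegative kernel, taking absolute values does not decrease the quotient.\<close>

lemma abs_maximizer_is_eigenvector:
  assumes "finite S" "S \<noteq> {}" and sym: "\<And>i j. a i j = a j i" and nonneg: "\<And>i j. 0 \<le> a i j"
    and x: "bform a S x x = top_value a S * sqnorm S x"
  shows "\<forall>i\<in>S. (\<Sum>j\<in>S. a i j * \<bar>x j\<bar>) = top_value a S * \<bar>x i\<bar>"
proof (rule maximizer_is_eigenvector[OF assms(1) sym top_value_props(1)[OF assms(1,2)]])
  show "bform a S (\<lambda>i. \<bar>x i\<bar>) (\<lambda>i. \<bar>x i\<bar>) = top_value a S * sqnorm S (\<lambda>i. \<bar>x i\<bar>)"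
    using bform_abs_ge[of a S x] nonneg x top_value_props(1)[OF assms(1,2), of a "\<lambda>i. \<bar>x i\<bar>"]
    by (simp add: sqnorm_abs)
qed

section \<open>The spectral radius of an outerplanar graph\<close>

definition adj :: "('a \<times> 'a) set \<Rightarrow> 'a \<Rightarrow> 'a \<Rightarrow> real" where
  "adj E i j = (if (i, j) \<in> E then 1 else 0)"

definition fan_arcs :: "'a \<Rightarrow> 'a list \<Rightarrow> ('a \<times> 'a) set" where
  "fan_arcs w vs = {w} \<times> set vs \<union> set vs \<times> {w} \<union> list_arcs vs \<union> (list_arcs vs)\<inverse>"

lemma adj_sym: "(\<And>u v. (u, v) \<in> E \<Longrightarrow> (v, u) \<in> E) \<Longrightarrow> adj E i j = adj E j i"
  unfolding adj_def by auto

lemma adj_nonneg: "0 \<le> adj E i j" unfolding adj_def by simp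

lemma fan_arcs_sym: "(u, v) \<in> fan_arcs w vs \<Longrightarrow> (v, u) \<in> fan_arcs w vs"
  unfolding fan_arcs_def by auto

lemma fan_arcs_loopfree: "distinct (w # vs) \<Longrightarrow> (v, v) \<notin> fan_arcs w vs"
  using list_arcs_distinct_ends[of vs v v] unfolding fan_arcs_def by auto

lemma sum_adj: "finite S \<Longrightarrow> (\<Sum>j\<in>S. adj E i j * x j) = (\<Sum>j\<in>{j\<in>S. (i, j) \<in> E}. x j)"
  unfolding adj_def by (simp add: if_distrib[of "\<lambda>t. t * _"] sum.inter_filter cong: if_cong)

text \<open>Here \<open>x\<close> is a nonnegative eigenvector of the graph induced on \<open>S\<close>, scaled so that its maximum \<open>1\<close>
is attained at \<open>w\<close>. The number \<open>k\<close> is the spectral radius of a star on \<open>card S\<close> vertices, and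
\<open>lam\<close> is large in the sense that it is at least \<open>k\<close>. The bound \<open>200\<close> makes
the lower order terms of the following estimates negligible.\<close>

locale perron_vector = theta_K4_free E
  for E :: "('a \<times> 'a) set" +
  fixes S :: "'a set" and x :: "'a \<Rightarrow> real" and lam k :: real and w :: 'a
  assumes finS: "finite S" and wS: "w \<in> S" and xw: "x w = 1"
    and x_nonneg: "i \<in> S \<Longrightarrow> 0 \<le> x i" and x_le_1: "i \<in> S \<Longrightarrow> x i \<le> 1"
    and eigen: "i \<in> S \<Longrightarrow> (\<Sum>j\<in>{j\<in>S. (i, j) \<in> E}. x j) = lam * x i"
    and k: "k\<^sup>2 = real (card S) - 1" "200 \<le> k" "k \<le> lam"
begin

definition nb :: "'a \<Rightarrow> 'a set" where "nb v = {u \<in> S. (v, u) \<in> E}"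

definition R :: "'a set" where "R = S - insert w (nb w)"

text \<open>The vertices at distance two from \<open>w\<close>.\<close>

definition N2 :: "'a set" where "N2 = {t \<in> R. nb t \<inter> nb w \<noteq> {}}"

lemma finite_sets [simp]: "finite (nb v)" "finite R" "finite N2" "finite S"
  using finS by (auto simp: nb_def R_def N2_def)

lemma subsets: "nb v \<subseteq> S" "R \<subseteq> S" "N2 \<subseteq> R" by (auto simp: nb_def R_def N2_def)

lemma nb_sym: "u \<in> S \<Longrightarrow> v \<in> S \<Longrightarrow> u \<in> nb v \<longleftrightarrow> v \<in> nb u"
  using sym by (auto simp: nb_def)

lemma w_notin_nb: "w \<notin> nb w" using loopfree by (simp add: nb_def)

lemma eigen': "i \<in> S \<Longrightarrow> (\<Sum>j\<in>nb i. x j) = lam * x i"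
  using eigen by (simp add: nb_def)

lemma lam_pos: "0 < lam" using k by linarith

lemma common_nb_le_2: "u \<noteq> v \<Longrightarrow> card (nb u \<inter> nb v) \<le> 2"
proof -
  assume "u \<noteq> v"
  show ?thesis
  proof (rule card_le_2I)
    fix a b c assume h: "a \<in> nb u \<inter> nb v" "b \<in> nb u \<inter> nb v" "c \<in> nb u \<inter> nb v" "distinct [a, b, c]"
    show False
      by (rule no_theta[of u "[a]" "[b]" "[c]" v]) (use h \<open>u \<noteq> v\<close> sym loopfree in \<open>auto simp: nb_def\<close>)
  qed
qed

lemma nb_N2_le_2:
  assumes "v \<in> R"
  shows "card (nb v \<inter> N2) \<le> 2"
proof (rule card_le_2I)
  fix a b c assume h: "a \<in> nb v \<inter> N2" "b \<in> nb v \<inter> N2" "c \<in> nb v \<inter> N2" "distinct [a, b, c]"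
  then obtain a' b' c' where "a' \<in> nb a \<inter> nb w" "b' \<in> nb b \<inter> nb w" "c' \<in> nb c \<inter> nb w"
    unfolding N2_def by blast
  then show False
    by (intro no_three_at_distance_2[of v w a b c a' b' c'])
      (use h assms sym in \<open>auto simp: nb_def R_def N2_def\<close>)
qed

lemma sum_x_le_card: "A \<subseteq> S \<Longrightarrow> sum x A \<le> card A"
  using x_le_1 sum_mono[of A x "\<lambda>_. 1"] by auto

text \<open>Both sides are sums over the walks of length two from \<open>v\<close> through \<open>U\<close> to \<open>T\<close>. With the eigenvalue
equation applied at \<open>v\<close> and at its neighbours, this bounds \<open>lam\<^sup>2 * x v\<close> by numbers of common
neighbours.\<close>

lemma sum_two_steps:
  assumes "U \<subseteq> S" "T \<subseteq> S"
  shows "(\<Sum>u\<in>nb v \<inter> U. \<Sum>t\<in>nb u \<inter> T. x t) = (\<Sum>t\<in>T. card (nb v \<inter> nb t \<inter> U) * x t)"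
proof -
  have fin: "finite U" "finite T" using assms finite_subset[OF _ finS] by auto
  have "(\<Sum>u\<in>nb v \<inter> U. \<Sum>t\<in>nb u \<inter> T. x t) = (\<Sum>u\<in>nb v \<inter> U. \<Sum>t\<in>{t\<in>T. t \<in> nb u}. x t)"
    by (intro sum.cong) auto
  also have "\<dots> = (\<Sum>t\<in>T. \<Sum>u\<in>{u. u \<in> nb v \<inter> U \<and> t \<in> nb u}. x t)"
    using fin by (intro sum.swap_restrict) auto
  also have "\<dots> = (\<Sum>t\<in>T. card (nb v \<inter> nb t \<inter> U) * x t)"
  proof (rule sum.cong)
    fix t assume "t \<in> T"
    then have "{u. u \<in> nb v \<inter> U \<and> t \<in> nb u} = nb v \<inter> nb t \<inter> U"
      using assms nb_sym[of t] by auto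
    then show "(\<Sum>u\<in>{u. u \<in> nb v \<inter> U \<and> t \<in> nb u}. x t) = card (nb v \<inter> nb t \<inter> U) * x t"
      by simp
  qed simp
  finally show ?thesis .
qed

lemma two_steps_le:
  assumes "U \<subseteq> S" "T \<subseteq> S" "v \<in> S"
  shows "(\<Sum>u\<in>nb v \<inter> U. \<Sum>t\<in>nb u \<inter> T. x t) \<le> card (nb v \<inter> U) * (if v \<in> T then x v else 0) + 2 * sum x (T - {v})"
proof -
  have fin: "finite T" using assms finite_subset[OF _ finS] by auto
  have "card (nb v \<inter> nb t \<inter> U) * x t \<le> 2 * x t" if "t \<in> T - {v}" for t
  proof -
    have "card (nb v \<inter> nb t \<inter> U) \<le> card (nb v \<inter> nb t)" by (intro card_mono) auto
    also have "\<dots> \<le> 2" using common_nb_le_2[of v t] that by auto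
    finally have "real (card (nb v \<inter> nb t \<inter> U)) \<le> 2" by simp
    then show ?thesis using x_nonneg[of t] that assms by (intro mult_right_mono) auto
  qed
  then have "(\<Sum>t\<in>T - {v}. card (nb v \<inter> nb t \<inter> U) * x t) \<le> 2 * sum x (T - {v})"
    by (subst sum_distrib_left) (intro sum_mono)
  moreover have "(\<Sum>t\<in>T. card (nb v \<inter> nb t \<inter> U) * x t) =
    card (nb v \<inter> U) * (if v \<in> T then x v else 0) + (\<Sum>t\<in>T - {v}. card (nb v \<inter> nb t \<inter> U) * x t)"
    using fin by (cases "v \<in> T") (simp_all add: sum.remove[of T v])
  ultimately show ?thesis using sum_two_steps[OF assms(1,2)] by simp
qed

lemma lam_squared:
  assumes "v \<in> S"
  shows "lam\<^sup>2 * x v = (\<Sum>u\<in>nb v \<inter> S. \<Sum>t\<in>nb u \<inter> S. x t)"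
proof -
  have "(\<Sum>u\<in>nb v \<inter> S. \<Sum>t\<in>nb u \<inter> S. x t) = (\<Sum>u\<in>nb v. lam * x u)"
    by (intro sum.cong) (auto simp: eigen' Int_absorb2 subsets(1) nb_def[of v])
  also have "\<dots> = lam * (lam * x v)" using eigen' assms by (simp flip: sum_distrib_left)
  finally show ?thesis by (simp add: power2_eq_square)
qed

lemma sum_S_split: "sum f S = f w + sum f (nb w) + sum f R" for f :: "'a \<Rightarrow> real"
proof -
  have "S = insert w (nb w) \<union> R" "insert w (nb w) \<inter> R = {}" using wS by (auto simp: R_def nb_def)
  then have "sum f S = sum f (insert w (nb w)) + sum f R" by (metis finite_sets(1,2) finite_insert sum.union_disjoint)
  then show ?thesis using w_notin_nb by simp
qed

lemma card_S: "real (card S) = 1 + card (nb w) + card R"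
  using sum_S_split[of "\<lambda>_. 1"] by simp

text \<open>By the eigenvalue equation the left-hand side is the sum over \<open>u\<close> of \<open>x u\<close> times the number of neighbours
of \<open>u\<close> in \<open>N2\<close>. The edges between \<open>nb w\<close> and \<open>N2\<close> are counted from \<open>N2\<close>, where each vertex has
at most two of them, and each vertex of \<open>R\<close> has at most two neighbours in \<open>N2\<close>.\<close>

lemma sum_N2_le: "lam * sum x N2 \<le> 4 * card R"
proof -
  have N2S: "N2 \<subseteq> S" using subsets by blast
  have "lam * sum x N2 = (\<Sum>t\<in>N2. \<Sum>u\<in>{u\<in>S. u \<in> nb t}. x u)"
    unfolding sum_distrib_left
  proof (rule sum.cong)
    fix t assume "t \<in> N2"
    moreover have "{u\<in>S. u \<in> nb t} = nb t" by (auto simp: nb_def)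
    ultimately show "lam * x t = (\<Sum>u\<in>{u\<in>S. u \<in> nb t}. x u)" using eigen'[of t] N2S by auto
  qed simp
  also have "\<dots> = (\<Sum>u\<in>S. \<Sum>t\<in>{t. t \<in> N2 \<and> u \<in> nb t}. x u)" by (rule sum.swap_restrict) auto
  also have "\<dots> = (\<Sum>u\<in>S. card (nb u \<inter> N2) * x u)"
  proof (rule sum.cong)
    fix u assume "u \<in> S"
    then have "{t. t \<in> N2 \<and> u \<in> nb t} = nb u \<inter> N2" using nb_sym[of u] N2S by auto
    then show "(\<Sum>t\<in>{t. t \<in> N2 \<and> u \<in> nb t}. x u) = card (nb u \<inter> N2) * x u" by simp
  qed simp
  also have "\<dots> = card (nb w \<inter> N2) * x w + (\<Sum>u\<in>nb w. card (nb u \<inter> N2) * x u) + (\<Sum>u\<in>R. card (nb u \<inter> N2) * x u)"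
    by (rule sum_S_split)
  also have "nb w \<inter> N2 = {}" by (auto simp: N2_def R_def)
  also have "(\<Sum>u\<in>nb w. card (nb u \<inter> N2) * x u) \<le> 2 * real (card R)"
  proof -
    have "(\<Sum>u\<in>nb w. card (nb u \<inter> N2) * x u) \<le> (\<Sum>u\<in>nb w. real (card (nb u \<inter> N2)))"
      using x_le_1 subsets(1) by (intro sum_mono) (auto intro!: mult_left_le)
    also have "\<dots> = (\<Sum>u\<in>nb w. \<Sum>t\<in>{t\<in>N2. t \<in> nb u}. 1)"
      by (simp add: Int_def conj_commute)
    also have "\<dots> = (\<Sum>t\<in>N2. \<Sum>u\<in>{u. u \<in> nb w \<and> t \<in> nb u}. 1)" by (rule sum.swap_restrict) auto
    also have "\<dots> \<le> (\<Sum>t\<in>N2. 2)"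
    proof (rule sum_mono)
      fix t assume t: "t \<in> N2"
      then have "{u. u \<in> nb w \<and> t \<in> nb u} = nb w \<inter> nb t" using nb_sym[of t] N2S by (auto simp: nb_def intro: sym)
      moreover have "t \<noteq> w" using t by (auto simp: N2_def R_def)
      ultimately show "(\<Sum>u\<in>{u. u \<in> nb w \<and> t \<in> nb u}. 1) \<le> (2 :: real)"
        using common_nb_le_2[of w t] by simp
    qed
    also have "\<dots> \<le> 2 * real (card R)" using card_mono[OF finite_sets(2) subsets(3)] by simp
    finally show ?thesis .
  qed
  also have "(\<Sum>u\<in>R. card (nb u \<inter> N2) * x u) \<le> (\<Sum>u\<in>R. 2)"
  proof (rule sum_mono)
    fix u assume u: "u \<in> R"
    have "card (nb u \<inter> N2) * x u \<le> 2 * 1"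
      using nb_N2_le_2[OF u] x_le_1[of u] x_nonneg[of u] subsets u by (intro mult_mono) auto
    then show "card (nb u \<inter> N2) * x u \<le> 2" by simp
  qed
  finally show ?thesis by simp
qed

text \<open>Walks of length two from \<open>w\<close> end in \<open>w\<close>, in \<open>nb w\<close> or in \<open>N2\<close>.\<close>

lemma lam_squared_le: "lam\<^sup>2 \<le> card (nb w) + 2 * lam + 2 * sum x N2"
proof -
  have cod: "card (nb w \<inter> nb t) * x t \<le> 2 * x t" if "t \<in> S" "t \<noteq> w" for t
    using common_nb_le_2[of w t] that x_nonneg by (intro mult_right_mono) auto
  have "lam\<^sup>2 = (\<Sum>t\<in>S. card (nb w \<inter> nb t \<inter> S) * x t)"
    using lam_squared[OF wS] sum_two_steps[of S S w] xw by simp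
  also have "\<dots> = (\<Sum>t\<in>S. card (nb w \<inter> nb t) * x t)"
  proof (rule sum.cong)
    fix t
    have "nb w \<inter> nb t \<inter> S = nb w \<inter> nb t" by (auto simp: nb_def)
    then show "real (card (nb w \<inter> nb t \<inter> S)) * x t = real (card (nb w \<inter> nb t)) * x t" by simp
  qed simp
  also have "\<dots> = card (nb w) + (\<Sum>t\<in>nb w. card (nb w \<inter> nb t) * x t) + (\<Sum>t\<in>R. card (nb w \<inter> nb t) * x t)"
    using sum_S_split[of "\<lambda>t. card (nb w \<inter> nb t) * x t"] xw by simp
  also have "(\<Sum>t\<in>nb w. card (nb w \<inter> nb t) * x t) \<le> (\<Sum>t\<in>nb w. 2 * x t)"
    using cod w_notin_nb subsets by (intro sum_mono) auto
  also have "\<dots> = 2 * lam" using eigen'[OF wS] xw by (simp flip: sum_distrib_left)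
  also have "(\<Sum>t\<in>R. card (nb w \<inter> nb t) * x t) = (\<Sum>t\<in>N2. card (nb w \<inter> nb t) * x t)"
    by (rule sum.mono_neutral_right) (auto simp: N2_def Int_commute)
  also have "\<dots> \<le> (\<Sum>t\<in>N2. 2 * x t)"
    using cod by (intro sum_mono) (auto simp: N2_def R_def)
  finally show ?thesis by (simp add: sum_distrib_left)
qed

text \<open>As \<open>k\<^sup>2\<close> is the number of vertices other than \<open>w\<close>, each vertex of \<open>R\<close> is missing from the degree of
\<open>w\<close>, and the contribution of \<open>N2\<close> makes up for only a small part of this loss. The term
\<open>2 * lam\<close> leaves room for \<open>O(k)\<close> missing vertices.\<close>

lemma lam_le_and_card_R_le: "lam \<le> k + 2" "card R \<le> 4 * k"
proof -
  let ?r = "real (card R)"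
  have l: "200 \<le> lam" using k by linarith
  have "sum x N2 \<le> 4 * ?r / lam" using sum_N2_le lam_pos by (simp add: field_simps)
  also have "\<dots> \<le> 4 * ?r / 200" using l by (intro divide_left_mono) auto
  also have "\<dots> = ?r / 50" by simp
  finally have s: "sum x N2 \<le> ?r / 50" .
  have q: "k\<^sup>2 = card (nb w) + ?r" using k(1) card_S by simp
  have main: "lam\<^sup>2 - 2 * lam \<le> k\<^sup>2 - 24 / 25 * ?r" using lam_squared_le s q by simp
  show "lam \<le> k + 2"
  proof (rule ccontr)
    assume "\<not> lam \<le> k + 2"
    then have "(k + 2) * k < lam * (lam - 2)" using k by (intro mult_strict_mono) auto
    then show False using main k by (simp add: algebra_simps power2_eq_square)
  qed
  have "k * (k - 2) \<le> lam * (lam - 2)" using k by (intro mult_mono) auto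
  then have "24 / 25 * ?r \<le> 2 * k" using main by (simp add: algebra_simps power2_eq_square)
  then show "?r \<le> 4 * k" using k by simp
qed

lemma sum_S_le: "sum x S \<le> 5 * k + 3"
  using sum_S_split[of x] xw eigen'[OF wS] lam_le_and_card_R_le sum_x_le_card[OF subsets(2)] by simp

lemma degree_le:
  assumes "u \<in> S" "u \<noteq> w"
  shows "card (nb u) \<le> 4 * k + 3"
proof -
  have "nb u \<subseteq> insert w (nb u \<inter> nb w) \<union> R" by (auto simp: R_def nb_def)
  then have "card (nb u) \<le> card (insert w (nb u \<inter> nb w) \<union> R)" by (intro card_mono) auto
  also have "\<dots> \<le> card (insert w (nb u \<inter> nb w)) + card R" by (rule card_Un_le)
  also have "\<dots> \<le> Suc (card (nb u \<inter> nb w)) + card R" by (simp add: card_insert_if)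
  finally have "card (nb u) \<le> 3 + card R" using common_nb_le_2[OF assms(2)] by linarith
  then show ?thesis using lam_le_and_card_R_le(2) by linarith
qed

text \<open>Every vertex other than \<open>w\<close> has degree \<open>O(k)\<close>, so \<open>lam\<^sup>2 * x u\<close> is dominated by the sum of all entries,
which is \<open>O(k)\<close> as well.\<close>

lemma x_small:
  assumes u: "u \<in> S" "u \<noteq> w"
  shows "x u \<le> 12 / k"
proof -
  have k2: "k\<^sup>2 \<le> lam\<^sup>2" using k by (intro power_mono) auto
  have "k\<^sup>2 * x u \<le> lam\<^sup>2 * x u" using k2 x_nonneg[OF u(1)] by (rule mult_right_mono)
  also have "\<dots> \<le> card (nb u \<inter> S) * x u + 2 * sum x (S - {u})"
    using lam_squared[OF u(1)] two_steps_le[of S S u] u by simp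
  also have "nb u \<inter> S = nb u" using subsets by auto
  also have "card (nb u) * x u \<le> (4 * k + 3) * x u"
    using degree_le[OF u] x_nonneg[OF u(1)] by (rule mult_right_mono)
  also have "sum x (S - {u}) \<le> sum x S" using x_nonneg by (intro sum_mono2) auto
  also have "\<dots> \<le> 5 * k + 3" by (rule sum_S_le)
  finally have 1: "(k\<^sup>2 - 4 * k - 3) * x u \<le> 10 * k + 6" by (simp add: algebra_simps)
  have "200 * k \<le> k * k" using k(2) by (intro mult_right_mono) auto
  then have kk: "200 * k \<le> k\<^sup>2" by (simp add: power2_eq_square)
  have pos: "0 < k\<^sup>2 - 4 * k - 3" using kk k by linarith
  have "(k\<^sup>2 - 4 * k - 3) * (x u * k) \<le> (10 * k + 6) * k" using 1 k by (simp flip: mult.assoc add: mult_right_mono)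
  also have "\<dots> = 10 * k\<^sup>2 + 6 * k" by (simp add: algebra_simps power2_eq_square)
  also have "\<dots> \<le> 12 * k\<^sup>2 - 48 * k - 36" using kk k(2) by linarith
  also have "\<dots> = (k\<^sup>2 - 4 * k - 3) * 12" by simp
  finally have "x u * k \<le> 12" using pos by (simp only: mult_le_cancel_left_pos)
  then show ?thesis using k by (simp add: field_simps)
qed

text \<open>A vertex of \<open>R\<close> has at most two neighbours in \<open>nb w\<close>, with entries \<open>O(1/k)\<close>, and otherwise only
neighbours in \<open>R\<close>. Two steps of the eigenvalue equation at the vertex where \<open>x\<close> is largest on
\<open>R\<close> show that this maximum is \<open>O(1/k\<^sup>2)\<close>.\<close>

lemma lam_x_small:
  assumes "v \<in> R"
  shows "lam * x v < 1"
proof -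
  have "R \<noteq> {}" using assms by auto
  define M where "M = Max (x ` R)"
  have M: "x t \<le> M" if "t \<in> R" for t using that by (simp add: M_def)
  have "M \<in> x ` R" unfolding M_def using \<open>R \<noteq> {}\<close> by (intro Max_in) auto
  then obtain m where m: "m \<in> R" "x m = M" by auto
  have M0: "0 \<le> M" using x_nonneg[of m] m subsets by auto
  let ?r = "real (card R)"
  have step: "lam * x u \<le> 24 / k + sum x (nb u \<inter> R)" if "u \<in> R" for u
  proof -
    have uS: "u \<in> S" "u \<noteq> w" "w \<notin> nb u" using that sym by (auto simp: R_def nb_def)
    then have "nb u = (nb u \<inter> nb w) \<union> (nb u \<inter> R)" "(nb u \<inter> nb w) \<inter> (nb u \<inter> R) = {}"
      by (auto simp: R_def nb_def)
    then have "lam * x u = sum x (nb u \<inter> nb w) + sum x (nb u \<inter> R)"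
      using eigen'[OF uS(1)] by (metis finite_Int finite_sets(1) sum.union_disjoint)
    also have "sum x (nb u \<inter> nb w) \<le> (\<Sum>t\<in>nb u \<inter> nb w. 12 / k)"
      using x_small w_notin_nb subsets by (intro sum_mono) auto
    also have "\<dots> \<le> 2 * (12 / k)"
      using common_nb_le_2[OF uS(2)] k by (simp only: sum_constant) (intro mult_right_mono, auto)
    finally show ?thesis by simp
  qed
  have card_le: "real (card (nb m \<inter> R)) \<le> ?r" by (simp add: card_mono)
  have "k\<^sup>2 * M \<le> lam\<^sup>2 * M" using k M0 by (intro mult_right_mono power_mono) auto
  also have "\<dots> = lam * (lam * x m)" by (simp add: m power2_eq_square)
  also have "\<dots> \<le> lam * (24 / k + sum x (nb m \<inter> R))"
    using step[OF m(1)] lam_pos by (intro mult_left_mono) auto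
  also have "\<dots> = lam * (24 / k) + (\<Sum>u\<in>nb m \<inter> R. lam * x u)" by (simp add: algebra_simps sum_distrib_left)
  also have "(\<Sum>u\<in>nb m \<inter> R. lam * x u) \<le> (\<Sum>u\<in>nb m \<inter> R. 24 / k + sum x (nb u \<inter> R))"
    using step by (intro sum_mono) auto
  also have "\<dots> = card (nb m \<inter> R) * (24 / k) + (\<Sum>u\<in>nb m \<inter> R. sum x (nb u \<inter> R))"
    by (simp add: sum.distrib)
  also have "card (nb m \<inter> R) * (24 / k) \<le> ?r * (24 / k)"
    using card_le k by (intro mult_right_mono) auto
  also have "(\<Sum>u\<in>nb m \<inter> R. sum x (nb u \<inter> R)) \<le> card (nb m \<inter> R) * x m + 2 * sum x (R - {m})"
    using two_steps_le[of R R m] m subsets by auto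
  also have "card (nb m \<inter> R) * x m \<le> ?r * M" unfolding m(2) using card_le M0 by (rule mult_right_mono)
  also have "sum x (R - {m}) \<le> ?r * M"
  proof -
    have "sum x (R - {m}) \<le> sum x R" using x_nonneg subsets by (intro sum_mono2) auto
    also have "\<dots> \<le> (\<Sum>t\<in>R. M)" using M by (intro sum_mono)
    finally show ?thesis by simp
  qed
  finally have "k\<^sup>2 * M \<le> (lam + ?r) * (24 / k) + 3 * ?r * M" by (simp add: algebra_simps add_divide_distrib)
  also have "(lam + ?r) * (24 / k) \<le> (5 * k + 2) * (24 / k)"
    using lam_le_and_card_R_le k by (intro mult_right_mono) auto
  also have "\<dots> \<le> 121" using k by (simp add: field_simps)
  also have "3 * ?r * M \<le> 12 * k * M" using lam_le_and_card_R_le(2) M0 by (intro mult_right_mono) auto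
  finally have 1: "(k\<^sup>2 - 12 * k) * M \<le> 121" by (simp add: algebra_simps)
  have "lam * x v \<le> (k + 2) * M"
    using lam_le_and_card_R_le(1) M[OF assms] x_nonneg[of v] subsets assms k by (intro mult_mono) auto
  also have "\<dots> < 1"
  proof (rule ccontr)
    assume "\<not> (k + 2) * M < 1"
    then have "(k\<^sup>2 - 12 * k) * 1 \<le> (k\<^sup>2 - 12 * k) * ((k + 2) * M)"
      using mult_right_mono[of 12 k k] k(2) by (intro mult_left_mono) (auto simp: power2_eq_square simp del: mult_le_cancel_right)
    also have "\<dots> = (k + 2) * ((k\<^sup>2 - 12 * k) * M)" by simp
    also have "\<dots> \<le> (k + 2) * 121" using 1 k by (intro mult_left_mono) auto
    finally have "k * (k - 133) \<le> 242" by (simp add: algebra_simps power2_eq_square)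
    moreover have "200 * 67 \<le> k * (k - 133)" using k by (intro mult_mono) auto
    ultimately show False by simp
  qed
  finally show ?thesis .
qed

end

section \<open>Comparison with a fan\<close>

lemma fan_eigenvector:
  fixes M :: real
  assumes d: "distinct (w # vs)" and ne: "vs \<noteq> []" and S: "S = set (w # vs)"
    and eigen: "\<forall>i\<in>S. (\<Sum>j\<in>S. adj (fan_arcs w vs) i j * x j) = M * x i"
    and nonneg: "\<forall>i\<in>S. 0 \<le> x i" and nz: "sqnorm S x \<noteq> 0"
  shows "0 < M" "\<forall>i\<in>S. 0 < x i" "length vs \<le> M\<^sup>2"
proof -
  have fin: "finite S" using S by simp
  have "{j\<in>S. (w, j) \<in> fan_arcs w vs} = set vs"
    using d S list_arcs_subset[of vs] by (auto simp: fan_arcs_def)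
  then have row_w: "(\<Sum>j\<in>set vs. x j) = M * x w" using bspec[OF eigen, of w] S unfolding sum_adj[OF fin] by simp
  have row_v: "x w \<le> M * x v" if "v \<in> set vs" for v
  proof -
    have "adj (fan_arcs w vs) v w * x w \<le> (\<Sum>j\<in>S. adj (fan_arcs w vs) v j * x j)"
      by (rule member_le_sum) (use S nonneg in \<open>auto simp: adj_nonneg\<close>)
    also have "\<dots> = M * x v" using eigen that S by simp
    finally show ?thesis using that by (simp add: adj_def fan_arcs_def)
  qed
  have "x w \<noteq> 0"
  proof
    assume 0: "x w = 0"
    then have "(\<Sum>j\<in>set vs. x j) = 0" using row_w by simp
    then have "\<forall>j\<in>set vs. x j = 0" using nonneg S by (subst (asm) sum_nonneg_eq_0_iff) auto
    then show False using 0 nz S by (simp add: sqnorm_eq_0_iff)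
  qed
  then have xw: "0 < x w" using nonneg S by (simp add: less_le)
  obtain v where "v \<in> set vs" using ne by (cases vs) auto
  then have "0 < M * x v" "0 \<le> x v" using row_v[of v] xw nonneg S by auto
  then show M: "0 < M" by (auto simp: zero_less_mult_iff)
  show "\<forall>i\<in>S. 0 < x i"
  proof
    fix i assume "i \<in> S"
    then consider "i = w" | "i \<in> set vs" using S by auto
    then show "0 < x i"
    proof cases
      case 2
      then have "0 < M * x i" using row_v[of i] xw by simp
      then show ?thesis using M by (simp add: zero_less_mult_iff)
    qed (use xw in simp)
  qed
  have "length vs * x w = (\<Sum>j\<in>set vs. x w)" using d by (simp add: distinct_card)
  also have "\<dots> \<le> (\<Sum>j\<in>set vs. M * x j)" using row_v by (intro sum_mono) auto
  also have "\<dots> = M * (M * x w)" using row_w by (simp flip: sum_distrib_left)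
  finally have "length vs * x w \<le> M\<^sup>2 * x w" by (simp add: power2_eq_square)
  then show "length vs \<le> M\<^sup>2" using xw by simp
qed

context perron_vector
begin

text \<open>The graph induced on \<open>nb w\<close> is a linear forest. The vertices of \<open>R\<close> are appended in any order.\<close>

lemma covering_path:
  "\<exists>vs. distinct (w # vs) \<and> set (w # vs) = S \<and>
    (\<forall>u\<in>nb w. \<forall>v\<in>nb w. (u, v) \<in> E \<longrightarrow> (u, v) \<in> list_arcs vs \<or> (v, u) \<in> list_arcs vs)"
proof -
  have "\<exists>vs. distinct vs \<and> set vs = nb w \<and>
    (\<forall>u\<in>nb w. \<forall>v\<in>nb w. (u, v) \<in> E \<longrightarrow> (u, v) \<in> list_arcs vs \<or> (v, u) \<in> list_arcs vs)"
  proof (rule linear_forest_covering_path)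
    fix v a b c assume h: "v \<in> nb w" "a \<in> nb w" "b \<in> nb w" "c \<in> nb w" "(v, a) \<in> E" "(v, b) \<in> E"
      "(v, c) \<in> E" "distinct [a, b, c]"
    show False
      by (rule no_theta[of v "[a]" "[b]" "[c]" w]) (use h sym loopfree in \<open>auto simp: nb_def\<close>)
  next
    fix vs assume "distinct vs" "3 \<le> length vs" "set vs \<subseteq> nb w" "list_arcs vs \<subseteq> E" "(last vs, hd vs) \<in> E"
    then show False by (intro no_cycle_in_neighbourhood[of vs w]) (auto simp: nb_def)
  qed (use sym loopfree in auto)
  then obtain vs where vs: "distinct vs" "set vs = nb w"
    "\<forall>u\<in>nb w. \<forall>v\<in>nb w. (u, v) \<in> E \<longrightarrow> (u, v) \<in> list_arcs vs \<or> (v, u) \<in> list_arcs vs" by blast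
  obtain rs where rs: "set rs = R" "distinct rs" using finite_distinct_list[OF finite_sets(2)] by blast
  have "list_arcs vs \<subseteq> list_arcs (vs @ rs)"
    using list_arcs_append[of vs rs] by (cases "vs = []"; cases "rs = []"; auto)
  moreover have "distinct (w # vs @ rs)" "set (w # vs @ rs) = S"
    using vs rs wS w_notin_nb by (auto simp: R_def nb_def)
  ultimately show ?thesis using vs(3) by (intro exI[of _ "vs @ rs"]) blast
qed

lemma bform_adj_E: "bform (adj E) S x x = lam * sqnorm S x"
proof -
  have "bform (adj E) S x x = (\<Sum>i\<in>S. lam * (x i)\<^sup>2)"
    unfolding bform_eq_sum_apply sum_adj[OF finS]
    by (intro sum.cong) (simp_all add: eigen power2_eq_square)
  then show ?thesis by (simp add: sqnorm_def sum_distrib_left)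
qed

text \<open>The fan contains all edges of the graph that do not meet \<open>R\<close>. The edges that meet \<open>R\<close> contribute
at most twice the sum of \<open>x v * (lam * x v)\<close> over \<open>R\<close>, and the new edges from \<open>w\<close> contribute twice
the sum of \<open>x v * 1\<close>.\<close>

lemma fan_form_ge:
  assumes S: "set (w # vs) = S"
    and cover: "\<forall>u\<in>nb w. \<forall>v\<in>nb w. (u, v) \<in> E \<longrightarrow> (u, v) \<in> list_arcs vs \<or> (v, u) \<in> list_arcs vs"
  shows "bform (adj E) S x x + 2 * (\<Sum>v\<in>R. x v * (1 - lam * x v)) \<le> bform (adj (fan_arcs w vs)) S x x"
proof -
  define F where "F = fan_arcs w vs"
  \<comment> \<open>The kernel a selects the pairs from R to w, the kernel b the arcs of E that start in R.\<close>
  define a where "a i j = (if i \<in> R \<and> j = w then 1 else 0 :: real)" for i j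
  define b where "b i j = (if i \<in> R then adj E i j else 0)" for i j
  have w_R: "w \<notin> R" by (simp add: R_def)
  have ker: "adj E i j + a i j + a j i \<le> adj F i j + b i j + b j i" if ij: "i \<in> S" "j \<in> S" for i j
  proof (cases "(i, j) \<in> E")
    case True
    have "\<not> (i \<in> R \<and> j = w)" "\<not> (j \<in> R \<and> i = w)" using True sym by (auto simp: R_def nb_def)
    then have "a i j = 0" "a j i = 0" by (auto simp: a_def)
    moreover have "(i, j) \<in> F" if "i \<notin> R" "j \<notin> R"
    proof -
      have "i = w \<or> i \<in> nb w" "j = w \<or> j \<in> nb w" using that ij by (auto simp: R_def)
      moreover have "nb w \<subseteq> set vs" using S w_notin_nb by (auto simp: nb_def)
      ultimately show ?thesis using cover True loopfree by (auto simp: F_def fan_arcs_def)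
    qed
    moreover have "(j, i) \<in> E" using True by (rule sym)
    ultimately show ?thesis using True by (auto simp: b_def adj_def)
  next
    case False
    have "(i, j) \<in> F" if "i \<in> R \<and> j = w \<or> j \<in> R \<and> i = w"
      using that S w_R subsets(2) by (auto simp: F_def fan_arcs_def)
    then have "a i j + a j i \<le> adj F i j" using w_R by (auto simp: a_def adj_def)
    moreover have "0 \<le> b i j" "0 \<le> b j i" by (auto simp: b_def adj_nonneg)
    ultimately show ?thesis using False by (simp add: adj_def)
  qed
  have restrict: "(\<Sum>i\<in>S. if i \<in> R then f i else 0) = sum f R" for f :: "'a \<Rightarrow> real"
    using subsets(2) by (subst sum.inter_restrict[symmetric]) (auto simp: Int_absorb1)
  have a_sum: "bform a S x x = sum x R"
  proof -
    have "bform a S x x = (\<Sum>i\<in>S. if i \<in> R then x i else 0)"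
      unfolding bform_eq_sum_apply a_def
    proof (intro sum.cong refl)
      fix i assume "i \<in> S"
      have "(\<Sum>j\<in>S. (if i \<in> R \<and> j = w then 1 else 0) * x j) = (\<Sum>j\<in>S. if j = w then (if i \<in> R then x w else 0) else 0)"
        by (intro sum.cong) auto
      then show "x i * (\<Sum>j\<in>S. (if i \<in> R \<and> j = w then 1 else 0) * x j) = (if i \<in> R then x i else 0)"
        using wS xw finS by simp
    qed
    then show ?thesis by (simp add: restrict)
  qed
  have b_sum: "bform b S x x = (\<Sum>i\<in>R. lam * (x i)\<^sup>2)"
  proof -
    have "bform b S x x = (\<Sum>i\<in>S. if i \<in> R then lam * (x i)\<^sup>2 else 0)"
      unfolding bform_eq_sum_apply
    proof (intro sum.cong refl)
      fix i assume i: "i \<in> S"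
      show "x i * (\<Sum>j\<in>S. b i j * x j) = (if i \<in> R then lam * (x i)\<^sup>2 else 0)"
      proof (cases "i \<in> R")
        case True
        then have "(\<Sum>j\<in>S. b i j * x j) = (\<Sum>j\<in>S. adj E i j * x j)" by (simp add: b_def)
        then show ?thesis using True i by (simp add: sum_adj[OF finS] eigen power2_eq_square)
      qed (simp add: b_def)
    qed
    then show ?thesis by (simp add: restrict)
  qed
  have swap: "bform (\<lambda>i j. f j i) S x x = bform f S x x" for f :: "'a \<Rightarrow> 'a \<Rightarrow> real"
    unfolding bform_def by (subst sum.swap) (simp add: mult.commute mult.left_commute)
  have "bform (\<lambda>i j. adj E i j + a i j + a j i) S x x \<le> bform (\<lambda>i j. adj F i j + b i j + b j i) S x x"
    unfolding bform_def
    using ker x_nonneg by (intro sum_mono mult_right_mono) auto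
  moreover have "bform (\<lambda>i j. adj E i j + a i j + a j i) S x x = bform (adj E) S x x + 2 * sum x R"
    using a_sum swap[of a] by (simp add: bform_def sum.distrib algebra_simps)
  moreover have "bform (\<lambda>i j. adj F i j + b i j + b j i) S x x = bform (adj F) S x x + 2 * (\<Sum>i\<in>R. lam * (x i)\<^sup>2)"
    using b_sum swap[of b] by (simp add: bform_def sum.distrib algebra_simps)
  moreover have "(\<Sum>v\<in>R. x v * (1 - lam * x v)) = sum x R - (\<Sum>i\<in>R. lam * (x i)\<^sup>2)"
    by (simp add: algebra_simps power2_eq_square sum_subtractf)
  ultimately show ?thesis unfolding F_def by simp
qed

text \<open>The form of the fan at \<open>x\<close> is at least that of the graph and at most
\<open>lam * sqnorm S x\<close>, so both are equal. Then \<open>x\<close> is an eigenvector of the fan as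
well, hence positive. As \<open>lam * x v < 1\<close> on \<open>R\<close>, the gain of
\<open>fan_form_ge\<close> vanishes only if \<open>R\<close> is empty, and then every edge of the fan must be present.\<close>

theorem is_fan:
  assumes top: "\<And>vs. distinct (w # vs) \<Longrightarrow> set (w # vs) = S \<Longrightarrow> top_value (adj (fan_arcs w vs)) S \<le> lam"
  shows "\<exists>vs. distinct (w # vs) \<and> set (w # vs) = S \<and> E \<inter> S \<times> S = fan_arcs w vs"
proof -
  obtain vs where vs: "distinct (w # vs)" "set (w # vs) = S"
    and cover: "\<forall>u\<in>nb w. \<forall>v\<in>nb w. (u, v) \<in> E \<longrightarrow> (u, v) \<in> list_arcs vs \<or> (v, u) \<in> list_arcs vs"
    using covering_path by blast
  let ?F = "fan_arcs w vs"
  have Sne: "S \<noteq> {}" using wS by auto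
  have Fsym: "adj ?F i j = adj ?F j i" for i j by (rule adj_sym) (rule fan_arcs_sym)
  have bound: "bform (adj ?F) S y y \<le> lam * sqnorm S y" for y
    using top_value_props(1)[OF finS Sne, of "adj ?F" y] mult_right_mono[OF top[OF vs] sqnorm_nonneg[of S y]]
    by linarith
  have gain: "0 \<le> x v * (1 - lam * x v)" if "v \<in> R" for v
    using that lam_x_small[OF that] x_nonneg subsets(2) by auto
  then have "0 \<le> (\<Sum>v\<in>R. x v * (1 - lam * x v))" by (intro sum_nonneg)
  then have eq: "bform (adj ?F) S x x = lam * sqnorm S x" "(\<Sum>v\<in>R. x v * (1 - lam * x v)) = 0"
    using fan_form_ge[OF vs(2) cover] bound[of x] bform_adj_E by auto
  have Feigen: "\<forall>i\<in>S. (\<Sum>j\<in>S. adj ?F i j * x j) = lam * x i"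
    by (rule maximizer_is_eigenvector[where a = "adj ?F", OF finS Fsym bound eq(1)])
  have "vs \<noteq> []"
  proof
    assume "vs = []"
    then have "k\<^sup>2 = 0" using vs k(1) by auto
    then show False using k by simp
  qed
  moreover have "sqnorm S x \<noteq> 0" using xw wS finS by (auto simp: sqnorm_eq_0_iff intro!: bexI[of _ w])
  ultimately have pos: "0 < x i" if "i \<in> S" for i
    using fan_eigenvector(2)[OF vs(1) _ vs(2)[symmetric] Feigen] x_nonneg that by auto
  have "R = {}"
  proof (rule ccontr)
    assume "R \<noteq> {}"
    then obtain v where v: "v \<in> R" by auto
    then have "x v * (1 - lam * x v) = 0"
      using eq(2) gain by (subst (asm) sum_nonneg_eq_0_iff) auto
    then show False using pos[of v] lam_x_small[OF v] v subsets(2) by auto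
  qed
  then have cov: "i = w \<or> i \<in> nb w" if "i \<in> S" for i using that by (auto simp: R_def)
  have sub: "adj E i j \<le> adj ?F i j" if "i \<in> S" "j \<in> S" for i j
    using cov[OF that(1)] cov[OF that(2)] cover loopfree vs(1,2) that
    by (auto simp: adj_def fan_arcs_def)
  have "(\<Sum>i\<in>S. \<Sum>j\<in>S. (adj ?F i j - adj E i j) * (x i * x j)) = 0"
    using eq(1) bform_adj_E by (simp add: bform_def algebra_simps sum_subtractf)
  moreover have nn: "0 \<le> (adj ?F i j - adj E i j) * (x i * x j)" if "i \<in> S" "j \<in> S" for i j
    using sub[OF that] x_nonneg that by auto
  ultimately have "(adj ?F i j - adj E i j) * (x i * x j) = 0" if "i \<in> S" "j \<in> S" for i j
    using that finS by (simp add: sum_nonneg_eq_0_iff sum_nonneg)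
  then have "adj ?F i j = adj E i j" if "i \<in> S" "j \<in> S" for i j
    using that pos[of i] pos[of j] by fastforce
  then have "(i, j) \<in> E \<longleftrightarrow> (i, j) \<in> ?F" if "i \<in> S" "j \<in> S" for i j
    using that unfolding adj_def by (metis zero_neq_one)
  moreover have "?F \<subseteq> S \<times> S" using vs(2) list_arcs_subset[of vs] by (auto simp: fan_arcs_def)
  ultimately have "E \<inter> S \<times> S = ?F" by auto
  then show ?thesis using vs by blast
qed

end

section \<open>The spectral radius of the fan\<close>

lemma list_arcs_map: "list_arcs (map f xs) = map_prod f f ` list_arcs xs"
  by (induction xs rule: list_arcs.induct) auto

lemma fan_arcs_map: "fan_arcs (f w) (map f vs) = map_prod f f ` fan_arcs w vs"
proof -
  have "(map_prod f f ` A)\<inverse> = map_prod f f ` (A\<inverse>)" for A by force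
  then show ?thesis unfolding fan_arcs_def list_arcs_map image_Un by (simp add: map_prod_image)
qed

lemma fan_arcs_subset: "fan_arcs w vs \<subseteq> set (w # vs) \<times> set (w # vs)"
  using list_arcs_subset[of vs] by (auto simp: fan_arcs_def)

lemma map_prod_mem_iff:
  assumes "inj_on f A" "E \<subseteq> A \<times> A" "i \<in> A" "j \<in> A"
  shows "(f i, f j) \<in> map_prod f f ` E \<longleftrightarrow> (i, j) \<in> E"
proof
  assume "(f i, f j) \<in> map_prod f f ` E"
  then obtain u v where "(u, v) \<in> E" "f i = f u" "f j = f v" by auto
  moreover have "u \<in> A" "v \<in> A" using \<open>(u, v) \<in> E\<close> assms(2) by auto
  ultimately show "(i, j) \<in> E" using assms(1,3,4) by (auto dest: inj_onD)
qed force

lemma bform_image: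
  "inj_on f I \<Longrightarrow> bform a (f ` I) x y = bform (\<lambda>i j. a (f i) (f j)) I (x \<circ> f) (y \<circ> f)"
  by (simp add: bform_def sum.reindex)

lemma sqnorm_image: "inj_on f I \<Longrightarrow> sqnorm (f ` I) x = sqnorm I (x \<circ> f)"
  by (simp add: sqnorm_def sum.reindex)

lemma sqnorm_cong: "(\<And>i. i \<in> S \<Longrightarrow> x i = y i) \<Longrightarrow> sqnorm S x = sqnorm S y"
  unfolding sqnorm_def by (intro sum.cong) auto

lemma top_value_image:
  assumes I: "finite I" "I \<noteq> {}" and f: "inj_on f I"
  shows "top_value a (f ` I) = top_value (\<lambda>i j. a (f i) (f j)) I"
proof (rule antisym)
  let ?b = "\<lambda>i j. a (f i) (f j)"
  have J: "finite (f ` I)" "f ` I \<noteq> {}" using I by auto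
  obtain x where "sqnorm (f ` I) x = 1" "bform a (f ` I) x x = top_value a (f ` I)"
    using top_value_props(2)[OF J] by blast
  then show "top_value a (f ` I) \<le> top_value ?b I"
    using top_value_props(1)[OF I, of ?b "x \<circ> f"] f by (simp add: bform_image sqnorm_image)
  obtain y where y: "sqnorm I y = 1" "bform ?b I y y = top_value ?b I"
    using top_value_props(2)[OF I] by blast
  define z where "z = y \<circ> the_inv_into I f"
  have z: "(z \<circ> f) i = y i" if "i \<in> I" for i using that f by (simp add: z_def the_inv_into_f_f)
  have "sqnorm (f ` I) z = 1" using y z sqnorm_cong[of I "z \<circ> f" y] f by (simp add: sqnorm_image)
  moreover have "bform a (f ` I) z z = top_value ?b I"
    using y z bform_cong[of I "z \<circ> f" y "z \<circ> f" y] f by (simp add: bform_image)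
  ultimately show "top_value ?b I \<le> top_value a (f ` I)"
    using top_value_props(1)[OF J, of a z] by simp
qed

lemma top_value_cong:
  assumes "\<And>i j. i \<in> S \<Longrightarrow> j \<in> S \<Longrightarrow> a i j = b i j"
  shows "top_value a S = top_value b S"
proof -
  have "bform a S x x = bform b S x x" for x
    unfolding bform_def using assms by (intro sum.cong) auto
  then show ?thesis by (simp add: top_value_def)
qed

text \<open>All fans on \<open>q\<close> vertices are copies of the one with apex \<open>0\<close> and path \<open>1, \<dots>, q - 1\<close>.\<close>

definition fan_value :: "nat \<Rightarrow> real" where
  "fan_value q = top_value (adj (fan_arcs 0 [1..<q])) {..<q}"

lemma top_value_fan:
  assumes "distinct (w # vs)"
  shows "top_value (adj (fan_arcs w vs)) (set (w # vs)) = fan_value (length (w # vs))"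
proof -
  define q where "q = length (w # vs)"
  define f where "f i = (w # vs) ! i" for i
  have q: "[0..<q] = 0 # [1..<q]" using upt_conv_Cons[of 0 q] by (simp add: q_def del: upt_Suc)
  have "map f [0..<q] = w # vs" unfolding f_def q_def by (rule map_nth)
  then have map: "w # vs = map f (0 # [1..<q])" using q by simp
  have inj: "inj_on f {..<q}" unfolding f_def using assms by (intro inj_on_nth) (auto simp: q_def)
  have im: "set (w # vs) = f ` {..<q}"
    using map q by (metis atLeast_upt set_map)
  have "top_value (adj (fan_arcs w vs)) (set (w # vs)) =
    top_value (\<lambda>i j. adj (fan_arcs w vs) (f i) (f j)) {..<q}"
    unfolding im by (rule top_value_image) (use inj in \<open>auto simp: q_def\<close>)
  also have "\<dots> = fan_value q" unfolding fan_value_def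
  proof (rule top_value_cong)
    fix i j assume ij: "i \<in> {..<q}" "j \<in> {..<q}"
    have "fan_arcs w vs = map_prod f f ` fan_arcs 0 [1..<q]"
      using map fan_arcs_map[of f 0 "[1..<q]"] by simp
    moreover have "fan_arcs 0 [1..<q] \<subseteq> {..<q} \<times> {..<q}"
      using fan_arcs_subset[of 0 "[1..<q]"] unfolding q[symmetric] by auto
    ultimately show "adj (fan_arcs w vs) (f i) (f j) = adj (fan_arcs 0 [1..<q]) i j"
      using map_prod_mem_iff[OF inj _ ij] by (simp add: adj_def)
  qed
  finally show ?thesis by (simp add: q_def)
qed

lemma fan_top_eigenvector:
  assumes d: "distinct (w # vs)" "vs \<noteq> []" and S: "S = set (w # vs)"
    and u: "bform (adj (fan_arcs w vs)) S u u = fan_value (length (w # vs)) * sqnorm S u" "sqnorm S u \<noteq> 0"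
  shows "\<forall>i\<in>S. u i \<noteq> 0" "0 < fan_value (length (w # vs))" "length vs \<le> (fan_value (length (w # vs)))\<^sup>2"
proof -
  have fin: "finite S" "S \<noteq> {}" using S by auto
  have sym: "adj (fan_arcs w vs) i j = adj (fan_arcs w vs) j i" for i j
    by (rule adj_sym) (rule fan_arcs_sym)
  have top: "top_value (adj (fan_arcs w vs)) S = fan_value (length (w # vs))"
    unfolding S by (rule top_value_fan[OF d(1)])
  have "\<forall>i\<in>S. (\<Sum>j\<in>S. adj (fan_arcs w vs) i j * \<bar>u j\<bar>) = top_value (adj (fan_arcs w vs)) S * \<bar>u i\<bar>"
    by (rule abs_maximizer_is_eigenvector[where a = "adj (fan_arcs w vs)", OF fin sym adj_nonneg])
      (simp add: top u)
  note F = fan_eigenvector[OF d S this] 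
  show "\<forall>i\<in>S. u i \<noteq> 0" "0 < fan_value (length (w # vs))" "length vs \<le> (fan_value (length (w # vs)))\<^sup>2"
    using F u by (auto simp: sqnorm_abs top)
qed

text \<open>The fan contains the star on \<open>q\<close> vertices.\<close>

lemma fan_value_ge:
  assumes "2 \<le> q"
  shows "0 < fan_value q" "real q - 1 \<le> (fan_value q)\<^sup>2"
proof -
  have d: "distinct (0 # [1..<q])" "[1..<q] \<noteq> []" "length (0 # [1..<q]) = q" using assms by auto
  obtain u where "sqnorm (set (0 # [1..<q])) u = 1"
    "bform (adj (fan_arcs 0 [1..<q])) (set (0 # [1..<q])) u u =
      top_value (adj (fan_arcs 0 [1..<q])) (set (0 # [1..<q]))"
    using top_value_props(2)[of "set (0 # [1..<q])"] by blast
  note F = fan_top_eigenvector(2,3)[OF d(1,2) refl, of u] top_value_fan[OF d(1)] this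
  show "0 < fan_value q" "real q - 1 \<le> (fan_value q)\<^sup>2"
    using F assms unfolding d(3) by auto
qed

context theta_K4_free
begin

lemma adjacency_sym: "adj E i j = adj E j i"
  by (rule adj_sym) (rule sym)

text \<open>The eigenvector supplied by the maximizer is divided by its largest entry \<open>m\<close>. The bound \<open>40001\<close> is
\<open>200\<^sup>2 + 1\<close>.\<close>

lemma large_value_imp_fan:
  assumes S: "finite S" "40001 \<le> card S" and top: "fan_value (card S) \<le> top_value (adj E) S"
  shows "\<exists>w vs. distinct (w # vs) \<and> set (w # vs) = S \<and> E \<inter> S \<times> S = fan_arcs w vs"
proof -
  have ne: "S \<noteq> {}" using S by auto
  define lam where "lam = top_value (adj E) S"
  define k where "k = sqrt (real (card S) - 1)"
  obtain y where y: "sqnorm S y = 1" "bform (adj E) S y y = lam"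
    using top_value_props(2)[OF S(1) ne] by (auto simp: lam_def)
  then have eig: "\<forall>i\<in>S. (\<Sum>j\<in>S. adj E i j * \<bar>y j\<bar>) = lam * \<bar>y i\<bar>"
    unfolding lam_def by (intro abs_maximizer_is_eigenvector S ne adjacency_sym adj_nonneg) simp
  define m where "m = Max ((\<lambda>i. \<bar>y i\<bar>) ` S)"
  have "m \<in> (\<lambda>i. \<bar>y i\<bar>) ` S" unfolding m_def using S ne by (intro Max_in) auto
  then obtain w where w: "w \<in> S" "\<bar>y w\<bar> = m" by auto
  have le_m: "\<bar>y i\<bar> \<le> m" if "i \<in> S" for i unfolding m_def using that S by (intro Max_ge) auto
  have "m \<noteq> 0"
  proof
    assume "m = 0"
    then have "\<forall>i\<in>S. y i = 0" using le_m by auto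
    then show False using y S by (simp add: sqnorm_def)
  qed
  then have m: "0 < m" using w by auto
  have kk: "k\<^sup>2 = real (card S) - 1" using S by (simp add: k_def)
  have "sqrt (200\<^sup>2) \<le> k" unfolding k_def using S by (intro real_sqrt_le_mono) simp
  then have k200: "200 \<le> k" by simp
  have "k\<^sup>2 \<le> (fan_value (card S))\<^sup>2" "0 < fan_value (card S)"
    using fan_value_ge[of "card S"] S kk by auto
  then have "k \<le> fan_value (card S)" by (meson less_imp_le power2_le_imp_le)
  then have k_lam: "k \<le> lam" using top by (simp add: lam_def)
  interpret P: perron_vector E S "\<lambda>i. \<bar>y i\<bar> / m" lam k w
  proof
    show "(\<Sum>j\<in>{j \<in> S. (i, j) \<in> E}. \<bar>y j\<bar> / m) = lam * (\<bar>y i\<bar> / m)" if "i \<in> S" for i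
      using eig that by (simp add: sum_adj[OF S(1)] flip: sum_divide_distrib)
  qed (use S w m le_m kk k200 k_lam in auto)
  have "top_value (adj (fan_arcs w vs)) S \<le> lam" if "distinct (w # vs)" "set (w # vs) = S" for vs
  proof -
    have "length (w # vs) = card S" using that distinct_card by metis
    then show ?thesis using top_value_fan[OF that(1)] that(2) top by (simp add: lam_def)
  qed
  then show ?thesis using P.is_fan by blast
qed

theorem form_le_fan_value:
  assumes S: "finite S" "40001 \<le> card S"
  shows "bform (adj E) S u u \<le> fan_value (card S) * sqnorm S u"
    and "\<lbrakk>bform (adj E) S u u = fan_value (card S) * sqnorm S u; sqnorm S u \<noteq> 0\<rbrakk> \<Longrightarrow>
      (\<forall>i\<in>S. u i \<noteq> 0) \<and> (\<exists>w vs. distinct (w # vs) \<and> set (w # vs) = S \<and> E \<inter> S \<times> S = fan_arcs w vs)"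
proof -
  have ne: "S \<noteq> {}" using S by auto
  have bound: "bform (adj E) S u u \<le> top_value (adj E) S * sqnorm S u"
    by (rule top_value_props(1)[OF S(1) ne])
  have fan: "top_value (adj E) S = fan_value (card S) \<and>
      (bform (adj E) S u u = fan_value (card S) * sqnorm S u \<longrightarrow> sqnorm S u \<noteq> 0 \<longrightarrow> (\<forall>i\<in>S. u i \<noteq> 0))"
    if f: "distinct (w # vs)" "set (w # vs) = S" "E \<inter> S \<times> S = fan_arcs w vs" for w vs
  proof -
    have len: "length (w # vs) = card S" using f distinct_card by metis
    have eq: "adj E i j = adj (fan_arcs w vs) i j" if "i \<in> S" "j \<in> S" for i j
      unfolding f(3)[symmetric] using that by (simp add: adj_def)
    have "top_value (adj E) S = top_value (adj (fan_arcs w vs)) S" by (rule top_value_cong) (rule eq)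
    moreover have "bform (adj E) S u u = bform (adj (fan_arcs w vs)) S u u"
      unfolding bform_def using eq by (intro sum.cong) auto
    moreover have "vs \<noteq> []" using len S by auto
    ultimately show ?thesis
      using top_value_fan[OF f(1)] fan_top_eigenvector(1)[OF f(1) _ f(2)[symmetric], of u] f(2) len by simp
  qed
  show "bform (adj E) S u u \<le> fan_value (card S) * sqnorm S u"
  proof (cases "fan_value (card S) \<le> top_value (adj E) S")
    case True
    then show ?thesis using large_value_imp_fan[OF S] fan bound by metis
  next
    case False
    then show ?thesis using bound mult_right_mono[of "top_value (adj E) S" "fan_value (card S)" "sqnorm S u"]
        sqnorm_nonneg[of S u] by linarith
  qed
  show "(\<forall>i\<in>S. u i \<noteq> 0) \<and> (\<exists>w vs. distinct (w # vs) \<and> set (w # vs) = S \<and> E \<inter> S \<times> S = fan_arcs w vs)"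
    if u: "bform (adj E) S u u = fan_value (card S) * sqnorm S u" "sqnorm S u \<noteq> 0"
  proof -
    have "0 < sqnorm S u" using u(2) sqnorm_nonneg[of S u] by simp
    then have "fan_value (card S) \<le> top_value (adj E) S" using bound u(1) by simp
    then show ?thesis using large_value_imp_fan[OF S] fan u by metis
  qed
qed

end

section \<open>Eigenvectors for the two largest eigenvalues\<close>

unbundle no inner_syntax

lemma mult_unit_vec_index:
  fixes A :: "'a :: semiring_1 mat"
  assumes "A \<in> carrier_mat n k" "i < n" "j < k"
  shows "(A *\<^sub>v unit_vec k j) $ i = A $$ (i, j)"
  using assms by simp

lemma scalar_prod_self_pos:
  fixes v :: "real vec"
  assumes "v \<in> carrier_vec n" "v \<noteq> 0\<^sub>v n"
  shows "0 < v \<bullet> v"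
proof -
  obtain i where i: "i < n" "v $ i \<noteq> 0"
    using assms by (auto simp: vec_eq_iff)
  have "0 < (\<Sum>j\<in>{0..<n}. v $ j * v $ j)"
    by (rule sum_pos2[of _ i]) (use i in \<open>auto simp: zero_less_mult_iff\<close>)
  then show ?thesis using assms by (simp add: scalar_prod_def)
qed

text \<open>The Householder reflection \<open>Q\<close> that exchanges the first unit vector \<open>e\<close> and the unit eigenvector
\<open>v\<close> makes \<open>e\<close> an eigenvector of the symmetric matrix \<open>Q * A * Q\<close>, which therefore is block
diagonal. It is built from \<open>h = v - e\<close>; if \<open>h\<close> is zero, then \<open>c = 2 / 0 = 0\<close> and \<open>Q\<close> is the identity,
as it should be.\<close>

lemma symmetric_deflation:
  fixes A :: "real mat"
  assumes A: "A \<in> carrier_mat (Suc m) (Suc m)" and symA: "A\<^sup>T = A"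
    and v: "v \<in> carrier_vec (Suc m)" "v \<bullet> v = 1" "A *\<^sub>v v = t \<cdot>\<^sub>v v"
  shows "\<exists>Q A'. Q \<in> carrier_mat (Suc m) (Suc m) \<and> Q\<^sup>T = Q \<and> Q * Q = 1\<^sub>m (Suc m) \<and>
    Q *\<^sub>v unit_vec (Suc m) 0 = v \<and> A' \<in> carrier_mat m m \<and> A'\<^sup>T = A' \<and>
    Q * A * Q = four_block_mat (mat 1 1 (\<lambda>_. t)) (0\<^sub>m 1 m) (0\<^sub>m m 1) A' \<and>
    char_poly A = [:-t, 1:] * char_poly A'"
proof -
  let ?n = "Suc m" and ?e = "unit_vec (Suc m) 0 :: real vec"
  define h where "h = v - ?e"
  have h: "h \<in> carrier_vec ?n" using v by (simp add: h_def)
  define c where "c = 2 / (h \<bullet> h)"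
  define Q where "Q = mat ?n ?n (\<lambda>(i, j). (if i = j then 1 else 0) - c * h $ i * h $ j)"
  have Q: "Q \<in> carrier_mat ?n ?n" by (simp add: Q_def)
  have QT: "Q\<^sup>T = Q" by (rule eq_matI) (auto simp: Q_def)
  have Q_apply: "Q *\<^sub>v x = x - (c * (h \<bullet> x)) \<cdot>\<^sub>v h" if "x \<in> carrier_vec ?n" for x
  proof (rule eq_vecI)
    fix i assume "i < dim_vec (x - (c * (h \<bullet> x)) \<cdot>\<^sub>v h)"
    then have i: "i < ?n" using h by simp
    have "(Q *\<^sub>v x) $ i = (\<Sum>j\<in>{0..<?n}. ((if i = j then 1 else 0) - c * h $ i * h $ j) * x $ j)"
      using i that by (simp add: Q_def scalar_prod_def)
    also have "\<dots> = (\<Sum>j\<in>{0..<?n}. (if i = j then x $ j else 0)) - c * h $ i * (\<Sum>j\<in>{0..<?n}. h $ j * x $ j)"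
      by (simp only: sum_distrib_left flip: sum_subtractf) (intro sum.cong, auto simp: algebra_simps)
    also have "\<dots> = x $ i - c * h $ i * (h \<bullet> x)" using i that by (simp add: scalar_prod_def)
    finally show "(Q *\<^sub>v x) $ i = (x - (c * (h \<bullet> x)) \<cdot>\<^sub>v h) $ i" using i that h by simp
  qed (use Q h that in auto)
  have hh: "h \<bullet> h = - 2 * h $ 0"
  proof -
    have "h \<bullet> h = (v - ?e) \<bullet> v - (v - ?e) \<bullet> ?e" unfolding h_def
      using v by (subst scalar_prod_minus_distrib[of _ ?n]) auto
    also have "(v - ?e) \<bullet> v = v \<bullet> v - ?e \<bullet> v" using v by (subst minus_scalar_prod_distrib[of _ ?n]) auto
    also have "(v - ?e) \<bullet> ?e = v \<bullet> ?e - ?e \<bullet> ?e" using v by (subst minus_scalar_prod_distrib[of _ ?n]) auto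
    finally show ?thesis using v by (simp add: h_def)
  qed
  have Qe: "Q *\<^sub>v ?e = v"
  proof (cases "h \<bullet> h = 0")
    case True
    then have "h = 0\<^sub>v ?n" using scalar_prod_self_pos[OF h] by auto
    then have "h $ i = 0" if "i < ?n" for i using that by simp
    moreover have "h $ i = v $ i - ?e $ i" if "i < ?n" for i using that v by (simp add: h_def)
    ultimately have "v $ i = ?e $ i" if "i < ?n" for i using that by simp
    then have "v = ?e" using v by (intro eq_vecI) auto
    then show ?thesis using True h by (auto simp: Q_apply c_def intro!: eq_vecI)
  next
    case False
    then have "c * (h \<bullet> ?e) = -1" using h hh by (simp add: c_def field_simps)
    then have "Q *\<^sub>v ?e = ?e - (-1) \<cdot>\<^sub>v h" by (simp only: Q_apply[OF unit_vec_carrier])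
    then show ?thesis using v by (auto simp: h_def intro!: eq_vecI)
  qed
  have QQ_apply: "Q *\<^sub>v (Q *\<^sub>v x) = x" if x: "x \<in> carrier_vec ?n" for x
  proof -
    let ?s = "c * (h \<bullet> x)"
    have "c * (h \<bullet> (x - ?s \<cdot>\<^sub>v h)) = c * (h \<bullet> x) - c * ?s * (h \<bullet> h)"
      using h x by (simp add: scalar_prod_minus_distrib[of _ ?n] algebra_simps)
    also have "\<dots> = - ?s" by (simp add: c_def)
    finally have "Q *\<^sub>v (Q *\<^sub>v x) = (x - ?s \<cdot>\<^sub>v h) - (- ?s) \<cdot>\<^sub>v h"
      using h x by (simp add: Q_apply)
    also have "\<dots> = x" using h x by (intro eq_vecI) auto
    finally show ?thesis .
  qed
  have QQ: "Q * Q = 1\<^sub>m ?n"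
  proof (rule eq_matI)
    fix i j assume "i < dim_row (1\<^sub>m ?n :: real mat)" "j < dim_col (1\<^sub>m ?n :: real mat)"
    then have ij: "i < ?n" "j < ?n" by auto
    have "(Q * Q) $$ (i, j) = ((Q * Q) *\<^sub>v unit_vec ?n j) $ i"
      using ij Q by (subst mult_unit_vec_index[of _ ?n ?n]) auto
    also have "(Q * Q) *\<^sub>v unit_vec ?n j = unit_vec ?n j"
      using Q QQ_apply[of "unit_vec ?n j"] by (simp add: assoc_mult_mat_vec[OF Q Q])
    finally show "(Q * Q) $$ (i, j) = (1\<^sub>m ?n :: real mat) $$ (i, j)" using ij by (simp add: unit_vec_def)
  qed (use Q in auto)
  define B where "B = Q * A * Q"
  have B: "B \<in> carrier_mat ?n ?n" using Q A by (simp add: B_def)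
  have BT: "B\<^sup>T = B"
    using Q A by (simp add: B_def transpose_mult[of _ ?n ?n _ ?n] QT symA assoc_mult_mat[of _ ?n ?n _ ?n _ ?n])
  have "B *\<^sub>v ?e = Q *\<^sub>v (A *\<^sub>v (Q *\<^sub>v ?e))"
    using Q A by (simp add: B_def assoc_mult_mat_vec[of _ ?n ?n _ ?n])
  also have "\<dots> = Q *\<^sub>v (t \<cdot>\<^sub>v v)" by (simp add: Qe v)
  also have "\<dots> = t \<cdot>\<^sub>v (Q *\<^sub>v (Q *\<^sub>v ?e))" using Q v by (simp add: Qe mult_mat_vec)
  finally have Be: "B *\<^sub>v ?e = t \<cdot>\<^sub>v ?e" by (simp add: QQ_apply)
  have col0: "B $$ (i, 0) = (if i = 0 then t else 0)" if "i < ?n" for i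
  proof -
    have "B $$ (i, 0) = (B *\<^sub>v ?e) $ i" using that B by (subst mult_unit_vec_index[of _ ?n ?n]) auto
    then show ?thesis using that by (simp add: Be)
  qed
  have row0: "B $$ (0, i) = (if i = 0 then t else 0)" if "i < ?n" for i
    using col0[OF that] BT B that by (metis carrier_matD index_transpose_mat(1) zero_less_Suc)
  define A' where "A' = mat m m (\<lambda>(i, j). B $$ (Suc i, Suc j))"
  have A': "A' \<in> carrier_mat m m" by (simp add: A'_def)
  have "B $$ (i, j) = B $$ (j, i)" if "i < ?n" "j < ?n" for i j
    using BT B that by (metis carrier_matD index_transpose_mat(1))
  then have A'T: "A'\<^sup>T = A'" by (intro eq_matI) (auto simp: A'_def)
  have Bblock: "B = four_block_mat (mat 1 1 (\<lambda>_. t)) (0\<^sub>m 1 m) (0\<^sub>m m 1) A'"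
    by (rule eq_matI) (use B in \<open>auto simp: A'_def col0 row0 four_block_mat_def Let_def\<close>)
  have "similar_mat B A"
    by (rule similar_matI[of _ _ Q Q ?n]) (use A B Q QQ in \<open>auto simp: B_def\<close>)
  then have "char_poly A = char_poly B" by (simp add: char_poly_similar)
  also have "\<dots> = char_poly (mat 1 1 (\<lambda>_. t)) * char_poly A'"
    unfolding Bblock by (rule char_poly_four_block_zeros_col) (use A' in auto)
  also have "char_poly (mat 1 1 (\<lambda>_. t)) = [:-t, 1:]"
    by (simp add: char_poly_defs det_def sign_def)
  finally show ?thesis
    using Q QT QQ Qe A' A'T Bblock[unfolded B_def] by (intro exI[of _ Q] exI[of _ A'] conjI)
qed

text \<open>Splitting off an eigenvector leaves a symmetric matrix whose eigenvectors correspond to the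
eigenvectors of \<open>A\<close> that are orthogonal to \<open>v\<close>. This turns multiplicities of roots of the
characteristic polynomial into orthogonal eigenvectors and back.\<close>

lemma deflation_orthogonal_eigenvectors:
  fixes A :: "real mat"
  assumes A: "A \<in> carrier_mat (Suc m) (Suc m)" and symA: "A\<^sup>T = A"
    and v: "v \<in> carrier_vec (Suc m)" "v \<bullet> v = 1" "A *\<^sub>v v = t \<cdot>\<^sub>v v"
  shows "\<exists>A'. A' \<in> carrier_mat m m \<and> A'\<^sup>T = A' \<and> char_poly A = [:-t, 1:] * char_poly A' \<and>
    (\<forall>s. eigenvalue A' s \<longleftrightarrow>
      (\<exists>y. y \<in> carrier_vec (Suc m) \<and> y \<noteq> 0\<^sub>v (Suc m) \<and> A *\<^sub>v y = s \<cdot>\<^sub>v y \<and> v \<bullet> y = 0))"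
proof -
  let ?n = "Suc m" and ?e = "unit_vec (Suc m) 0 :: real vec"
  obtain Q A' where Q: "Q \<in> carrier_mat ?n ?n" "Q\<^sup>T = Q" "Q * Q = 1\<^sub>m ?n" "Q *\<^sub>v ?e = v"
    and A': "A' \<in> carrier_mat m m" "A'\<^sup>T = A'"
    and B: "Q * A * Q = four_block_mat (mat 1 1 (\<lambda>_. t)) (0\<^sub>m 1 m) (0\<^sub>m m 1) A'"
    and cp: "char_poly A = [:-t, 1:] * char_poly A'"
    using symmetric_deflation[OF A symA v] by blast
  have QQ: "Q *\<^sub>v (Q *\<^sub>v x) = x" if "x \<in> carrier_vec ?n" for x
    using assoc_mult_mat_vec[OF Q(1) Q(1) that] Q(3) that by simp
  have Q0: "Q *\<^sub>v 0\<^sub>v ?n = 0\<^sub>v ?n" using Q(1) by (intro eq_vecI) (auto simp: scalar_prod_def)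
  have conj: "Q *\<^sub>v (A *\<^sub>v (Q *\<^sub>v x)) = four_block_mat (mat 1 1 (\<lambda>_. t)) (0\<^sub>m 1 m) (0\<^sub>m m 1) A' *\<^sub>v x"
    if "x \<in> carrier_vec ?n" for x
  proof -
    have QA: "Q * A \<in> carrier_mat ?n ?n" and Qx: "Q *\<^sub>v x \<in> carrier_vec ?n" using Q(1) A that by auto
    show ?thesis unfolding B[symmetric] assoc_mult_mat_vec[OF QA Q(1) that] assoc_mult_mat_vec[OF Q(1) A Qx] ..
  qed
  have block: "four_block_mat (mat 1 1 (\<lambda>_. t)) (0\<^sub>m 1 m) (0\<^sub>m m 1) A' *\<^sub>v (0\<^sub>v 1 @\<^sub>v z) = 0\<^sub>v 1 @\<^sub>v (A' *\<^sub>v z)"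
    if "z \<in> carrier_vec m" for z
  proof -
    have 0: "mat 1 1 (\<lambda>_. t) *\<^sub>v 0\<^sub>v 1 = 0\<^sub>v 1" by (rule eq_vecI) (auto simp: scalar_prod_def)
    have 1: "mat 1 1 (\<lambda>_. t) \<in> carrier_mat 1 1" by simp
    show ?thesis unfolding mult_mat_vec_split[OF 1 A'(1) zero_carrier_vec that] 0 ..
  qed
  have v_dot: "v \<bullet> (Q *\<^sub>v x) = x $ 0" if "x \<in> carrier_vec ?n" for x
  proof -
    have "v \<bullet> (Q *\<^sub>v x) = (Q *\<^sub>v v) \<bullet> x"
      using transpose_vec_mult_scalar[OF Q(1) that v(1)] Q(2) by simp
    also have "Q *\<^sub>v v = ?e" using QQ[of ?e] Q(4) by simp
    finally show ?thesis using that by simp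
  qed
  have "eigenvalue A' s \<longleftrightarrow>
      (\<exists>y. y \<in> carrier_vec ?n \<and> y \<noteq> 0\<^sub>v ?n \<and> A *\<^sub>v y = s \<cdot>\<^sub>v y \<and> v \<bullet> y = 0)" for s
  proof
    assume "eigenvalue A' s"
    then obtain z where z: "z \<in> carrier_vec m" "z \<noteq> 0\<^sub>v m" "A' *\<^sub>v z = s \<cdot>\<^sub>v z"
      using A' by (auto simp: eigenvalue_def eigenvector_def)
    define x where "x = 0\<^sub>v 1 @\<^sub>v z"
    have x: "x \<in> carrier_vec ?n" unfolding x_def using z(1) by (intro carrier_vecI) simp
    have "Q *\<^sub>v (A *\<^sub>v (Q *\<^sub>v x)) = 0\<^sub>v 1 @\<^sub>v (A' *\<^sub>v z)"
      unfolding conj[OF x] unfolding x_def by (rule block[OF z(1)])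
    also have "\<dots> = s \<cdot>\<^sub>v x" unfolding z(3) x_def by (rule eq_vecI) auto
    finally have "Q *\<^sub>v (A *\<^sub>v (Q *\<^sub>v x)) = s \<cdot>\<^sub>v x" .
    then have "A *\<^sub>v (Q *\<^sub>v x) = Q *\<^sub>v (s \<cdot>\<^sub>v x)"
      using QQ[of "A *\<^sub>v (Q *\<^sub>v x)"] A Q(1) x by (metis mult_mat_vec_carrier)
    then have "A *\<^sub>v (Q *\<^sub>v x) = s \<cdot>\<^sub>v (Q *\<^sub>v x)" using Q(1) x by (simp add: mult_mat_vec)
    moreover have "Q *\<^sub>v x \<noteq> 0\<^sub>v ?n"
    proof
      assume "Q *\<^sub>v x = 0\<^sub>v ?n"
      then have "x = 0\<^sub>v ?n" using QQ[OF x] Q0 by simp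
      then have "x $ Suc i = 0" if "i < m" for i using that by simp
      moreover have "x $ Suc i = z $ i" if "i < m" for i using that z(1) by (simp add: x_def)
      ultimately have "z = 0\<^sub>v m" using z(1) by (intro eq_vecI) auto
      then show False using z by simp
    qed
    moreover have "v \<bullet> (Q *\<^sub>v x) = 0" using v_dot[OF x] by (simp add: x_def)
    ultimately show "\<exists>y. y \<in> carrier_vec ?n \<and> y \<noteq> 0\<^sub>v ?n \<and> A *\<^sub>v y = s \<cdot>\<^sub>v y \<and> v \<bullet> y = 0"
      using Q(1) x by (intro exI[of _ "Q *\<^sub>v x"]) simp
  next
    assume "\<exists>y. y \<in> carrier_vec ?n \<and> y \<noteq> 0\<^sub>v ?n \<and> A *\<^sub>v y = s \<cdot>\<^sub>v y \<and> v \<bullet> y = 0"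
    then obtain y where y: "y \<in> carrier_vec ?n" "y \<noteq> 0\<^sub>v ?n" "A *\<^sub>v y = s \<cdot>\<^sub>v y" "v \<bullet> y = 0" by blast
    define x where "x = Q *\<^sub>v y"
    have x: "x \<in> carrier_vec ?n" using Q y by (simp add: x_def)
    have Qx: "Q *\<^sub>v x = y" using QQ[OF y(1)] by (simp add: x_def)
    have x0: "x $ 0 = 0" using v_dot[OF x] y by (simp add: Qx)
    define z where "z = vec m (\<lambda>i. x $ Suc i)"
    have z: "z \<in> carrier_vec m" by (simp add: z_def)
    have xz: "x = 0\<^sub>v 1 @\<^sub>v z" using x x0 by (intro eq_vecI) (auto simp: z_def)
    have "0\<^sub>v 1 @\<^sub>v (A' *\<^sub>v z) = Q *\<^sub>v (A *\<^sub>v (Q *\<^sub>v x))"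
      unfolding conj[OF x] using block[OF z, folded xz] ..
    also have "\<dots> = s \<cdot>\<^sub>v (Q *\<^sub>v y)" unfolding Qx y(3) by (rule mult_mat_vec[OF Q(1) y(1)])
    also have "\<dots> = s \<cdot>\<^sub>v (0\<^sub>v 1 @\<^sub>v z)" unfolding x_def[symmetric] xz[symmetric] ..
    finally have "0\<^sub>v 1 @\<^sub>v (A' *\<^sub>v z) = s \<cdot>\<^sub>v (0\<^sub>v 1 @\<^sub>v z)" .
    then have *: "(0\<^sub>v 1 @\<^sub>v (A' *\<^sub>v z)) $ Suc i = (s \<cdot>\<^sub>v (0\<^sub>v 1 @\<^sub>v z)) $ Suc i" for i by simp
    have "A' *\<^sub>v z = s \<cdot>\<^sub>v z"
    proof (rule eq_vecI)
      fix i assume "i < dim_vec (s \<cdot>\<^sub>v z)"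
      then show "(A' *\<^sub>v z) $ i = (s \<cdot>\<^sub>v z) $ i" using *[of i] A' z by simp
    qed (use A' z in auto)
    moreover have "z \<noteq> 0\<^sub>v m"
    proof
      assume "z = 0\<^sub>v m"
      then have "x = 0\<^sub>v ?n" unfolding xz by (intro eq_vecI) auto
      then have "y = 0\<^sub>v ?n" using Qx Q0 by simp
      then show False using y by simp
    qed
    ultimately show "eigenvalue A' s" using A' z by (auto simp: eigenvalue_def eigenvector_def)
  qed
  then show ?thesis using A' cp by (intro exI[of _ A'] conjI allI)
qed

lemma symmetric_has_eigenvalue:
  fixes A :: "real mat"
  assumes A: "A \<in> carrier_mat n n" "A\<^sup>T = A" and n: "0 < n"
  shows "\<exists>t. eigenvalue A t"
proof -
  define a where "a i j = (if i < n \<and> j < n then A $$ (i, j) else 0)" for i j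
  have "a i j = a j i" for i j
    using A by (auto simp: a_def) (metis carrier_matD index_transpose_mat(1))
  then obtain x where x: "sqnorm {..<n} x = 1"
    "\<forall>i\<in>{..<n}. (\<Sum>j\<in>{..<n}. a i j * x j) = top_value a {..<n} * x i"
    using top_value_eigenvector[of "{..<n}" a] n by auto
  have "A *\<^sub>v vec n x = top_value a {..<n} \<cdot>\<^sub>v vec n x"
  proof (rule eq_vecI)
    fix i assume "i < dim_vec (top_value a {..<n} \<cdot>\<^sub>v vec n x)"
    then have i: "i < n" by simp
    have "(A *\<^sub>v vec n x) $ i = (\<Sum>j\<in>{..<n}. a i j * x j)"
      using i A by (auto simp: scalar_prod_def a_def atLeast0LessThan intro!: sum.cong)
    then show "(A *\<^sub>v vec n x) $ i = (top_value a {..<n} \<cdot>\<^sub>v vec n x) $ i" using x(2) i by simp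
  qed (use A in auto)
  moreover have "vec n x \<noteq> 0\<^sub>v n"
  proof
    assume *: "vec n x = 0\<^sub>v n"
    have "x i = 0" if "i < n" for i using arg_cong[OF *, of "\<lambda>u. u $ i"] that by simp
    then show False using x(1) by (simp add: sqnorm_def)
  qed
  ultimately show ?thesis using A by (auto simp: eigenvalue_def eigenvector_def intro!: exI[of _ "vec n x"])
qed

definition desc_list :: "real multiset \<Rightarrow> real list" where
  "desc_list M = rev (sorted_list_of_multiset M)"

lemma desc_list_add_max:
  assumes "\<forall>s\<in>#M. s \<le> t"
  shows "desc_list (add_mset t M) = t # desc_list M"
proof -
  have "sorted (sorted_list_of_multiset M @ [t])" using assms by (simp add: sorted_append)
  moreover have "mset (sorted_list_of_multiset M @ [t]) = add_mset t M" by simp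
  ultimately have "sorted_list_of_multiset (add_mset t M) = sorted_list_of_multiset M @ [t]"
    by (metis sorted_list_of_multiset_mset sorted_sort_id)
  then show ?thesis by (simp add: desc_list_def)
qed

lemma desc_list_hd:
  assumes "M \<noteq> {#}"
  shows "desc_list M ! 0 = Max_mset M"
proof -
  have "Max_mset M \<in># M" using assms by simp
  then obtain N where "M = add_mset (Max_mset M) N" by (metis insert_DiffM)
  moreover from this have "\<forall>s\<in>#N. s \<le> Max_mset M" by (metis Max_ge finite_set_mset union_iff add_mset_add_single)
  ultimately show ?thesis using desc_list_add_max[of N "Max_mset M"] by (metis nth_Cons_0)
qed

lemma normalized_eigenvector:
  fixes A :: "real mat"
  assumes A: "A \<in> carrier_mat n n" and y: "y \<in> carrier_vec n" "y \<noteq> 0\<^sub>v n" "A *\<^sub>v y = t \<cdot>\<^sub>v y"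
  shows "\<exists>r. r \<noteq> 0 \<and> (r \<cdot>\<^sub>v y) \<bullet> (r \<cdot>\<^sub>v y) = 1 \<and> A *\<^sub>v (r \<cdot>\<^sub>v y) = t \<cdot>\<^sub>v (r \<cdot>\<^sub>v y)"
proof -
  have "0 < y \<bullet> y" by (rule scalar_prod_self_pos[OF y(1,2)])
  then show ?thesis
    using A y by (intro exI[of _ "1 / sqrt (y \<bullet> y)"])
      (auto simp: mult_mat_vec smult_smult_assoc mult.commute)
qed


lemma monic_char_poly_nonzero:
  fixes A :: "real mat"
  assumes "A \<in> carrier_mat n n"
  shows "char_poly A \<noteq> 0"
  using degree_monic_char_poly[OF assms] by auto

text \<open>After the deflation by an eigenvector of the largest root, the second entry of the list is the
largest root of the remaining factor.\<close>

lemma two_largest_eigenvalues: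
  fixes A :: "real mat"
  assumes A: "A \<in> carrier_mat n n" "A\<^sup>T = A" and n: "2 \<le> n"
  defines "es \<equiv> desc_list (proots (char_poly A))"
  shows "\<exists>x y. x \<in> carrier_vec n \<and> y \<in> carrier_vec n \<and> x \<noteq> 0\<^sub>v n \<and> y \<noteq> 0\<^sub>v n \<and> x \<bullet> y = 0 \<and>
    A *\<^sub>v x = (es ! 0) \<cdot>\<^sub>v x \<and> A *\<^sub>v y = (es ! 1) \<cdot>\<^sub>v y \<and> es ! 1 \<le> es ! 0"
proof -
  obtain m where m: "n = Suc m" "0 < m" using n by (cases n) auto
  let ?M = "proots (char_poly A)"
  have root: "t \<in># ?M \<longleftrightarrow> eigenvalue A t" for t
    using eigenvalue_root_char_poly[OF A(1)] monic_char_poly_nonzero[OF A(1)] by simp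
  have "?M \<noteq> {#}" using symmetric_has_eigenvalue[OF A] root m by fastforce
  define t where "t = Max_mset ?M"
  have t: "t \<in># ?M" using \<open>?M \<noteq> {#}\<close> by (simp add: t_def)
  obtain x0 where x0: "x0 \<in> carrier_vec n" "x0 \<noteq> 0\<^sub>v n" "A *\<^sub>v x0 = t \<cdot>\<^sub>v x0"
    using t A(1) unfolding root eigenvalue_def eigenvector_def by auto
  obtain r where r: "r \<noteq> 0" "(r \<cdot>\<^sub>v x0) \<bullet> (r \<cdot>\<^sub>v x0) = 1" "A *\<^sub>v (r \<cdot>\<^sub>v x0) = t \<cdot>\<^sub>v (r \<cdot>\<^sub>v x0)"
    using normalized_eigenvector[OF A(1) x0] by blast
  define x where "x = r \<cdot>\<^sub>v x0"
  have x: "x \<in> carrier_vec n" "x \<bullet> x = 1" "A *\<^sub>v x = t \<cdot>\<^sub>v x" using r x0 by (auto simp: x_def)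
  have "x \<noteq> 0\<^sub>v n" using x(2) by (intro notI) simp
  obtain A' where A': "A' \<in> carrier_mat m m" "A'\<^sup>T = A'" and cp: "char_poly A = [:-t, 1:] * char_poly A'"
    and ev: "\<And>s. eigenvalue A' s \<longleftrightarrow>
      (\<exists>y. y \<in> carrier_vec n \<and> y \<noteq> 0\<^sub>v n \<and> A *\<^sub>v y = s \<cdot>\<^sub>v y \<and> x \<bullet> y = 0)"
    using deflation_orthogonal_eigenvectors[OF A(1)[unfolded m(1)] A(2) x(1)[unfolded m(1)] x(2,3)]
    unfolding m(1)[symmetric] by (elim exE conjE) simp
  let ?M' = "proots (char_poly A')"
  have MM': "?M = add_mset t ?M'"
    unfolding cp using monic_char_poly_nonzero[OF A'(1)] by (subst proots_mult) auto
  have root': "s \<in># ?M' \<longleftrightarrow> eigenvalue A' s" for s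
    using eigenvalue_root_char_poly[OF A'(1)] monic_char_poly_nonzero[OF A'(1)] by simp
  have ne': "?M' \<noteq> {#}" using symmetric_has_eigenvalue[OF A' m(2)] root' by fastforce
  have "\<forall>s\<in>#?M. s \<le> t" by (simp add: t_def)
  then have le: "\<forall>s\<in>#?M'. s \<le> t" by (simp add: MM')
  have es: "es = t # desc_list ?M'" unfolding es_def MM' by (rule desc_list_add_max[OF le])
  then have es01: "es ! 0 = t" "es ! 1 = Max_mset ?M'" using desc_list_hd[OF ne'] by auto
  have "Max_mset ?M' \<in># ?M'" using ne' by simp
  then obtain y where "y \<in> carrier_vec n" "y \<noteq> 0\<^sub>v n" "A *\<^sub>v y = (es ! 1) \<cdot>\<^sub>v y" "x \<bullet> y = 0"
    unfolding root' ev es01(2) by (elim exE conjE)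
  moreover have "es ! 1 \<le> es ! 0" unfolding es01 using le \<open>Max_mset ?M' \<in># ?M'\<close> by blast
  ultimately show ?thesis using x \<open>x \<noteq> 0\<^sub>v n\<close> unfolding es01(1)
    by (intro exI[of _ x] exI[of _ y] conjI)
qed

text \<open>The deflation by \<open>x\<close> removes one occurrence of \<open>s\<close> from the multiset of roots, and \<open>y\<close> provides
another one.\<close>

lemma second_eigenvalue_ge:
  fixes A :: "real mat"
  assumes A: "A \<in> carrier_mat n n" "A\<^sup>T = A"
    and x: "x \<in> carrier_vec n" "x \<noteq> 0\<^sub>v n" "A *\<^sub>v x = s \<cdot>\<^sub>v x"
    and y: "y \<in> carrier_vec n" "y \<noteq> 0\<^sub>v n" "A *\<^sub>v y = s \<cdot>\<^sub>v y" and orth: "x \<bullet> y = 0"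
  shows "s \<le> desc_list (proots (char_poly A)) ! 1"
proof -
  have "n \<noteq> 0" using x by (auto simp: vec_eq_iff)
  then obtain m where m: "n = Suc m" by (cases n) auto
  obtain r where r: "r \<noteq> 0" "(r \<cdot>\<^sub>v x) \<bullet> (r \<cdot>\<^sub>v x) = 1" "A *\<^sub>v (r \<cdot>\<^sub>v x) = s \<cdot>\<^sub>v (r \<cdot>\<^sub>v x)"
    using normalized_eigenvector[OF A(1) x] by blast
  have rx: "r \<cdot>\<^sub>v x \<in> carrier_vec n" using x by simp
  obtain A' where A': "A' \<in> carrier_mat m m" "A'\<^sup>T = A'" and cp: "char_poly A = [:-s, 1:] * char_poly A'"
    and ev: "\<And>t. eigenvalue A' t \<longleftrightarrow>
      (\<exists>y. y \<in> carrier_vec n \<and> y \<noteq> 0\<^sub>v n \<and> A *\<^sub>v y = t \<cdot>\<^sub>v y \<and> (r \<cdot>\<^sub>v x) \<bullet> y = 0)"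
    using deflation_orthogonal_eigenvectors[OF A(1)[unfolded m(1)] A(2) rx[unfolded m(1)] r(2,3)]
    unfolding m(1)[symmetric] by (elim exE conjE) simp
  let ?M = "proots (char_poly A)" and ?M' = "proots (char_poly A')"
  have MM': "?M = add_mset s ?M'"
    unfolding cp using monic_char_poly_nonzero[OF A'(1)] by (subst proots_mult) auto
  have "(r \<cdot>\<^sub>v x) \<bullet> y = 0" using orth x y by simp
  then have "eigenvalue A' s" unfolding ev using y by blast
  then have s: "s \<in># ?M'"
    using eigenvalue_root_char_poly[OF A'(1)] monic_char_poly_nonzero[OF A'(1)] by simp
  define t where "t = Max_mset ?M"
  have "t \<in># ?M" unfolding t_def by (rule Max_in) (auto simp: MM')
  then obtain N where N: "?M = add_mset t N" by (metis insert_DiffM)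
  have "\<forall>u\<in>#?M. u \<le> t" by (simp add: t_def)
  then have le: "\<forall>u\<in>#N. u \<le> t" by (simp add: N)
  have "s \<in># N"
  proof (cases "t = s")
    case True
    then show ?thesis using N MM' s by simp
  next
    case False
    then show ?thesis using N MM' by (metis insert_noteq_member)
  qed
  then have "N \<noteq> {#}" "s \<le> Max_mset N" by auto
  then show ?thesis unfolding N desc_list_add_max[OF le] using desc_list_hd[of N] by simp
qed

section \<open>Eigenfunctions of a graph\<close>

lemma eigenfunction_vec_iff:
  assumes vs: "distinct vs" "set vs = pverts G"
  shows "adj_matrix G vs *\<^sub>v vec (length vs) (\<lambda>i. x (vs ! i)) = t \<cdot>\<^sub>v vec (length vs) (\<lambda>i. x (vs ! i)) \<longleftrightarrow>
    (\<forall>i\<in>pverts G. (\<Sum>j\<in>pverts G. adj (parcs G) i j * x j) = t * x i)"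
proof -
  let ?n = "length vs" and ?x = "vec (length vs) (\<lambda>i. x (vs ! i))"
  have bij: "bij_betw (\<lambda>i. vs ! i) {..<?n} (pverts G)" using vs by (intro bij_betw_nth) auto
  have row: "(adj_matrix G vs *\<^sub>v ?x) $ i = (\<Sum>j\<in>pverts G. adj (parcs G) (vs ! i) j * x j)" if "i < ?n" for i
  proof -
    have "(adj_matrix G vs *\<^sub>v ?x) $ i = (\<Sum>j\<in>{..<?n}. adj (parcs G) (vs ! i) (vs ! j) * x (vs ! j))"
      using that by (auto simp: adj_matrix_def scalar_prod_def adj_def atLeast0LessThan intro!: sum.cong)
    then show ?thesis using sum.reindex_bij_betw[OF bij, of "\<lambda>j. adj (parcs G) (vs ! i) j * x j"] by simp
  qed
  have "adj_matrix G vs *\<^sub>v ?x = t \<cdot>\<^sub>v ?x \<longleftrightarrow> (\<forall>i<?n. (adj_matrix G vs *\<^sub>v ?x) $ i = t * x (vs ! i))"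
    by (auto simp: vec_eq_iff adj_matrix_def)
  also have "\<dots> \<longleftrightarrow> (\<forall>i<?n. (\<Sum>j\<in>pverts G. adj (parcs G) (vs ! i) j * x j) = t * x (vs ! i))"
    using row by auto
  also have "\<dots> \<longleftrightarrow> (\<forall>i\<in>pverts G. (\<Sum>j\<in>pverts G. adj (parcs G) i j * x j) = t * x i)"
    unfolding vs(2)[symmetric] all_set_conv_all_nth ..
  finally show ?thesis .
qed

lemma vec_nonzero_iff:
  assumes "distinct vs" "set vs = S"
  shows "vec (length vs) (\<lambda>i. x (vs ! i)) \<noteq> 0\<^sub>v (length vs) \<longleftrightarrow> sqnorm S x \<noteq> 0"
proof -
  have "finite S" using assms by auto
  then have "sqnorm S x = 0 \<longleftrightarrow> (\<forall>i<length vs. x (vs ! i) = 0)"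
    using sqnorm_eq_0_iff[OF \<open>finite S\<close>, of x] assms(2) all_set_conv_all_nth[of vs "\<lambda>u. x u = 0"] by simp
  then show ?thesis by (auto simp: vec_eq_iff)
qed

lemma vec_scalar_prod:
  assumes "distinct vs" "set vs = S"
  shows "vec (length vs) (\<lambda>i. x (vs ! i)) \<bullet> vec (length vs) (\<lambda>i. y (vs ! i)) = (\<Sum>i\<in>S. x i * y i)"
proof -
  have "bij_betw (\<lambda>i. vs ! i) {..<length vs} S" using assms by (intro bij_betw_nth) auto
  from sum.reindex_bij_betw[OF this, of "\<lambda>i. x i * y i"] show ?thesis
    by (simp add: scalar_prod_def atLeast0LessThan)
qed

lemma function_of_vec:
  assumes "distinct vs" "v \<in> carrier_vec (length vs)"
  shows "\<exists>x. v = vec (length vs) (\<lambda>i. x (vs ! i))"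
proof (intro exI eq_vecI)
  let ?x = "\<lambda>u. v $ the_inv_into {..<length vs} ((!) vs) u"
  have "inj_on ((!) vs) {..<length vs}" using assms by (intro inj_on_nth) auto
  then show "v $ i = vec (length vs) (\<lambda>i. ?x (vs ! i)) $ i"
    if "i < dim_vec (vec (length vs) (\<lambda>i. ?x (vs ! i)))" for i
    using that by (simp add: the_inv_into_f_f)
qed (use assms in auto)

text \<open>The enumeration of the vertices is the arbitrary one chosen in the definition of the spectrum. No
other one has to be considered, since eigenfunctions do not depend on the enumeration.\<close>

lemma adj_eigenvalues_enumeration:
  assumes "finite (pverts G)"
  shows "\<exists>vs. distinct vs \<and> set vs = pverts G \<and>
    adj_eigenvalues G = desc_list (proots (char_poly (adj_matrix G vs)))"
proof -
  have "distinct (SOME vs. distinct vs \<and> set vs = pverts G) \<and>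
      set (SOME vs. distinct vs \<and> set vs = pverts G) = pverts G"
    using finite_distinct_list[OF assms] by (intro someI_ex[where P = "\<lambda>vs. distinct vs \<and> set vs = pverts G"]) blast
  then show ?thesis
    by (intro exI[of _ "SOME vs. distinct vs \<and> set vs = pverts G"]) (simp add: adj_eigenvalues_def desc_list_def)
qed

definition eigenfunction :: "'a pair_pre_digraph \<Rightarrow> real \<Rightarrow> ('a \<Rightarrow> real) \<Rightarrow> bool" where
  "eigenfunction G t x \<longleftrightarrow> sqnorm (pverts G) x \<noteq> 0 \<and>
    (\<forall>i\<in>pverts G. (\<Sum>j\<in>pverts G. adj (parcs G) i j * x j) = t * x i)"

lemma adj_matrix_symmetric:
  assumes "\<And>u v. (u, v) \<in> parcs G \<Longrightarrow> (v, u) \<in> parcs G"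
  shows "(adj_matrix G vs)\<^sup>T = adj_matrix G vs"
  by (rule eq_matI) (auto simp: adj_matrix_def assms)

lemma two_largest_eigenfunctions:
  assumes fin: "finite (pverts G)" and sym: "\<And>u v. (u, v) \<in> parcs G \<Longrightarrow> (v, u) \<in> parcs G"
    and card: "2 \<le> card (pverts G)"
  shows "\<exists>x y. eigenfunction G (graph_lambda 1 G) x \<and> eigenfunction G (graph_lambda 2 G) y \<and>
    (\<Sum>i\<in>pverts G. x i * y i) = 0 \<and> graph_lambda 2 G \<le> graph_lambda 1 G"
proof -
  obtain vs where vs: "distinct vs" "set vs = pverts G"
    and ev: "adj_eigenvalues G = desc_list (proots (char_poly (adj_matrix G vs)))"
    using adj_eigenvalues_enumeration[OF fin] by blast
  have n: "2 \<le> length vs" using card vs distinct_card by metis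
  have A: "adj_matrix G vs \<in> carrier_mat (length vs) (length vs)" by (simp add: adj_matrix_def)
  obtain X Y where XY: "X \<in> carrier_vec (length vs)" "Y \<in> carrier_vec (length vs)"
    "X \<noteq> 0\<^sub>v (length vs)" "Y \<noteq> 0\<^sub>v (length vs)" "X \<bullet> Y = 0"
    "adj_matrix G vs *\<^sub>v X = graph_lambda 1 G \<cdot>\<^sub>v X" "adj_matrix G vs *\<^sub>v Y = graph_lambda 2 G \<cdot>\<^sub>v Y"
    "graph_lambda 2 G \<le> graph_lambda 1 G"
    using two_largest_eigenvalues[OF A adj_matrix_symmetric[OF sym] n]
    by (auto simp: graph_lambda_def ev)
  obtain x where x: "X = vec (length vs) (\<lambda>i. x (vs ! i))" using function_of_vec[OF vs(1) XY(1)] by blast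
  obtain y where y: "Y = vec (length vs) (\<lambda>i. y (vs ! i))" using function_of_vec[OF vs(1) XY(2)] by blast
  show ?thesis
    using XY unfolding x y vec_nonzero_iff[OF vs] vec_scalar_prod[OF vs] eigenfunction_vec_iff[OF vs]
    unfolding eigenfunction_def by blast
qed

lemma graph_lambda_2_ge:
  assumes fin: "finite (pverts G)" and sym: "\<And>u v. (u, v) \<in> parcs G \<Longrightarrow> (v, u) \<in> parcs G"
    and x: "eigenfunction G t x" and y: "eigenfunction G t y" and orth: "(\<Sum>i\<in>pverts G. x i * y i) = 0"
  shows "t \<le> graph_lambda 2 G"
proof -
  obtain vs where vs: "distinct vs" "set vs = pverts G"
    and ev: "adj_eigenvalues G = desc_list (proots (char_poly (adj_matrix G vs)))"
    using adj_eigenvalues_enumeration[OF fin] by blast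
  have A: "adj_matrix G vs \<in> carrier_mat (length vs) (length vs)" by (simp add: adj_matrix_def)
  have "t \<le> desc_list (proots (char_poly (adj_matrix G vs))) ! 1"
    by (rule second_eigenvalue_ge[OF A adj_matrix_symmetric[OF sym],
          of "vec (length vs) (\<lambda>i. x (vs ! i))" t "vec (length vs) (\<lambda>i. y (vs ! i))"])
      (use x y orth vec_nonzero_iff[OF vs] vec_scalar_prod[OF vs, of x y] eigenfunction_vec_iff[OF vs]
        in \<open>auto simp: eigenfunction_def\<close>)
  then show ?thesis by (simp add: graph_lambda_def ev)
qed

section \<open>Nodal domains\<close>

lemma sum_apply_bform:
  assumes "\<forall>i\<in>V. (\<Sum>j\<in>V. a i j * z j) = t * z i"
  shows "bform a V x z = t * (\<Sum>i\<in>V. x i * z i)"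
proof -
  have "bform a V x z = (\<Sum>i\<in>V. x i * (t * z i))"
    unfolding bform_eq_sum_apply using assms by (intro sum.cong) auto
  then show ?thesis by (simp add: sum_distrib_left algebra_simps)
qed

text \<open>The mixed term \<open>bform a V u v\<close> records the edges between the two supports. It is what is left
over in the case of equality.\<close>

definition nodal_pair :: "('a \<Rightarrow> 'a \<Rightarrow> real) \<Rightarrow> 'a set \<Rightarrow> real \<Rightarrow> ('a \<Rightarrow> real) \<Rightarrow> ('a \<Rightarrow> real) \<Rightarrow> bool" where
  "nodal_pair a V t u v \<longleftrightarrow> (\<forall>i. 0 \<le> u i \<and> 0 \<le> v i \<and> (u i = 0 \<or> v i = 0)) \<and>
     sqnorm V u \<noteq> 0 \<and> sqnorm V v \<noteq> 0 \<and>
     t * sqnorm V u + bform a V u v \<le> bform a V u u \<and>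
     t * sqnorm V v + bform a V u v \<le> bform a V v v"

lemma nodal_pair_commute:
  "(\<And>i j. a i j = a j i) \<Longrightarrow> nodal_pair a V t u v \<Longrightarrow> nodal_pair a V t v u"
  using bform_sym[of a V u v] unfolding nodal_pair_def by auto

text \<open>For the parts \<open>u\<close>, \<open>v\<close> of \<open>z = u - v\<close>, pairing the eigenvalue equation with \<open>u\<close> gives
\<open>bform a V u u - bform a V u v = s * sqnorm V u\<close>, and similarly for \<open>v\<close>.\<close>

lemma nodal_pair_of_sign_change:
  assumes fin: "finite V" and sym: "\<And>i j. a i j = a j i"
    and z: "\<forall>i\<in>V. (\<Sum>j\<in>V. a i j * z j) = s * z i" and ts: "t \<le> s"
    and pos: "i \<in> V" "0 < z i" and neg: "j \<in> V" "z j < 0"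
  shows "\<exists>u v. nodal_pair a V t u v"
proof -
  define u v where "u i = max (z i) 0" and "v i = max (- z i) 0" for i
  have uz: "u i * z i = (u i)\<^sup>2" and vz: "v i * z i = - (v i)\<^sup>2" for i
    by (auto simp: u_def v_def max_def power2_eq_square)
  have lin: "bform a V x z = bform a V x u - bform a V x v" for x
  proof -
    have "bform a V x z = (\<Sum>i\<in>V. \<Sum>j\<in>V. a i j * x i * u j - a i j * x i * v j)"
      unfolding bform_def by (intro sum.cong refl) (auto simp: u_def v_def max_def)
    then show ?thesis by (simp add: bform_def sum_subtractf)
  qed
  have "bform a V u z = s * sqnorm V u" "bform a V v z = - s * sqnorm V v"
    unfolding sum_apply_bform[OF z] by (simp_all add: uz vz sqnorm_def sum_negf)
  then have "bform a V u u = s * sqnorm V u + bform a V u v" "bform a V v v = s * sqnorm V v + bform a V u v"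
    using lin[of u] lin[of v] bform_sym[of a V v u] sym by auto
  moreover have "t * sqnorm V u \<le> s * sqnorm V u" "t * sqnorm V v \<le> s * sqnorm V v"
    using ts sqnorm_nonneg by (auto intro: mult_right_mono)
  moreover have "sqnorm V u \<noteq> 0" "sqnorm V v \<noteq> 0"
    using pos neg fin by (force simp: sqnorm_eq_0_iff u_def v_def)+
  moreover have "0 \<le> u i \<and> 0 \<le> v i \<and> (u i = 0 \<or> v i = 0)" for i by (auto simp: u_def v_def)
  ultimately show ?thesis by (intro exI[of _ u] exI[of _ v]) (simp add: nodal_pair_def)
qed

text \<open>Nonnegative orthogonal vectors have disjoint supports, and then the eigenvalue equation shows that
their mixed term vanishes.\<close>

lemma nodal_pair_of_constant_signs:
  assumes fin: "finite V"
    and x: "\<forall>i\<in>V. (\<Sum>j\<in>V. a i j * x j) = s * x i" "sqnorm V x \<noteq> 0" "\<forall>i\<in>V. 0 \<le> x i"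
    and y: "\<forall>i\<in>V. (\<Sum>j\<in>V. a i j * y j) = t * y i" "sqnorm V y \<noteq> 0" "\<forall>i\<in>V. 0 \<le> y i"
    and orth: "(\<Sum>i\<in>V. x i * y i) = 0" and ts: "t \<le> s"
  shows "\<exists>u v. nodal_pair a V t u v"
proof -
  define u v where "u i = (if i \<in> V then x i else 0)" and "v i = (if i \<in> V then y i else 0)" for i
  have eq: "bform a V u u = bform a V x x" "bform a V v v = bform a V y y" "bform a V u v = bform a V x y"
    "sqnorm V u = sqnorm V x" "sqnorm V v = sqnorm V y"
    by (auto simp: u_def v_def intro!: bform_cong sqnorm_cong)
  have "\<forall>i\<in>V. x i * y i = 0" using orth x(3) y(3) fin by (subst (asm) sum_nonneg_eq_0_iff) auto
  then have "0 \<le> u i \<and> 0 \<le> v i \<and> (u i = 0 \<or> v i = 0)" for i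
    using x(3) y(3) by (auto simp: u_def v_def)
  moreover have "bform a V x y = 0" "bform a V x x = s * sqnorm V x" "bform a V y y = t * sqnorm V y"
    using sum_apply_bform[OF x(1)] sum_apply_bform[OF y(1)] orth by (auto simp: sqnorm_def power2_eq_square)
  moreover have "t * sqnorm V x \<le> s * sqnorm V x" using ts sqnorm_nonneg by (rule mult_right_mono)
  ultimately show ?thesis using x(2) y(2) by (intro exI[of _ u] exI[of _ v]) (simp add: nodal_pair_def eq)
qed

text \<open>Either one of the two eigenvectors changes sign, or both can be made nonnegative by a change of
sign. The sign change may occur in the first eigenvector, when the graph is disconnected.\<close>

lemma exists_nodal_pair:
  assumes fin: "finite V" and sym: "\<And>i j. a i j = a j i"
    and x: "\<forall>i\<in>V. (\<Sum>j\<in>V. a i j * x j) = s * x i" "sqnorm V x \<noteq> 0"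
    and y: "\<forall>i\<in>V. (\<Sum>j\<in>V. a i j * y j) = t * y i" "sqnorm V y \<noteq> 0"
    and orth: "(\<Sum>i\<in>V. x i * y i) = 0" and ts: "t \<le> s"
  shows "\<exists>u v. nodal_pair a V t u v"
proof (cases "\<exists>i\<in>V. \<exists>j\<in>V. (0 < x i \<and> x j < 0) \<or> (0 < y i \<and> y j < 0)")
  case True
  then show ?thesis
    using nodal_pair_of_sign_change[of V a, OF fin sym x(1) ts]
      nodal_pair_of_sign_change[of V a, OF fin sym y(1) order_refl] by blast
next
  case False
  have sign: "\<exists>r. (r = 1 \<or> r = - 1) \<and> (\<forall>i\<in>V. 0 \<le> r * z i)"
    if "\<not> (\<exists>i\<in>V. \<exists>j\<in>V. 0 < z i \<and> z j < 0)" for z :: "'a \<Rightarrow> real"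
  proof (cases "\<exists>i\<in>V. 0 < z i")
    case True
    then show ?thesis using that by (intro exI[of _ 1]) (auto simp: not_less)
  next
    case False
    then show ?thesis by (intro exI[of _ "-1"]) (auto simp: not_less)
  qed
  obtain r where r: "r = 1 \<or> r = - 1" "\<forall>i\<in>V. 0 \<le> r * x i" using sign[of x] False by blast
  obtain r' where r': "r' = 1 \<or> r' = - 1" "\<forall>i\<in>V. 0 \<le> r' * y i" using sign[of y] False by blast
  have sq: "r\<^sup>2 = 1" "r'\<^sup>2 = 1" using r r' by auto
  show ?thesis
  proof (rule nodal_pair_of_constant_signs[where a = a, OF fin _ _ r(2) _ _ r'(2) _ ts])
    show "\<forall>i\<in>V. (\<Sum>j\<in>V. a i j * (r * x j)) = s * (r * x i)"
      using x(1) by (simp add: mult.left_commute[of _ r] flip: sum_distrib_left)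
    show "\<forall>i\<in>V. (\<Sum>j\<in>V. a i j * (r' * y j)) = t * (r' * y i)"
      using y(1) by (simp add: mult.left_commute[of _ r'] flip: sum_distrib_left)
    show "sqnorm V (\<lambda>i. r * x i) \<noteq> 0" "sqnorm V (\<lambda>i. r' * y i) \<noteq> 0"
      using x(2) y(2) by (simp_all add: sqnorm_scale sq)
    have "(\<Sum>i\<in>V. (r * x i) * (r' * y i)) = (r * r') * (\<Sum>i\<in>V. x i * y i)"
      by (simp add: sum_distrib_left algebra_simps)
    then show "(\<Sum>i\<in>V. (r * x i) * (r' * y i)) = 0" using orth by simp
  qed
qed

section \<open>Two disjoint fans\<close>

context theta_K4_free
begin

text \<open>The support of \<open>u\<close> is padded to a set \<open>S\<close> of exactly \<open>q\<close> vertices, on which the fan is extremal. An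
eigenvector of the fan has no zeros, so in the case of equality there was nothing to add.\<close>

lemma nodal_half:
  assumes fin: "finite V" and V: "card V = 2 * q" "40001 \<le> q" and nod: "nodal_pair (adj E) V t u v"
    and small: "card {i\<in>V. u i \<noteq> 0} \<le> q"
  shows "t \<le> fan_value q"
    and "t = fan_value q \<Longrightarrow> card {i\<in>V. u i \<noteq> 0} = q \<and> bform (adj E) V u v = 0 \<and>
      (\<exists>w vs. distinct (w # vs) \<and> set (w # vs) = {i\<in>V. u i \<noteq> 0} \<and>
        E \<inter> {i\<in>V. u i \<noteq> 0} \<times> {i\<in>V. u i \<noteq> 0} = fan_arcs w vs)"
proof -
  let ?P = "{i\<in>V. u i \<noteq> 0}"
  obtain S where S: "?P \<subseteq> S" "S \<subseteq> V" "card S = q"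
    using exists_subset_between[of ?P q V] small V fin by auto
  have finS: "finite S" using S fin finite_subset by blast
  have "sqnorm V u = sqnorm S u"
    unfolding sqnorm_def by (rule sum.mono_neutral_right) (use S fin in auto)
  moreover have "bform (adj E) V u u = bform (adj E) S u u"
  proof -
    have "bform (adj E) V u u = (\<Sum>i\<in>S. \<Sum>j\<in>V. adj E i j * u i * u j)"
      unfolding bform_def by (rule sum.mono_neutral_right) (use S fin in auto)
    also have "\<dots> = bform (adj E) S u u" unfolding bform_def
      by (intro sum.cong sum.mono_neutral_right) (use S fin in auto)
    finally show ?thesis .
  qed
  moreover have uv: "0 \<le> bform (adj E) V u v"
    unfolding bform_def using nod by (intro sum_nonneg) (auto simp: adj_nonneg nodal_pair_def)
  moreover have nz: "sqnorm V u \<noteq> 0" and le: "t * sqnorm V u + bform (adj E) V u v \<le> bform (adj E) V u u"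
    using nod by (auto simp: nodal_pair_def)
  moreover have F: "bform (adj E) S u u \<le> fan_value q * sqnorm S u"
    using form_le_fan_value(1)[OF finS, of u] S V by simp
  ultimately have chain: "t * sqnorm S u + bform (adj E) V u v \<le> bform (adj E) S u u" "sqnorm S u \<noteq> 0" by auto
  have "t * sqnorm S u \<le> fan_value q * sqnorm S u" using chain(1) uv F by linarith
  moreover have "0 < sqnorm S u" using chain(2) sqnorm_nonneg[of S u] by simp
  ultimately show "t \<le> fan_value q" by simp
  assume t: "t = fan_value q"
  have eq: "bform (adj E) S u u = fan_value q * sqnorm S u" "bform (adj E) V u v = 0"
    using chain F uv t by auto
  obtain w vs where all: "\<forall>i\<in>S. u i \<noteq> 0"
    and f: "distinct (w # vs)" "set (w # vs) = S" "E \<inter> S \<times> S = fan_arcs w vs"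
    using form_le_fan_value(2)[OF finS, of u] S V eq(1) chain(2) by auto
  have "?P = S" using all S by auto
  then show "card ?P = q \<and> bform (adj E) V u v = 0 \<and>
      (\<exists>w vs. distinct (w # vs) \<and> set (w # vs) = ?P \<and> E \<inter> ?P \<times> ?P = fan_arcs w vs)"
    using f eq(2) S by auto
qed

text \<open>One support has at most \<open>q\<close> vertices. In the case of equality it has exactly \<open>q\<close>, so the other one has
at most \<open>q\<close> and the same applies to it.\<close>

lemma nodal_bound:
  assumes fin: "finite V" and V: "card V = 2 * q" "40001 \<le> q" and nod: "nodal_pair (adj E) V t u v"
  shows "t \<le> fan_value q"
    and "t = fan_value q \<Longrightarrow> \<exists>w vs w' vs'. distinct (w # vs @ w' # vs') \<and> set (w # vs @ w' # vs') = V \<and>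
      length (w # vs) = q \<and> length (w' # vs') = q \<and> E \<inter> V \<times> V = fan_arcs w vs \<union> fan_arcs w' vs'"
proof -
  let ?P = "{i\<in>V. u i \<noteq> 0}" and ?N = "{i\<in>V. v i \<noteq> 0}"
  have nod': "nodal_pair (adj E) V t v u" using nodal_pair_commute[OF adjacency_sym nod] .
  have disj: "?P \<inter> ?N = {}" using nod by (auto simp: nodal_pair_def)
  have "card ?P + card ?N = card (?P \<union> ?N)" using disj fin by (subst card_Un_disjoint) auto
  also have "\<dots> \<le> card V" using fin by (intro card_mono) auto
  finally have sum: "card ?P + card ?N \<le> 2 * q" using V by simp
  then have small: "card ?P \<le> q \<or> card ?N \<le> q" by linarith
  then show "t \<le> fan_value q" using nodal_half(1)[OF fin V nod] nodal_half(1)[OF fin V nod'] by blast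
  assume t: "t = fan_value q"
  have P: "card ?P \<le> q"
    using small nodal_half(2)[OF fin V nod' _ t] sum by auto
  have N: "card ?N \<le> q"
    using small nodal_half(2)[OF fin V nod _ t] sum by auto
  obtain w vs where f: "card ?P = q" "bform (adj E) V u v = 0" "distinct (w # vs)" "set (w # vs) = ?P"
    "E \<inter> ?P \<times> ?P = fan_arcs w vs" using nodal_half(2)[OF fin V nod P t] by blast
  obtain w' vs' where f': "card ?N = q" "distinct (w' # vs')" "set (w' # vs') = ?N"
    "E \<inter> ?N \<times> ?N = fan_arcs w' vs'" using nodal_half(2)[OF fin V nod' N t] by blast
  have "card (?P \<union> ?N) = card V" using disj fin f f' V by (subst card_Un_disjoint) auto
  then have PN: "?P \<union> ?N = V" using fin by (intro card_subset_eq) auto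
  have cross: "(i, j) \<notin> E" if "i \<in> ?P" "j \<in> ?N" for i j
  proof
    assume ij: "(i, j) \<in> E"
    have nn: "0 \<le> adj E i j * u i * v j" for i j using nod by (auto simp: adj_nonneg nodal_pair_def)
    then have "\<forall>i\<in>V. \<forall>j\<in>V. adj E i j * u i * v j = 0"
      using f(2) fin unfolding bform_def by (simp add: sum_nonneg_eq_0_iff sum_nonneg)
    then have "adj E i j * u i * v j = 0" using that by blast
    then show False using ij that by (simp add: adj_def)
  qed
  have "E \<inter> V \<times> V = (E \<inter> ?P \<times> ?P) \<union> (E \<inter> ?N \<times> ?N)"
  proof
    show "E \<inter> V \<times> V \<subseteq> (E \<inter> ?P \<times> ?P) \<union> (E \<inter> ?N \<times> ?N)"
    proof
      fix e assume e: "e \<in> E \<inter> V \<times> V"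
      obtain i j where ij: "e = (i, j)" by (cases e)
      have "i \<in> ?P \<or> i \<in> ?N" "j \<in> ?P \<or> j \<in> ?N" using e PN unfolding ij by blast+
      then show "e \<in> (E \<inter> ?P \<times> ?P) \<union> (E \<inter> ?N \<times> ?N)"
        using e cross[of i j] cross[of j i] sym[of i j] unfolding ij by blast
    qed
  qed auto
  then have arcs: "E \<inter> V \<times> V = fan_arcs w vs \<union> fan_arcs w' vs'" unfolding f(5) f'(4) .
  have "distinct (w # vs @ w' # vs')" using f(3,4) f'(2,3) disj by auto
  moreover have "set (w # vs @ w' # vs') = V" using f(4) f'(3) PN by auto
  moreover have "length (w # vs) = q" "length (w' # vs') = q"
    using f(1,3,4) f'(1,2,3) by (metis distinct_card)+
  ultimately show "\<exists>w vs w' vs'. distinct (w # vs @ w' # vs') \<and> set (w # vs @ w' # vs') = V \<and>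
      length (w # vs) = q \<and> length (w' # vs') = q \<and> E \<inter> V \<times> V = fan_arcs w vs \<union> fan_arcs w' vs'"
    using arcs by blast
qed

end

definition double_fan :: "nat \<Rightarrow> 'a pair_pre_digraph \<Rightarrow> bool" where
  "double_fan q G \<longleftrightarrow> (\<exists>w vs w' vs'. distinct (w # vs @ w' # vs') \<and> length (w # vs) = q \<and>
     length (w' # vs') = q \<and> pverts G = set (w # vs @ w' # vs') \<and>
     parcs G = fan_arcs w vs \<union> fan_arcs w' vs')"

lemma outerplanar_graph: "outerplanar G \<Longrightarrow> pair_graph G"
  by (simp add: outerplanar_def)

theorem outerplanar_lambda_2:
  assumes G: "outerplanar G" and n: "card (pverts G) = 2 * q" "40001 \<le> q"
  shows "graph_lambda 2 G \<le> fan_value q"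
    and "graph_lambda 2 G = fan_value q \<Longrightarrow> double_fan q G"
proof -
  interpret pair_graph G by (rule outerplanar_graph[OF G])
  interpret T: theta_K4_free "parcs G" by (rule outerplanar_theta_K4_free[OF G])
  have fin: "finite (pverts G)" by (rule pair_finite_verts)
  obtain x y where "eigenfunction G (graph_lambda 1 G) x" "eigenfunction G (graph_lambda 2 G) y"
    "(\<Sum>i\<in>pverts G. x i * y i) = 0" "graph_lambda 2 G \<le> graph_lambda 1 G"
    using two_largest_eigenfunctions[OF fin T.sym] n by auto
  then obtain u v where nod: "nodal_pair (adj (parcs G)) (pverts G) (graph_lambda 2 G) u v"
    using exists_nodal_pair[where a = "adj (parcs G)", OF fin T.adjacency_sym] unfolding eigenfunction_def by blast
  show "graph_lambda 2 G \<le> fan_value q" by (rule T.nodal_bound(1)[OF fin n nod])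
  have "parcs G \<inter> pverts G \<times> pverts G = parcs G" using wellformed' by auto
  moreover assume "graph_lambda 2 G = fan_value q"
  then obtain w vs w' vs' where "distinct (w # vs @ w' # vs')" "set (w # vs @ w' # vs') = pverts G"
    "length (w # vs) = q" "length (w' # vs') = q"
    "parcs G \<inter> pverts G \<times> pverts G = fan_arcs w vs \<union> fan_arcs w' vs'"
    using T.nodal_bound(2)[OF fin n nod] by blast
  ultimately show "double_fan q G" unfolding double_fan_def
    by (intro exI[of _ w] exI[of _ vs] exI[of _ w'] exI[of _ vs'] conjI) simp_all
qed

text \<open>The hypotheses on \<open>E\<close> say that the fan is a union of components, so its eigenvector may be continued
by zero.\<close>

lemma fan_eigenfunction_extends:
  assumes d: "distinct (w # vs)" "vs \<noteq> []" and V: "finite V" "set (w # vs) \<subseteq> V"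
    and arcs: "E \<inter> set (w # vs) \<times> V = fan_arcs w vs" "E \<inter> (V - set (w # vs)) \<times> set (w # vs) = {}"
  shows "\<exists>x. sqnorm V x \<noteq> 0 \<and> (\<forall>i\<in>V. (\<Sum>j\<in>V. adj E i j * x j) = fan_value (length (w # vs)) * x i) \<and>
    (\<forall>i. i \<notin> set (w # vs) \<longrightarrow> x i = 0)"
proof -
  let ?S = "set (w # vs)"
  have S: "finite ?S" "?S \<noteq> {}" by auto
  have sym: "adj (fan_arcs w vs) i j = adj (fan_arcs w vs) j i" for i j
    by (rule adj_sym) (rule fan_arcs_sym)
  obtain y where y: "sqnorm ?S y = 1"
    "\<forall>i\<in>?S. (\<Sum>j\<in>?S. adj (fan_arcs w vs) i j * y j) = fan_value (length (w # vs)) * y i"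
    using top_value_eigenvector[where a = "adj (fan_arcs w vs)", OF S sym] unfolding top_value_fan[OF d(1)] by blast
  define x where "x i = (if i \<in> ?S then y i else 0)" for i
  have "sqnorm V x = sqnorm ?S x"
    unfolding sqnorm_def by (rule sum.mono_neutral_right) (use V in \<open>auto simp: x_def\<close>)
  also have "\<dots> = sqnorm ?S y" by (rule sqnorm_cong) (simp add: x_def)
  finally have "sqnorm V x \<noteq> 0" using y(1) by simp
  moreover have "(\<Sum>j\<in>V. adj E i j * x j) = fan_value (length (w # vs)) * x i" if i: "i \<in> V" for i
  proof -
    have "(\<Sum>j\<in>V. adj E i j * x j) = (\<Sum>j\<in>?S. adj E i j * x j)"
      by (rule sum.mono_neutral_right) (use V in \<open>auto simp: x_def\<close>)
    also have "\<dots> = fan_value (length (w # vs)) * x i"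
    proof (cases "i \<in> ?S")
      case True
      have "adj E i j = adj (fan_arcs w vs) i j" if "j \<in> ?S" for j
        unfolding arcs(1)[symmetric] using True that V by (auto simp: adj_def)
      then have "(\<Sum>j\<in>?S. adj E i j * x j) = (\<Sum>j\<in>?S. adj (fan_arcs w vs) i j * y j)"
        by (intro sum.cong) (auto simp: x_def)
      then show ?thesis using bspec[OF y(2) True] True by (simp add: x_def del: list.set)
    next
      case False
      have "adj E i j = 0" if "j \<in> ?S" for j using arcs(2) i False that by (auto simp: adj_def)
      then have "(\<Sum>j\<in>?S. adj E i j * x j) = 0" by (intro sum.neutral) auto
      then show ?thesis using False by (simp add: x_def)
    qed
    finally show ?thesis .
  qed
  moreover have "\<forall>i. i \<notin> ?S \<longrightarrow> x i = 0" by (simp add: x_def)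
  ultimately show ?thesis by blast
qed

lemma double_fan_lambda_2_ge:
  assumes G: "double_fan q G" and q: "2 \<le> q"
  shows "fan_value q \<le> graph_lambda 2 G"
proof -
  obtain w vs w' vs' where d: "distinct (w # vs @ w' # vs')" and len: "length (w # vs) = q" "length (w' # vs') = q"
    and V: "pverts G = set (w # vs @ w' # vs')" and arcs: "parcs G = fan_arcs w vs \<union> fan_arcs w' vs'"
    using G unfolding double_fan_def by blast
  have disj: "set (w # vs) \<inter> set (w' # vs') = {}" using d by auto
  have sub: "fan_arcs w vs \<subseteq> set (w # vs) \<times> set (w # vs)" "fan_arcs w' vs' \<subseteq> set (w' # vs') \<times> set (w' # vs')"
    by (rule fan_arcs_subset)+
  have V': "pverts G = set (w # vs) \<union> set (w' # vs')" by (auto simp: V)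
  have fin: "finite (pverts G)" unfolding V by (rule finite_set)
  have d': "distinct (w # vs)" "vs \<noteq> []" "distinct (w' # vs')" "vs' \<noteq> []" using d len q by auto
  have subV: "set (w # vs) \<subseteq> pverts G" "set (w' # vs') \<subseteq> pverts G" unfolding V' by blast+
  have "parcs G \<inter> set (w # vs) \<times> pverts G = fan_arcs w vs"
    "parcs G \<inter> (pverts G - set (w # vs)) \<times> set (w # vs) = {}"
    using sub disj unfolding V' arcs by blast+
  from fan_eigenfunction_extends[OF d'(1,2) fin subV(1) this] obtain x where x: "sqnorm (pverts G) x \<noteq> 0"
    "\<forall>i\<in>pverts G. (\<Sum>j\<in>pverts G. adj (parcs G) i j * x j) = fan_value q * x i"
    "\<forall>i. i \<notin> set (w # vs) \<longrightarrow> x i = 0" unfolding len by blast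
  have "parcs G \<inter> set (w' # vs') \<times> pverts G = fan_arcs w' vs'"
    "parcs G \<inter> (pverts G - set (w' # vs')) \<times> set (w' # vs') = {}"
    using sub disj unfolding V' arcs by blast+
  from fan_eigenfunction_extends[OF d'(3,4) fin subV(2) this] obtain y where y: "sqnorm (pverts G) y \<noteq> 0"
    "\<forall>i\<in>pverts G. (\<Sum>j\<in>pverts G. adj (parcs G) i j * y j) = fan_value q * y i"
    "\<forall>i. i \<notin> set (w' # vs') \<longrightarrow> y i = 0" unfolding len by blast
  show ?thesis
  proof (rule graph_lambda_2_ge[OF fin])
    show "(u, v) \<in> parcs G \<Longrightarrow> (v, u) \<in> parcs G" for u v
      unfolding arcs using fan_arcs_sym by fast
    show "eigenfunction G (fan_value q) x" "eigenfunction G (fan_value q) y"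
      using x y by (auto simp: eigenfunction_def)
    have "x i * y i = 0" for i using x(3) y(3) disj by (cases "i \<in> set (w # vs)") auto
    then show "(\<Sum>i\<in>pverts G. x i * y i) = 0" by (intro sum.neutral) blast
  qed
qed

section \<open>Isomorphism of double fans\<close>

lemma exists_map_eq:
  "distinct xs \<Longrightarrow> length xs = length ys \<Longrightarrow> \<exists>f. map f xs = ys"
proof (induction xs arbitrary: ys)
  case (Cons x xs)
  then obtain y ys' where ys: "ys = y # ys'" by (cases ys) auto
  then obtain f where "map f xs = ys'" using Cons by auto
  then have "map (f(x := y)) (x # xs) = ys" using Cons.prems ys by auto
  then show ?case by blast
qed simp

lemma digraph_iso_of_map:
  assumes "wf_digraph (with_proj G)" and inj: "inj_on f (pverts G)"
    and V: "pverts H = f ` pverts G" and A: "parcs H = map_prod f f ` parcs G"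
  shows "digraph_iso (with_proj G) (with_proj H)"
proof -
  interpret wf_digraph "with_proj G" by (rule assms(1))
  define h where "h = \<lparr>iso_verts = f, iso_arcs = map_prod f f, iso_head = snd, iso_tail = fst\<rparr>"
  have "parcs G \<subseteq> pverts G \<times> pverts G" using tail_in_verts head_in_verts by fastforce
  then have "inj_on (map_prod f f) (parcs G)" using map_prod_inj_on[OF inj inj] inj_on_subset by blast
  then have "digraph_isomorphism h"
    unfolding digraph_isomorphism_def using assms(1) inj by (simp add: h_def)
  moreover have "with_proj H = app_iso h (with_proj G)"
    unfolding app_iso_def with_proj_def by (simp add: h_def V A)
  ultimately show ?thesis unfolding digraph_iso_def by blast
qed

lemma map_of_digraph_iso:
  assumes "digraph_iso (with_proj G) (with_proj H)"
  shows "\<exists>f. inj_on f (pverts G) \<and> pverts H = f ` pverts G \<and> parcs H = map_prod f f ` parcs G \<and>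
    parcs G \<subseteq> pverts G \<times> pverts G"
proof -
  obtain h where h: "pre_digraph.digraph_isomorphism (with_proj G) h" and H: "with_proj H = app_iso h (with_proj G)"
    using assms unfolding digraph_iso_def by blast
  interpret wf_digraph "with_proj G" using h by (simp add: pre_digraph.digraph_isomorphism_def)
  let ?f = "iso_verts h"
  have eq: "pverts H = ?f ` pverts G" "parcs H = iso_arcs h ` parcs G" "iso_tail h = fst" "iso_head h = snd"
    using H by (simp_all add: app_iso_def with_proj_def)
  have "iso_arcs h e = map_prod ?f ?f e" if "e \<in> parcs G" for e
    using h that unfolding digraph_isomorphism_def by (intro prod_eqI) (auto simp: eq)
  then have "parcs H = map_prod ?f ?f ` parcs G" unfolding eq(2) by (intro image_cong) auto
  moreover have "inj_on ?f (pverts G)" using h unfolding digraph_isomorphism_def by simp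
  moreover have "parcs G \<subseteq> pverts G \<times> pverts G" using tail_in_verts head_in_verts by fastforce
  ultimately show ?thesis using eq(1) by blast
qed

lemma double_fan_iso:
  assumes wf: "wf_digraph (with_proj G)" and G: "double_fan q G" and H: "double_fan q H"
  shows "digraph_iso (with_proj G) (with_proj H)"
proof -
  obtain w vs w' vs' where d: "distinct (w # vs @ w' # vs')" and len: "length (w # vs) = q" "length (w' # vs') = q"
    and V: "pverts G = set (w # vs @ w' # vs')" and arcs: "parcs G = fan_arcs w vs \<union> fan_arcs w' vs'"
    using G unfolding double_fan_def by blast
  obtain a as a' as' where d2: "distinct (a # as @ a' # as')" and len2: "length (a # as) = q" "length (a' # as') = q"
    and V2: "pverts H = set (a # as @ a' # as')" and arcs2: "parcs H = fan_arcs a as \<union> fan_arcs a' as'"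
    using H unfolding double_fan_def by blast
  obtain f where f: "map f (w # vs @ w' # vs') = a # as @ a' # as'"
    using exists_map_eq[OF d] len len2 by (metis append_Cons length_append)
  then have f': "f w = a" "map f vs = as" "f w' = a'" "map f vs' = as'"
    using len len2 by auto
  have "distinct (map f (w # vs @ w' # vs'))" unfolding f by (rule d2)
  then have "inj_on f (pverts G)" unfolding V by (simp only: distinct_map)
  moreover have "pverts H = f ` pverts G" unfolding V V2 f[symmetric] by (rule set_map)
  moreover have "parcs H = map_prod f f ` parcs G"
    unfolding arcs arcs2 image_Un fan_arcs_map[symmetric] f' ..
  ultimately show ?thesis by (rule digraph_iso_of_map[OF wf])
qed

lemma double_fan_of_iso:
  assumes iso: "digraph_iso (with_proj G) (with_proj H)" and H: "double_fan q H"
  shows "double_fan q G"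
proof -
  obtain f where f: "inj_on f (pverts G)" "pverts H = f ` pverts G" "parcs H = map_prod f f ` parcs G"
    "parcs G \<subseteq> pverts G \<times> pverts G" using map_of_digraph_iso[OF iso] by blast
  define g where "g = the_inv_into (pverts G) f"
  have gf: "g (f x) = x" if "x \<in> pverts G" for x using f(1) that by (simp add: g_def the_inv_into_f_f)
  have inj: "inj_on g (pverts H)" unfolding f(2) by (auto intro!: inj_onI simp: gf)
  have V: "pverts G = g ` pverts H" unfolding f(2) by (force simp: gf image_image)
  have "map_prod g g (map_prod f f e) = e" if "e \<in> parcs G" for e using that f(4) gf by (cases e) auto
  then have A: "parcs G = map_prod g g ` parcs H" unfolding f(3) image_image by (simp cong: image_cong)
  obtain w vs w' vs' where d: "distinct (w # vs @ w' # vs')" and len: "length (w # vs) = q" "length (w' # vs') = q"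
    and VH: "pverts H = set (w # vs @ w' # vs')" and arcs: "parcs H = fan_arcs w vs \<union> fan_arcs w' vs'"
    using H unfolding double_fan_def by blast
  have "distinct (map g (w # vs @ w' # vs'))" using d inj unfolding VH distinct_map by simp
  moreover have "pverts G = set (map g (w # vs @ w' # vs'))" unfolding V VH by (rule set_map[symmetric])
  moreover have "parcs G = fan_arcs (g w) (map g vs) \<union> fan_arcs (g w') (map g vs')"
    unfolding A arcs image_Un fan_arcs_map ..
  ultimately show ?thesis unfolding double_fan_def
    using len by (intro exI[of _ "g w"] exI[of _ "map g vs"] exI[of _ "g w'"] exI[of _ "map g vs'"]) simp
qed

section \<open>Outerplanar drawings on a parabola\<close>

definition parabola :: "real \<Rightarrow> complex" where "parabola t = Complex t (t\<^sup>2)"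

lemma parabola_simps [simp]: "Re (parabola t) = t" "Im (parabola t) = t\<^sup>2"
  by (simp_all add: parabola_def)

lemma parabola_eq_iff [simp]: "parabola s = parabola t \<longleftrightarrow> s = t"
  by (auto simp: complex_eq_iff)

lemma eq_parabola_iff: "z = parabola t \<longleftrightarrow> Re z = t \<and> Im z = t\<^sup>2"
  by (auto simp: complex_eq_iff)

lemma chord_point:
  assumes "z \<in> closed_segment (parabola s) (parabola t)" "s < t"
  shows "s \<le> Re z" "Re z \<le> t" "Im z = (Re z)\<^sup>2 + (Re z - s) * (t - Re z)"
proof -
  obtain r where r: "0 \<le> r" "r \<le> 1" "z = (1 - r) *\<^sub>R parabola s + r *\<^sub>R parabola t"
    using assms(1) by (auto simp: in_segment)
  have Re: "Re z = s + r * (t - s)" by (simp add: r(3) algebra_simps)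
  show "s \<le> Re z" using r(1) assms(2) by (simp add: Re)
  have "r * (t - s) \<le> 1 * (t - s)" using r(2) assms(2) by (intro mult_right_mono) auto
  then show "Re z \<le> t" by (simp add: Re)
  have "Im z = (1 - r) * s\<^sup>2 + r * t\<^sup>2" by (simp add: r(3))
  then show "Im z = (Re z)\<^sup>2 + (Re z - s) * (t - Re z)"
    by (simp add: Re algebra_simps power2_eq_square)
qed

lemma chord_on_parabola:
  assumes "z \<in> closed_segment (parabola s) (parabola t)" "s < t" "Im z = (Re z)\<^sup>2"
  shows "z \<in> {parabola s, parabola t}"
  using chord_point[OF assms(1,2)] assms(3) by (auto simp: eq_parabola_iff)

text \<open>The height of a chord from \<open>s\<close> to \<open>t\<close> above the parabola at \<open>r\<close> is \<open>(r - s) * (t - r)\<close>, so over the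
interior of its interval the inner chord is strictly below the outer one.\<close>

lemma nested_chords_meet:
  assumes z: "z \<in> closed_segment (parabola s) (parabola t)" "z \<in> closed_segment (parabola s') (parabola t')"
    and le: "s' < t'" "s \<le> s'" "t' \<le> t" and ne: "(s, t) \<noteq> (s', t')"
  shows "Im z = (Re z)\<^sup>2"
proof (rule ccontr)
  assume *: "Im z \<noteq> (Re z)\<^sup>2"
  have st: "s < t" using le by linarith
  note 1 = chord_point[OF z(1) st] and 2 = chord_point[OF z(2) le(1)]
  have "Re z \<noteq> s'" "Re z \<noteq> t'" using * 2(3) by auto
  then have in2: "0 < Re z - s'" "0 < t' - Re z" using 2 by auto
  have "(Re z - s') * (t' - Re z) < (Re z - s) * (t - Re z)"
  proof (cases "s < s'")
    case True
    then show ?thesis using in2 le by (intro mult_less_le_imp_less) auto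
  next
    case False
    then show ?thesis using in2 le ne by (intro mult_le_less_imp_less) auto
  qed
  then show False using 1(3) 2(3) by simp
qed

lemma laminar_chords_meet:
  assumes z: "z \<in> closed_segment (parabola s) (parabola t)" "z \<in> closed_segment (parabola s') (parabola t')"
    and lt: "s < t" "s' < t'" and ne: "(s, t) \<noteq> (s', t')"
    and laminar: "t \<le> s' \<or> t' \<le> s \<or> (s \<le> s' \<and> t' \<le> t) \<or> (s' \<le> s \<and> t \<le> t')"
  shows "z \<in> {parabola s, parabola t}"
proof -
  note 1 = chord_point[OF z(1) lt(1)] and 2 = chord_point[OF z(2) lt(2)]
  have "Im z = (Re z)\<^sup>2"
    using laminar
  proof (elim disjE)
    assume "t \<le> s'" then show ?thesis using 1 2 by auto
  next
    assume "t' \<le> s" then show ?thesis using 1 2 by auto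
  next
    assume "s \<le> s' \<and> t' \<le> t" then show ?thesis using nested_chords_meet[OF z] lt ne by auto
  next
    assume "s' \<le> s \<and> t \<le> t'" then show ?thesis using nested_chords_meet[OF z(2,1)] lt ne by auto
  qed
  then show ?thesis by (rule chord_on_parabola[OF z(1) lt(1)])
qed

text \<open>The vertical ray downwards from \<open>z\<close> stays below the parabola.\<close>

lemma below_parabola_outside:
  assumes D: "\<And>z. z \<in> D \<Longrightarrow> (Re z)\<^sup>2 \<le> Im z" and z: "Im z < (Re z)\<^sup>2"
  shows "z \<in> outside D"
proof -
  let ?T = "(\<lambda>s. Complex (Re z) s) ` {..Im z}"
  have "Complex (Re z) = (\<lambda>s. complex_of_real (Re z) + \<i> * complex_of_real s)"
    by (auto simp: complex_eq_iff)
  then have "continuous_on {..Im z} (Complex (Re z))" by (simp add: continuous_intros)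
  then have con: "Topological_Spaces.connected ?T" by (rule connected_continuous_image) auto
  have sub: "?T \<subseteq> - D"
  proof
    fix y assume "y \<in> ?T"
    then have "Re y = Re z" "Im y \<le> Im z" by auto
    then show "y \<in> - D" using D[of y] z by auto
  qed
  have zT: "z \<in> ?T" by (rule image_eqI[of _ _ "Im z"]) auto
  have "?T \<subseteq> connected_component_set (- D) z" by (rule connected_component_maximal[OF zT con sub])
  moreover have "\<not> bounded ?T"
  proof
    assume "bounded ?T"
    then obtain B where B: "\<And>y. y \<in> ?T \<Longrightarrow> norm y \<le> B" by (auto simp: bounded_iff)
    have "\<bar>min (Im z) (- B - 1)\<bar> \<le> norm (Complex (Re z) (min (Im z) (- B - 1)))"
      using abs_Im_le_cmod[of "Complex (Re z) (min (Im z) (- B - 1))"] by simp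
    also have "\<dots> \<le> B" by (rule B) auto
    finally show False by linarith
  qed
  ultimately have "\<not> bounded (connected_component_set (- D) z)" using bounded_subset by blast
  then show ?thesis using D[of z] z by (auto simp: outside_def)
qed

text \<open>Vertices are placed on the parabola at the abscissas \<open>f v\<close>, and edges are drawn as chords. By
hypothesis, the intervals below two chords have disjoint interiors or are nested, so the chords
meet at most in ends. No chord goes below the parabola, so every vertex
can be reached from below.\<close>

theorem laminar_imp_outerplanar:
  fixes G :: "'a pair_pre_digraph" and f :: "'a \<Rightarrow> real"
  assumes G: "pair_graph G" and inj: "inj_on f (pverts G)"
    and laminar: "\<And>u v x y. \<lbrakk>(u, v) \<in> parcs G; (x, y) \<in> parcs G; f u < f v; f x < f y\<rbrakk> \<Longrightarrow>
      f v \<le> f x \<or> f y \<le> f u \<or> (f u \<le> f x \<and> f y \<le> f v) \<or> (f x \<le> f u \<and> f v \<le> f y)"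
  shows "outerplanar G"
proof -
  define p where "p v = parabola (f v)" for v
  define c where "c e = linepath (p (fst e)) (p (snd e))" for e
  have ends: "u \<in> pverts G" "v \<in> pverts G" "f u \<noteq> f v" if "(u, v) \<in> parcs G" for u v
  proof -
    show uv: "u \<in> pverts G" "v \<in> pverts G" using pair_graph_arcD[OF G that] by blast+
    then show "f u \<noteq> f v" using inj pair_graph_arcD(3)[OF G that] by (auto dest: inj_onD)
  qed
  have orient: "\<exists>a b. (a, b) \<in> parcs G \<and> f a < f b \<and> {a, b} = {u, v} \<and>
      path_image (c (u, v)) = closed_segment (parabola (f a)) (parabola (f b))" if uv: "(u, v) \<in> parcs G" for u v
  proof (cases "f u < f v")
    case True
    then show ?thesis using uv by (intro exI[of _ u] exI[of _ v]) (simp add: c_def p_def)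
  next
    case False
    have "(v, u) \<in> parcs G" by (rule pair_graph_arcD(4)[OF G uv])
    then show ?thesis using False ends(3)[OF uv]
      by (intro exI[of _ v] exI[of _ u]) (auto simp: c_def p_def closed_segment_commute)
  qed
  have plane: "plane_drawing G p c"
    unfolding plane_drawing_def
  proof (intro conjI ballI; (elim case_prodI2 | clarify)?)
    show "inj_on p (pverts G)" using inj by (auto simp: inj_on_def p_def)
  next
    fix u v assume uv: "(u, v) \<in> parcs G"
    show "arc (c (u, v)) \<and> pathstart (c (u, v)) = p u \<and> pathfinish (c (u, v)) = p v \<and>
        c (v, u) = reversepath (c (u, v))"
      using ends(3)[OF uv] by (auto simp: c_def p_def intro!: arc_linepath)
  next
    fix u v assume uv: "(u, v) \<in> parcs G"
    obtain a b where ab: "(a, b) \<in> parcs G" "f a < f b" "{a, b} = {u, v}"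
      "path_image (c (u, v)) = closed_segment (parabola (f a)) (parabola (f b))"
      using orient[OF uv] by blast
    have "p y \<in> {p a, p b}" if "p y \<in> path_image (c (u, v))" for y
      using chord_on_parabola[of "p y", OF _ ab(2)] that unfolding ab(4) p_def by simp
    then have "path_image (c (u, v)) \<inter> p ` pverts G \<subseteq> {p a, p b}" by blast
    moreover have "{p a, p b} = {p u, p v}" using ab(3) by (metis image_empty image_insert)
    moreover have "{p u, p v} \<subseteq> path_image (c (u, v)) \<inter> p ` pverts G"
      using ends[OF uv] by (auto simp: c_def)
    ultimately show "path_image (c (u, v)) \<inter> p ` pverts G = {p u, p v}" by blast
  next
    fix u v x y z
    assume uv: "(u, v) \<in> parcs G" and xy: "(x, y) \<in> parcs G" and ne: "{u, v} \<noteq> {x, y}"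
      and z: "z \<in> path_image (c (u, v))" "z \<in> path_image (c (x, y))"
    obtain a b where ab: "(a, b) \<in> parcs G" "f a < f b" "{a, b} = {u, v}"
      "path_image (c (u, v)) = closed_segment (parabola (f a)) (parabola (f b))"
      using orient[OF uv] by blast
    obtain a' b' where ab': "(a', b') \<in> parcs G" "f a' < f b'" "{a', b'} = {x, y}"
      "path_image (c (x, y)) = closed_segment (parabola (f a')) (parabola (f b'))"
      using orient[OF xy] by blast
    have "(f a, f b) \<noteq> (f a', f b')"
    proof
      assume "(f a, f b) = (f a', f b')"
      then have "a = a'" "b = b'" using inj ends[OF ab(1)] ends[OF ab'(1)] by (auto dest: inj_onD)
      then show False using ne ab(3) ab'(3) by simp
    qed
    then have "z \<in> {p a, p b}" unfolding p_def
      using laminar_chords_meet[OF z[unfolded ab(4) ab'(4)] ab(2) ab'(2)] laminar[OF ab(1) ab'(1) ab(2) ab'(2)] by blast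
    then show "z \<in> p ` pverts G" using ends[OF ab(1)] by auto
  qed
  let ?D = "drawing_points G p c"
  have above: "(Re z)\<^sup>2 \<le> Im z" if z: "z \<in> ?D" for z
  proof -
    consider v where "z = p v" | u v where "(u, v) \<in> parcs G" "z \<in> path_image (c (u, v))"
      using z by (auto simp: drawing_points_def)
    then show ?thesis
    proof cases
      case 2
      then obtain a b where "f a < f b" "z \<in> closed_segment (parabola (f a)) (parabola (f b))"
        using orient[OF 2(1)] by blast
      then show ?thesis using chord_point[of z "f a" "f b"] by simp
    qed (simp add: p_def)
  qed
  have "p v \<in> frontier (outside ?D)" if v: "v \<in> pverts G" for v
  proof -
    have "p v \<in> closure (outside ?D)"
      unfolding closure_approachable
    proof (intro allI impI)
      fix e :: real assume e: "0 < e"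
      \<comment> \<open>A point vertically below the vertex, hence below the parabola.\<close>
      let ?z = "p v - \<i> * of_real (e / 2)"
      have z: "Re ?z = f v" "Im ?z = (f v)\<^sup>2 - e / 2" by (simp_all add: p_def)
      have "Im ?z < (Re ?z)\<^sup>2" unfolding z using e by simp
      with above have "?z \<in> outside ?D" by (rule below_parabola_outside)
      moreover have "dist ?z (p v) < e" using e by (simp add: dist_norm norm_mult)
      ultimately show "\<exists>y\<in>outside ?D. dist y (p v) < e" by blast
    qed
    moreover have "p v \<in> ?D" using v by (simp add: drawing_points_def)
    then have "p v \<notin> interior (outside ?D)"
      using interior_subset outside_no_overlap[of ?D] by blast
    ultimately show ?thesis by (simp add: frontier_def)
  qed
  then show ?thesis unfolding outerplanar_def using G plane by blast
qed

section \<open>The extremal graph\<close>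

lemma list_arcs_upt: "list_arcs [a..<b] = {(i, j). a \<le> i \<and> j = Suc i \<and> j < b}"
proof (induction b)
  case (Suc b)
  show ?case
  proof (cases "a < b")
    case True
    then have "list_arcs [a..<Suc b] = insert (b - 1, b) (list_arcs [a..<b])"
      by (simp add: list_arcs_append last_upt)
    then show ?thesis using Suc True by auto
  qed (cases "a = b"; auto)
qed simp

lemma double_fan_pair_graph:
  assumes "double_fan q G"
  shows "pair_graph G"
proof -
  obtain w vs w' vs' where d: "distinct (w # vs @ w' # vs')"
    and V: "pverts G = set (w # vs @ w' # vs')" and arcs: "parcs G = fan_arcs w vs \<union> fan_arcs w' vs'"
    using assms unfolding double_fan_def by blast
  have sub: "parcs G \<subseteq> pverts G \<times> pverts G"
    using fan_arcs_subset[of w vs] fan_arcs_subset[of w' vs'] unfolding arcs V by auto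
  have "finite (pverts G)" by (simp add: V)
  moreover from this have "finite (parcs G)" using sub finite_subset by blast
  moreover have "fst e \<noteq> snd e" if "e \<in> parcs G" for e
    using that d fan_arcs_loopfree[of w vs] fan_arcs_loopfree[of w' vs'] unfolding arcs by (cases e) auto
  moreover have "symmetric (with_proj G)"
    unfolding symmetric_def sym_def by (auto simp: arcs intro: fan_arcs_sym)
  ultimately show ?thesis using sub by unfold_locales auto
qed

text \<open>The vertices are numbered along the two lists, so that every edge joins consecutive numbers or
starts at the apex \<open>0\<close> or \<open>q\<close> of its fan. Such intervals are nested or have disjoint interiors.\<close>

lemma double_fan_outerplanar:
  assumes G: "double_fan q G"
  shows "outerplanar G"
proof -
  obtain w vs w' vs' where d: "distinct (w # vs @ w' # vs')" and len: "length (w # vs) = q" "length (w' # vs') = q"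
    and V: "pverts G = set (w # vs @ w' # vs')" and arcs: "parcs G = fan_arcs w vs \<union> fan_arcs w' vs'"
    using G unfolding double_fan_def by blast
  have q: "0 < q" using len by auto
  have L: "[0..<2 * q] = 0 # [1..<q] @ q # [Suc q..<2 * q]"
  proof -
    have "[0..<2 * q] = [0..<q] @ [q..<2 * q]" using upt_add_eq_append[of 0 q q] by (simp add: mult_2)
    then show ?thesis using q upt_conv_Cons[of 0 q] upt_conv_Cons[of q "2 * q"] by simp
  qed
  obtain f where f: "map f (w # vs @ w' # vs') = [0..<2 * q]"
    using exists_map_eq[OF d, of "[0..<2 * q]"] len by auto
  then have f': "f w = 0" "map f vs = [1..<q]" "f w' = q" "map f vs' = [Suc q..<2 * q]"
    using len unfolding L by auto
  have "inj_on f (pverts G)"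
    using distinct_upt[of 0 "2 * q"] unfolding f[symmetric] V distinct_map by blast
  then have inj: "inj_on (\<lambda>v. real (f v)) (pverts G)" by (auto simp: inj_on_def)
  have arc: "f v = Suc (f u) \<or> (f u = 0 \<and> f v < q) \<or> (f u = q \<and> q < f v)" if uv: "(u, v) \<in> parcs G" "f u < f v" for u v
  proof -
    have "map_prod f f (u, v) \<in> fan_arcs (f w) (map f vs) \<union> fan_arcs (f w') (map f vs')"
      unfolding fan_arcs_map image_Un[symmetric] arcs[symmetric] using uv(1) by blast
    then have "(f u, f v) \<in> fan_arcs 0 [1..<q] \<union> fan_arcs q [Suc q..<2 * q]" unfolding f' by simp
    then show ?thesis using uv(2) by (auto simp: fan_arcs_def list_arcs_upt)
  qed
  show ?thesis
  proof (rule laminar_imp_outerplanar[OF double_fan_pair_graph[OF G] inj])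
    fix u v x y
    assume "(u, v) \<in> parcs G" "(x, y) \<in> parcs G" "real (f u) < real (f v)" "real (f x) < real (f y)"
    then show "real (f v) \<le> real (f x) \<or> real (f y) \<le> real (f u) \<or> (real (f u) \<le> real (f x) \<and> real (f y) \<le> real (f v)) \<or>
        (real (f x) \<le> real (f u) \<and> real (f v) \<le> real (f y))"
      using arc[of u v] arc[of x y] by auto
  qed
qed

lemma fan_graph:
  "pverts (graph_join K1 (path_graph m)) = set (Inl () # map Inr [0..<m])"
  "parcs (graph_join K1 (path_graph m)) = fan_arcs (Inl ()) (map Inr [0..<m])"
proof -
  have path: "parcs (path_graph m) = list_arcs [0..<m] \<union> (list_arcs [0..<m])\<inverse>"
    by (auto simp: path_graph_def list_arcs_upt)
  show "pverts (graph_join K1 (path_graph m)) = set (Inl () # map Inr [0..<m])"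
    by (auto simp: graph_join_def K1_def path_graph_def)
  have "map_prod Inr Inr ` parcs (path_graph m) = list_arcs (map Inr [0..<m]) \<union> (list_arcs (map Inr [0..<m]))\<inverse>"
    unfolding path list_arcs_map by force
  moreover have "pverts (path_graph m) = {0..<m}" by (auto simp: path_graph_def)
  ultimately show "parcs (graph_join K1 (path_graph m)) = fan_arcs (Inl ()) (map Inr [0..<m])"
    by (auto simp: graph_join_def disjoint_union_def K1_def fan_arcs_def)
qed

lemma double_fan_disjoint_union:
  assumes "0 < q"
  shows "double_fan q (disjoint_union (graph_join K1 (path_graph (q - 1))) (graph_join K1 (path_graph (q - 1))))"
  (is "double_fan q (disjoint_union ?F ?F)")
proof -
  let ?L = "map Inr [0..<q - 1] :: (unit + nat) list"
  have d: "distinct (Inl () # ?L)" by (auto simp: distinct_map)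
  have "distinct (map Inl (Inl () # ?L) @ map Inr (Inl () # ?L))"
    unfolding distinct_append distinct_map using d by (auto simp del: distinct.simps)
  moreover have "pverts (disjoint_union ?F ?F) = set (map Inl (Inl () # ?L) @ map Inr (Inl () # ?L))"
    unfolding disjoint_union_def by (simp add: fan_graph(1) Plus_def image_Un image_image insert_commute)
  moreover have "parcs (disjoint_union ?F ?F) = fan_arcs (Inl (Inl ())) (map Inl ?L) \<union> fan_arcs (Inr (Inl ())) (map Inr ?L)"
    unfolding disjoint_union_def fan_arcs_map by (simp add: fan_graph(2))
  ultimately show ?thesis unfolding double_fan_def using assms
    by (intro exI[of _ "Inl (Inl ())"] exI[of _ "map Inl ?L"] exI[of _ "Inr (Inl ())"] exI[of _ "map Inr ?L"]) simp
qed

lemma double_fan_card: "double_fan q G \<Longrightarrow> card (pverts G) = 2 * q"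
  unfolding double_fan_def by (auto simp: distinct_card simp del: distinct.simps set_append dest!: distinct_card)

theorem corollary1:
  shows "\<exists>n0. \<forall>n q. n = 2 * q \<and> n0 \<le> n \<longrightarrow>
    (let F = graph_join K1 (path_graph (q - 1));
         H = disjoint_union F F
     in outerplanar H \<and> card (pverts H) = n \<and>
        (\<forall>G :: 'a pair_pre_digraph. outerplanar G \<and> card (pverts G) = n \<longrightarrow>
           graph_lambda 2 G \<le> graph_lambda 2 H \<and>
           (graph_lambda 2 G = graph_lambda 2 H \<longleftrightarrow> digraph_iso G H)))"
\<comment> \<open>The comparison with the fan needs 40001 vertices in each half.\<close>
proof (intro exI[of _ 80002] allI impI)
  fix n q :: nat assume nq: "n = 2 * q \<and> 80002 \<le> n"
  then have q: "40001 \<le> q" by simp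
  define H where "H = disjoint_union (graph_join K1 (path_graph (q - 1))) (graph_join K1 (path_graph (q - 1)))"
  have H: "double_fan q H" unfolding H_def by (rule double_fan_disjoint_union) (use q in simp)
  have out: "outerplanar H" by (rule double_fan_outerplanar[OF H])
  have lamH: "graph_lambda 2 H = fan_value q"
    using outerplanar_lambda_2(1)[OF out double_fan_card[OF H] q] double_fan_lambda_2_ge[OF H] q by simp
  have "graph_lambda 2 G \<le> graph_lambda 2 H \<and> (graph_lambda 2 G = graph_lambda 2 H \<longleftrightarrow> digraph_iso G H)"
    if G: "outerplanar G" "card (pverts G) = n" for G :: "'a pair_pre_digraph"
  proof -
    have card: "card (pverts G) = 2 * q" using G nq by simp
    interpret pair_graph G by (rule outerplanar_graph[OF G(1)])
    have "digraph_iso G H" if "graph_lambda 2 G = graph_lambda 2 H"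
      using double_fan_iso[OF wf_digraph_axioms outerplanar_lambda_2(2)[OF G(1) card q] H] that lamH by simp
    moreover have "graph_lambda 2 G = graph_lambda 2 H" if "digraph_iso G H"
      using double_fan_lambda_2_ge[OF double_fan_of_iso[OF that H]] outerplanar_lambda_2(1)[OF G(1) card q] q lamH
      by simp
    ultimately show ?thesis using outerplanar_lambda_2(1)[OF G(1) card q] lamH by auto
  qed
  then show "let F = graph_join K1 (path_graph (q - 1)); H = disjoint_union F F
     in outerplanar H \<and> card (pverts H) = n \<and>
        (\<forall>G :: 'a pair_pre_digraph. outerplanar G \<and> card (pverts G) = n \<longrightarrow>
           graph_lambda 2 G \<le> graph_lambda 2 H \<and>
           (graph_lambda 2 G = graph_lambda 2 H \<longleftrightarrow> digraph_iso G H))"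
    using out double_fan_card[OF H] nq unfolding Let_def H_def[symmetric] by blast
qed

end
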